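(* (i) Let $H$ and $H'$ be almost twin-free Lebesguian graphons. Then $t(F,H)=t(F,H')$ holds for every finite simple graph $F$ if and only if $H$ and $H'$ are isomorphic mod $0$. (ii) Let $H$ and $H'$ be arbitrary graphons. Then $t(F,H)=t(F,H')$ holds for every finite simple graph $F$ if and only if $H$ and $H'$ are weakly isomorphic.
   Context: A graphon is a quadruple $H=(\Omega,\mathcal A,\pi,W)$ where $(\Omega,\mathcal A,\pi)$ is a probability space and $W:\Omega\times\Omega\to\mathbb R$ is a bounded symmetric function measurable with respect to the completion of $(\Omega\times\Omega,\mathcal A\times\mathcal A,\pi\times\pi)$ (here $\mathcal A\times\mathcal A$ is the product $\sigma$-algebra). For a finite graph $F$ with $V(F)=\{1,\dots,k\}$, $t(F,H)=\int_{\Omega^k}\prod_{ij\in E(F)}W(x_i,x_j)\,\prod_{i=1}^k d\pi(x_i)$. A simple graph has no loops and no multiple edges. A measure preserving map $\phi:\Omega\to\Omega'$ between probability spaces is an isomorphism if it is a bijection and both $\phi$ and $\phi^{-1}$ are measure preserving; it is an isomorphism mod $0$ if there are null sets $N\in\mathcal A$, $N'\in\mathcal A'$ such that $\phi$ restricted to $\Omega\setminus N$ is an isomorphism between $\Omega\setminus N$ and $\Omega'\setminus N'$ (with the restricted $\sigma$-algebras and measures). A Lebesgue space is a complete probability space that is isomorphic mod $0$ to the disjoint union of a closed interval (with Lebesgue sets and Lebesgue measure) and a countable set of atoms (either part may be absent). A graphon is Lebesguian if its underlying probability space is a Lebesgue space. For a graphon $H'=(\Omega',\mathcal A',\pi',W')$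 and a map $\phi:\Omega\to\Omega'$, the pull-back is $(W')^\phi(x,y)=W'(\phi(x),\phi(y))$. Graphons $H=(\Omega,\mathcal A,\pi,W)$ and $H'=(\Omega',\mathcal A',\pi',W')$ are isomorphic mod $0$ if there is an isomorphism mod $0$ $\phi:\Omega\to\Omega'$ with $(W')^\phi=W$ almost everywhere on $\Omega\times\Omega$. A weak isomorphism from $H=(\Omega,\mathcal A,\pi,W)$ to $G=(\Gamma,\mathcal B,\rho,U)$ is a map $\phi:\Omega\to\Gamma$ that is measure preserving from the completion $\overline{\mathcal A}$ into $\mathcal B$ and satisfies $W=U^\phi$ almost everywhere (it need not be invertible). $H$ and $H'$ are weakly isomorphic if there are a graphon $G$ and weak isomorphisms from $H$ to $G$ and from $H'$ to $G$. Two points $x_1,x_2\in\Omega$ are twins (in $H$) if $W(x_1,y)=W(x_2,y)$ for almost all $y\in\Omega$. $H$ is almost twin-free if there is a set $N$ of measure zero such that no two distinct points of $\Omega\setminus N$ are twins. *)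

theory Defs
  imports "HOL-Probability.Probability"
begin

locale graphon = prob_space M for M :: "'a measure" +
  fixes W :: "'a \<Rightarrow> 'a \<Rightarrow> real"
  assumes kernel_measurable: "(\<lambda>(x, y). W x y) \<in> borel_measurable (completion (M \<Otimes>\<^sub>M M))"
    and kernel_bounded: "\<exists>B. \<forall>x\<in>space M. \<forall>y\<in>space M. \<bar>W x y\<bar> \<le> B"
    and kernel_symmetric: "\<And>x y. x \<in> space M \<Longrightarrow> y \<in> space M \<Longrightarrow> W x y = W y x"

definition simple_graph_on :: "nat \<Rightarrow> nat set set \<Rightarrow> bool" where
  "simple_graph_on k E \<longleftrightarrow> (\<forall>e\<in>E. e \<subseteq> {1..k} \<and> card e = 2)"

text \<open>
  For an edge \<open>e = {i, j}\<close> the unordered pair is read off as \<open>Min e\<close>, \<open>Max e\<close>; the order is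
  irrelevant for a symmetric kernel. Since a kernel is only measurable for the completed
  product, the integrand is in general only measurable for the completion of the finite
  product measure, and the integral is taken there.
\<close>

definition hom_density :: "nat \<Rightarrow> nat set set \<Rightarrow> 'a measure \<Rightarrow> ('a \<Rightarrow> 'a \<Rightarrow> real) \<Rightarrow> real" where
  "hom_density k E M W =
     (\<integral>x. (\<Prod>e\<in>E. W (x (Min e)) (x (Max e))) \<partial>completion (Pi\<^sub>M {1..k} (\<lambda>_. M)))"

definition measure_preserving :: "'a measure \<Rightarrow> 'b measure \<Rightarrow> ('a \<Rightarrow> 'b) \<Rightarrow> bool" where
  "measure_preserving M N \<phi> \<longleftrightarrow>
     \<phi> \<in> measurable M N \<and> (\<forall>B\<in>sets N. emeasure M (\<phi> -` B \<inter> space M) = emeasure N B)"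

definition measure_isomorphism :: "'a measure \<Rightarrow> 'b measure \<Rightarrow> ('a \<Rightarrow> 'b) \<Rightarrow> bool" where
  "measure_isomorphism M N \<phi> \<longleftrightarrow>
     bij_betw \<phi> (space M) (space N) \<and> measure_preserving M N \<phi> \<and>
     measure_preserving N M (inv_into (space M) \<phi>)"

definition isomorphism_mod_0 :: "'a measure \<Rightarrow> 'b measure \<Rightarrow> ('a \<Rightarrow> 'b) \<Rightarrow> bool" where
  "isomorphism_mod_0 M M' \<phi> \<longleftrightarrow>
     measure_preserving M M' \<phi> \<and>
     (\<exists>N\<in>null_sets M. \<exists>N'\<in>null_sets M'.
        measure_isomorphism (restrict_space M (space M - N)) (restrict_space M' (space M' - N')) \<phi>)"

definition disjoint_union_measure :: "'a measure \<Rightarrow> 'b measure \<Rightarrow> ('a + 'b) measure" where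
  "disjoint_union_measure M N =
     measure_of (space M <+> space N)
       {A. A \<subseteq> space M <+> space N \<and> Inl -` A \<in> sets M \<and> Inr -` A \<in> sets N}
       (\<lambda>A. emeasure M (Inl -` A) + emeasure N (Inr -` A))"

lemma sigma_algebra_disjoint_union:
  "sigma_algebra (space M <+> space N)
     {A. A \<subseteq> space M <+> space N \<and> Inl -` A \<in> sets M \<and> Inr -` A \<in> sets N}"
proof -
  have l: "Inl -` ((space M <+> space N) - A) = space M - Inl -` A"
   and r: "Inr -` ((space M <+> space N) - A) = space N - Inr -` A" for A
    by auto
  have [simp]: "Inl -` (space M <+> space N) = space M" "Inr -` (space M <+> space N) = space N"
    by auto
  show ?thesis
    unfolding sigma_algebra_iff2
    by (auto simp: l r vimage_UN)
qed

lemma space_disjoint_union_measure [simp]: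
  "space (disjoint_union_measure M N) = space M <+> space N"
  unfolding disjoint_union_measure_def by (rule space_measure_of) auto

lemma sets_disjoint_union_measure:
  "sets (disjoint_union_measure M N) =
     {A. A \<subseteq> space M <+> space N \<and> Inl -` A \<in> sets M \<and> Inr -` A \<in> sets N}"
  unfolding disjoint_union_measure_def
  by (subst sets_measure_of)
     (auto simp: sigma_algebra.sigma_sets_eq[OF sigma_algebra_disjoint_union])

lemma emeasure_disjoint_union_measure:
  assumes "A \<in> sets (disjoint_union_measure M N)"
  shows "emeasure (disjoint_union_measure M N) A =
    emeasure M (Inl -` A) + emeasure N (Inr -` A)"
proof (rule emeasure_measure_of[OF disjoint_union_measure_def _ _ _ assms])
  show "countably_additive (sets (disjoint_union_measure M N))
     (\<lambda>A. emeasure M (Inl -` A) + emeasure N (Inr -` A))"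
  proof (rule countably_additiveI)
    fix A :: "nat \<Rightarrow> ('a + 'b) set"
    assume A: "range A \<subseteq> sets (disjoint_union_measure M N)" "disjoint_family A"
    have d: "disjoint_family (\<lambda>i. Inl -` A i)" "disjoint_family (\<lambda>i. Inr -` A i)"
      using A(2) unfolding disjoint_family_on_def by blast+
    have "(\<Sum>i. emeasure M (Inl -` A i)) = emeasure M (\<Union>i. Inl -` A i)"
      using A(1) d
      by (intro suminf_emeasure) (auto simp: sets_disjoint_union_measure)
    moreover have "(\<Sum>i. emeasure N (Inr -` A i)) = emeasure N (\<Union>i. Inr -` A i)"
      using A(1) d
      by (intro suminf_emeasure) (auto simp: sets_disjoint_union_measure)
    ultimately show "(\<Sum>i. emeasure M (Inl -` A i) + emeasure N (Inr -` A i)) =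
        emeasure M (Inl -` (\<Union>i. A i)) + emeasure N (Inr -` (\<Union>i. A i))"
      by (simp add: suminf_add[symmetric] vimage_UN)
  qed
qed (auto simp: positive_def)

text \<open>
  The interval part is absent if \<open>a > b\<close>, the atomic part if \<open>I = {}\<close>. The total mass of the
  model need not be required to be 1, as this follows from the isomorphism.
\<close>

definition lebesgue_space :: "'a measure \<Rightarrow> bool" where
  "lebesgue_space M \<longleftrightarrow> prob_space M \<and> complete_measure M \<and>
     (\<exists>(a::real) b (I::nat set) (p::nat \<Rightarrow> real). (\<forall>i\<in>I. 0 < p i) \<and>
        (\<exists>\<phi>. isomorphism_mod_0 M
           (disjoint_union_measure (lebesgue_on {a..b}) (point_measure I (\<lambda>i. ennreal (p i)))) \<phi>))"

definition lebesguian_graphon :: "'a measure \<Rightarrow> ('a \<Rightarrow> 'a \<Rightarrow> real) \<Rightarrow> bool" where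
  "lebesguian_graphon M W \<longleftrightarrow> graphon M W \<and> lebesgue_space M"

definition pull_back :: "('b \<Rightarrow> 'b \<Rightarrow> real) \<Rightarrow> ('a \<Rightarrow> 'b) \<Rightarrow> 'a \<Rightarrow> 'a \<Rightarrow> real" where
  "pull_back W \<phi> x y = W (\<phi> x) (\<phi> y)"

definition isomorphic_mod_0 ::
  "'a measure \<Rightarrow> ('a \<Rightarrow> 'a \<Rightarrow> real) \<Rightarrow> 'b measure \<Rightarrow> ('b \<Rightarrow> 'b \<Rightarrow> real) \<Rightarrow> bool" where
  "isomorphic_mod_0 M W M' W' \<longleftrightarrow>
     (\<exists>\<phi>. isomorphism_mod_0 M M' \<phi> \<and> (AE (x, y) in M \<Otimes>\<^sub>M M. pull_back W' \<phi> x y = W x y))"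

definition weak_isomorphism ::
  "'a measure \<Rightarrow> ('a \<Rightarrow> 'a \<Rightarrow> real) \<Rightarrow> 'c measure \<Rightarrow> ('c \<Rightarrow> 'c \<Rightarrow> real) \<Rightarrow> ('a \<Rightarrow> 'c) \<Rightarrow> bool" where
  "weak_isomorphism M W N U \<phi> \<longleftrightarrow>
     measure_preserving (completion M) N \<phi> \<and> (AE (x, y) in M \<Otimes>\<^sub>M M. W x y = pull_back U \<phi> x y)"

text \<open>
  HOL cannot quantify existentially over the type carrying the intermediate graphon, so that
  type is a parameter.
\<close>

definition weakly_isomorphic ::
  "'c itself \<Rightarrow> 'a measure \<Rightarrow> ('a \<Rightarrow> 'a \<Rightarrow> real) \<Rightarrow> 'b measure \<Rightarrow> ('b \<Rightarrow> 'b \<Rightarrow> real) \<Rightarrow> bool" where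
  "weakly_isomorphic T M W M' W' \<longleftrightarrow>
     (\<exists>(N :: 'c measure) U. graphon N U \<and>
        (\<exists>\<phi>. weak_isomorphism M W N U \<phi>) \<and> (\<exists>\<phi>'. weak_isomorphism M' W' N U \<phi>'))"

definition twins :: "'a measure \<Rightarrow> ('a \<Rightarrow> 'a \<Rightarrow> real) \<Rightarrow> 'a \<Rightarrow> 'a \<Rightarrow> bool" where
  "twins M W x\<^sub>1 x\<^sub>2 \<longleftrightarrow> (AE y in M. W x\<^sub>1 y = W x\<^sub>2 y)"

definition almost_twin_free :: "'a measure \<Rightarrow> ('a \<Rightarrow> 'a \<Rightarrow> real) \<Rightarrow> bool" where
  "almost_twin_free M W \<longleftrightarrow>
     (\<exists>N\<in>null_sets M. \<forall>x\<^sub>1\<in>space M - N. \<forall>x\<^sub>2\<in>space M - N. x\<^sub>1 \<noteq> x\<^sub>2 \<longrightarrow> \<not> twins M W x\<^sub>1 x\<^sub>2)"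

end

theory Submission
  imports Defs
begin

text \<open>
  Every graphon is a pull-back of a Borel kernel \<open>U\<close> on the line, and pulling back does not change
  densities; this gives the easy directions. Conversely let \<open>P, U\<close> and \<open>P', U'\<close> be Borel kernels with
  the same densities, and put \<open>T2 x y = \<integral>u. U x u * U u y\<close>. Sample i.i.d. anchors \<open>\<xi>\<close> from \<open>P\<close>. The law
  of \<open>x \<mapsto> (T2 x (\<xi> i))\<^sub>i\<close> and its joint law with \<open>U x y\<close> are determined by densities of anchored graphs
  in which anchors are never adjacent, so gluing copies along the anchors never creates a multiple
  edge: all joint moments over \<open>\<xi>\<close> are densities of simple graphs. Hence the anchored densities have
  the same law for both kernels, and since Borel probability measures on Polish spaces are perfect
  there are typical anchors \<open>\<xi>\<close> and \<open>\<xi>'\<close> with equal anchored densities. For typical anchors, a function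
  orthogonal to all \<open>T2 x (\<xi> i)\<close> is orthogonal to the range of \<open>T2\<close> by the law of large numbers, hence
  is in the kernel of \<open>U\<close>; so \<open>U\<close> factors through the anchor map, and so does \<open>U'\<close>, through the same
  kernel. In the twin-free Lebesgue case the factor maps are injective off a null set, and
  perfectness makes them isomorphisms mod 0.
\<close>

section \<open>Coding sequences of reals by reals\<close>

text \<open>Multiple edges are the obstacle. With \<open>U x (\<xi> i)\<close> as anchor
  coordinates, a moment containing a square would put two edges on one pair of vertices, and
  densities of simple graphs say nothing about that. In \<open>T2\<close> each edge is replaced by a
  path with a middle vertex of its own, and parallel paths are harmless. Nothing is lost:
  \<open>T2\<close> is the square of the self-adjoint operator of \<open>U\<close>, so both have the
  same kernel. For the same reason only the first power of \<open>U x y\<close> is accessible. The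
  data determine the image, under the anchor map, of the measure whose density is \<open>U\<close>
  shifted and scaled to \<open>[0, 1]\<close>, that is, a conditional expectation of
  \<open>U\<close>; that this recovers \<open>U\<close> is exactly the factorization property of
  typical anchors. The abstract space of a graphon has no topology, so every countable family of
  real coordinates is coded by one real number. This moves the argument to Borel measures on the
  line, where perfectness holds, and puts the common factor on the fixed type
  \<open>real\<close>.\<close>

definition bits_code :: "(nat \<Rightarrow> bool) \<Rightarrow> real" where
  "bits_code b = (\<Sum>n. 2 * of_bool (b n) / 3 ^ Suc n)"

text \<open>Codes lie in the Cantor set: a first ternary digit 0 puts the code in
  \<open>[0, 1/3]\<close>, a first digit 2 puts it in \<open>[2/3, 1]\<close>, and the cut at 1/2
  separates the two. Base 3 avoids the double expansions of base 2.\<close>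

definition bits_head :: "real \<Rightarrow> bool" where
  "bits_head c \<longleftrightarrow> 1/2 \<le> c"

definition bits_shift :: "real \<Rightarrow> real" where
  "bits_shift c = (if bits_head c then 3 * c - 2 else 3 * c)"

lemma summable_bits_code: "summable (\<lambda>n. 2 * of_bool (b n) / 3 ^ Suc n :: real)"
proof (rule summable_comparison_test')
  show "summable (\<lambda>n. 2/3 * (1/3) ^ n :: real)"
    by (intro summable_mult summable_geometric) auto
  show "norm (2 * of_bool (b n) / 3 ^ Suc n :: real) \<le> 2/3 * (1/3) ^ n" for n
    by (auto simp: power_one_over field_simps)
qed

lemma bits_code_nonneg: "0 \<le> bits_code b"
  unfolding bits_code_def by (intro suminf_nonneg summable_bits_code) auto

lemma bits_code_le_1: "bits_code b \<le> 1"
proof -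
  have "bits_code b \<le> (\<Sum>n. 2/3 * (1/3) ^ n :: real)"
    unfolding bits_code_def
    by (intro suminf_le summable_bits_code summable_mult summable_geometric)
       (auto simp: power_one_over field_simps)
  also have "\<dots> = 1"
    by (subst suminf_mult) (auto simp: suminf_geometric intro!: summable_geometric)
  finally show ?thesis .
qed

lemma bits_code_split: "bits_code b = (2 * of_bool (b 0) + bits_code (\<lambda>n. b (Suc n))) / 3"
proof -
  have "bits_code b = 2 * of_bool (b 0) / 3 + (\<Sum>n. 2 * of_bool (b (Suc n)) / 3 ^ Suc (Suc n))"
    unfolding bits_code_def by (subst suminf_split_head[OF summable_bits_code]) simp
  also have "(\<Sum>n. 2 * of_bool (b (Suc n)) / 3 ^ Suc (Suc n)) = (\<Sum>n. 1/3 * (2 * of_bool (b (Suc n)) / 3 ^ Suc n) :: real)"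
    by (intro suminf_cong) simp
  also have "\<dots> = 1/3 * bits_code (\<lambda>n. b (Suc n))"
    unfolding bits_code_def by (rule suminf_mult[OF summable_bits_code])
  finally show ?thesis by simp
qed

lemma bits_head_code: "bits_head (bits_code b) \<longleftrightarrow> b 0"
  using bits_code_nonneg[of "\<lambda>n. b (Suc n)"] bits_code_le_1[of "\<lambda>n. b (Suc n)"] bits_code_split[of b]
  by (cases "b 0") (simp_all add: bits_head_def)

lemma bits_shift_code: "bits_shift (bits_code b) = bits_code (\<lambda>n. b (Suc n))"
  using bits_code_split[of b] by (auto simp: bits_shift_def bits_head_code)

lemma bits_shift_funpow: "(bits_shift ^^ k) (bits_code b) = bits_code (\<lambda>n. b (n + k))"
  by (induction k) (simp_all add: bits_shift_code)

lemma measurable_bits_head [measurable]: "Measurable.pred borel bits_head"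
  unfolding bits_head_def by measurable

lemma measurable_bits_shift_funpow[measurable]: "(bits_shift ^^ k) \<in> borel_measurable borel"
proof (induction k)
  case (Suc k)
  have "bits_shift \<in> borel_measurable borel"
    unfolding bits_shift_def by measurable
  from measurable_comp[OF Suc this] show ?case by (simp only: funpow.simps)
qed (simp add: id_def)

lemma measurable_bits_code[measurable (raw)]:
  assumes "\<And>n. Measurable.pred M (\<lambda>x. b x n)"
  shows "(\<lambda>x. bits_code (b x)) \<in> borel_measurable M"
proof -
  have "(\<lambda>x. bits_code (b x)) = (\<lambda>x. \<Sum>n. 2 * indicator {x. b x n} x / 3 ^ Suc n)"
    by (auto simp: bits_code_def indicator_def fun_eq_iff intro!: suminf_cong)
  also have "\<dots> \<in> borel_measurable M"
    using assms by (intro borel_measurable_suminf borel_measurable_divide borel_measurable_times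
      borel_measurable_const) (auto simp: pred_def space_borel intro!: borel_measurable_indicator')
  finally show ?thesis .
qed

text \<open>A Dedekind cut: \<open>b m\<close> tells whether the \<open>m\<close>-th rational lies
  above the number. The infimum in \<open>ereal\<close> exists for every bit sequence and is
  measurable as a countable infimum, so no test for valid cuts arises.\<close>

definition real_of_cut :: "(nat \<Rightarrow> bool) \<Rightarrow> real" where
  "real_of_cut b = real_of_ereal (INF m. if b m then ereal (real_of_rat (nat_to_rat_surj m)) else \<infinity>)"

lemma real_of_cut_less: "real_of_cut (\<lambda>m. y < real_of_rat (nat_to_rat_surj m)) = y"
proof -
  have "(INF m. if y < real_of_rat (nat_to_rat_surj m) then ereal (real_of_rat (nat_to_rat_surj m)) else \<infinity>) = ereal y"
  proof (rule antisym)
    show "(INF m. if y < real_of_rat (nat_to_rat_surj m) then ereal (real_of_rat (nat_to_rat_surj m)) else \<infinity>) \<le> ereal y"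
    proof (rule ereal_le_epsilon2)
      fix e :: real assume "0 < e"
      then obtain q where q: "y < real_of_rat q" "real_of_rat q < y + e"
        using of_rat_dense[of y "y + e"] by auto
      obtain m where "nat_to_rat_surj m = q"
        using surj_nat_to_rat_surj by (metis surjD)
      with q show "(INF m. if y < real_of_rat (nat_to_rat_surj m) then ereal (real_of_rat (nat_to_rat_surj m)) else \<infinity>) \<le> ereal y + ereal e"
        by (intro INF_lower2[of m]) auto
    qed
  qed (rule INF_greatest, simp)
  then show ?thesis by (simp add: real_of_cut_def)
qed

lemma measurable_real_of_cut[measurable (raw)]:
  assumes [measurable]: "\<And>n. Measurable.pred M (\<lambda>x. b x n)"
  shows "(\<lambda>x. real_of_cut (b x)) \<in> borel_measurable M"
  unfolding real_of_cut_def by measurable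

definition seq_code :: "('i::countable \<Rightarrow> real) \<Rightarrow> real" where
  "seq_code x = bits_code (\<lambda>n. case prod_decode n of (i, m) \<Rightarrow> x (from_nat i) < real_of_rat (nat_to_rat_surj m))"

definition seq_decode :: "'i::countable \<Rightarrow> real \<Rightarrow> real" where
  "seq_decode i c = real_of_cut (\<lambda>m. bits_head ((bits_shift ^^ prod_encode (to_nat i, m)) c))"

lemma seq_decode_code [simp]: "seq_decode i (seq_code x) = x i"
  by (simp add: seq_decode_def seq_code_def bits_shift_funpow bits_head_code real_of_cut_less)

lemma measurable_seq_code [measurable (raw)]:
  assumes [measurable]: "\<And>i. (\<lambda>z. x z i) \<in> borel_measurable M"
  shows "(\<lambda>z. seq_code (x z)) \<in> borel_measurable M"
  unfolding seq_code_def by (simp add: split_beta)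

lemma measurable_seq_decode [measurable]: "seq_decode i \<in> borel_measurable borel"
  unfolding seq_decode_def by measurable

text \<open>Every set of a generated sigma-algebra depends on countably many generators only, and
  countably many real coordinates fit into one by \<open>seq_code\<close>. The induction therefore
  stays within planar Borel sets.\<close>

lemma sets_pair_measure_factor:
  assumes "A \<in> sets (M \<Otimes>\<^sub>M N)"
  shows "\<exists>f\<in>borel_measurable M. \<exists>g\<in>borel_measurable N. \<exists>B\<in>sets (borel \<Otimes>\<^sub>M borel).
    A = {(x, y) \<in> space M \<times> space N. (f x :: real, g y :: real) \<in> B}"
  using assms[unfolded sets_pair_measure]
proof (induction A rule: sigma_sets.induct)
  case (Basic a)
  then obtain X Y where a: "a = X \<times> Y" and [measurable]: "X \<in> sets M" "Y \<in> sets N" by auto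
  have "X \<subseteq> space M" "Y \<subseteq> space N" by (simp_all add: sets.sets_into_space)
  then have "a = {(x, y) \<in> space M \<times> space N. (indicator X x :: real, indicator Y y :: real) \<in> {1} \<times> {1}}"
    by (auto simp: a indicator_def split: if_splits)
  moreover have "{1::real} \<times> {1::real} \<in> sets (borel \<Otimes>\<^sub>M borel)"
    by (rule pair_measureI) simp_all
  ultimately show ?case
    by (intro bexI[where x="indicator X"] bexI[where x="indicator Y"] bexI[where x="{1} \<times> {1}"])
       simp_all
next
  case Empty
  show ?case by (intro bexI[of _ "\<lambda>_. 0"] bexI[of _ "{}"]) auto
next
  case (Compl a)
  then obtain f g B where [measurable]: "f \<in> borel_measurable M" "g \<in> borel_measurable N" "B \<in> sets (borel \<Otimes>\<^sub>M borel)"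
    and a: "a = {(x, y) \<in> space M \<times> space N. (f x :: real, g y :: real) \<in> B}" by blast
  have "space M \<times> space N - a = {(x, y) \<in> space M \<times> space N. (f x, g y) \<in> UNIV - B}"
    unfolding a by auto
  moreover have "UNIV - B \<in> sets (borel \<Otimes>\<^sub>M borel)"
    using sets.compl_sets[of B "borel \<Otimes>\<^sub>M borel"] by (simp add: space_pair_measure)
  ultimately show ?case
    by (intro bexI[where x=f] bexI[where x=g] bexI[where x="UNIV - B"]) simp_all
next
  case (Union a)
  then have "\<forall>i. \<exists>f g B. f \<in> borel_measurable M \<and> g \<in> borel_measurable N \<and> B \<in> sets (borel \<Otimes>\<^sub>M borel) \<and>
    a i = {(x, y) \<in> space M \<times> space N. (f x :: real, g y :: real) \<in> B}" by blast
  then obtain f g B where [measurable]: "\<And>i. f i \<in> borel_measurable M" "\<And>i. g i \<in> borel_measurable N"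
      "\<And>i. B i \<in> sets (borel \<Otimes>\<^sub>M borel)"
    and a: "\<And>i. a i = {(x, y) \<in> space M \<times> space N. (f i x :: real, g i y :: real) \<in> B i}" unfolding choice_iff by blast
  \<comment> \<open>The sets \<open>B i\<close> refer to different coordinates \<open>f i\<close>,
    \<open>g i\<close>; preimages under the decoders rewrite all of them in the merged
    coordinates.\<close>
  let ?B = "\<Union>i. {z \<in> space (borel \<Otimes>\<^sub>M borel). (seq_decode i (fst z), seq_decode i (snd z)) \<in> B i}"
  have "\<Union> (range a) = {(x, y) \<in> space M \<times> space N. (seq_code (\<lambda>i. f i x), seq_code (\<lambda>i. g i y)) \<in> ?B}"
    by (auto simp: a space_pair_measure)
  moreover have "?B \<in> sets (borel \<Otimes>\<^sub>M borel)" by measurable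
  moreover have "(\<lambda>x. seq_code (\<lambda>i. f i x)) \<in> borel_measurable M" "(\<lambda>x. seq_code (\<lambda>i. g i x)) \<in> borel_measurable N"
    by measurable
  ultimately show ?case
    by (intro bexI[where x="\<lambda>x. seq_code (\<lambda>i. f i x)"] bexI[where x="\<lambda>x. seq_code (\<lambda>i. g i x)"]
      bexI[where x="?B"])
qed

text \<open>The codings of different level sets are merged into one real-valued coordinate.\<close>

lemma borel_measurable_pair_factor:
  fixes F :: "'a \<times> 'a \<Rightarrow> real"
  assumes "F \<in> borel_measurable (M \<Otimes>\<^sub>M M)"
  obtains \<psi> G where "\<psi> \<in> borel_measurable M" "G \<in> borel_measurable (borel \<Otimes>\<^sub>M borel)"
    "\<And>x y. x \<in> space M \<Longrightarrow> y \<in> space M \<Longrightarrow> F (x, y) = G (\<psi> x :: real, \<psi> y)"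
proof -
  let ?q = "\<lambda>m. real_of_rat (nat_to_rat_surj m)"
  have "\<forall>m. \<exists>f g B. f \<in> borel_measurable M \<and> g \<in> borel_measurable M \<and> B \<in> sets (borel \<Otimes>\<^sub>M borel) \<and>
    {z\<in>space (M \<Otimes>\<^sub>M M). F z < ?q m} = {(x, y) \<in> space M \<times> space M. (f x :: real, g y :: real) \<in> B}"
  proof
    fix m
    have "{z\<in>space (M \<Otimes>\<^sub>M M). F z < ?q m} \<in> sets (M \<Otimes>\<^sub>M M)" using assms by measurable
    from sets_pair_measure_factor[OF this] 
    show "\<exists>f g B. f \<in> borel_measurable M \<and> g \<in> borel_measurable M \<and> B \<in> sets (borel \<Otimes>\<^sub>M borel) \<and>
    {z\<in>space (M \<Otimes>\<^sub>M M). F z < ?q m} = {(x, y) \<in> space M \<times> space M. (f x :: real, g y :: real) \<in> B}"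
      by blast
  qed
  then obtain f g B where [measurable]: "\<And>i. f i \<in> borel_measurable M" "\<And>i. g i \<in> borel_measurable M"
      "\<And>i. B i \<in> sets (borel \<Otimes>\<^sub>M borel)"
    and a: "\<And>i. {z\<in>space (M \<Otimes>\<^sub>M M). F z < ?q i} = {(x, y) \<in> space M \<times> space M. (f i x :: real, g i y :: real) \<in> B i}"
    unfolding choice_iff by blast
  \<comment> \<open>One map has to serve both arguments of \<open>F\<close>, so the Boolean index
    stores the left coordinates \<open>f i\<close> and the right coordinates \<open>g i\<close> side
    by side.\<close>
  define \<psi> where "\<psi> x = seq_code (\<lambda>(i, c). if c then f i x else g i x)" for x
  define G where "G z = real_of_cut (\<lambda>m. (seq_decode (m, True) (fst z), seq_decode (m, False) (snd z)) \<in> B m)" for z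
  show ?thesis
  proof
    show "\<psi> \<in> borel_measurable M" unfolding \<psi>_def by measurable
    show "G \<in> borel_measurable (borel \<Otimes>\<^sub>M borel)" unfolding G_def by measurable
    fix x y assume xy: "x \<in> space M" "y \<in> space M"
    then have "F (x, y) < ?q m \<longleftrightarrow> (f m x, g m y) \<in> B m" for m
      using a[of m] by (auto simp: space_pair_measure set_eq_iff)
    then show "F (x, y) = G (\<psi> x, \<psi> y)"
      using real_of_cut_less[of "F (x, y)"] by (simp add: G_def \<psi>_def)
  qed
qed

section \<open>Measure preserving maps and homomorphism densities\<close>

lemma measure_preserving_measurable:
  "measure_preserving M N \<phi> \<Longrightarrow> \<phi> \<in> measurable M N"
  by (simp add: measure_preserving_def)

lemma measure_preserving_iff_distr:
  "measure_preserving M N \<phi> \<longleftrightarrow> \<phi> \<in> measurable M N \<and> distr M N \<phi> = N"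
proof -
  have "distr M N \<phi> = N" if "measure_preserving M N \<phi>"
    using that by (intro measure_eqI) (auto simp: measure_preserving_def emeasure_distr)
  moreover have "measure_preserving M N \<phi>" if "\<phi> \<in> measurable M N" and d: "distr M N \<phi> = N"
    unfolding measure_preserving_def
    using that(1) by (auto simp: emeasure_distr[symmetric] d)
  ultimately show ?thesis by (auto simp: measure_preserving_measurable)
qed

lemma measure_preserving_distr: "measure_preserving M N \<phi> \<Longrightarrow> distr M N \<phi> = N"
  by (simp add: measure_preserving_iff_distr)

lemma measure_preserving_AE:
  "measure_preserving M N \<phi> \<Longrightarrow> AE y in N. Q y \<Longrightarrow> AE x in M. Q (\<phi> x)"
  by (metis AE_distrD measure_preserving_iff_distr)

lemma measure_preserving_comp:
  assumes "measure_preserving M N f" "measure_preserving N L g"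
  shows "measure_preserving M L (\<lambda>x. g (f x))"
proof -
  have "distr M L (g \<circ> f) = distr (distr M N f) L g"
    using assms by (intro distr_distr[symmetric]) (auto simp: measure_preserving_measurable)
  then show ?thesis
    using assms measurable_comp[of f M N g L] by (simp add: measure_preserving_iff_distr comp_def)
qed

lemma measure_preserving_completion:
  assumes "measure_preserving M N f"
  shows "measure_preserving (completion M) (completion N) f"
    and "measure_preserving (completion M) N f"
proof -
  have f: "f \<in> completion M \<rightarrow>\<^sub>M N" "distr (completion M) N f = N"
    using assms by (auto simp: measure_preserving_iff_distr distr_completion intro: measurable_completion)
  have "f \<in> completion M \<rightarrow>\<^sub>M completion N"
    using f by (intro completion.measurable_completion2) simp_all
  moreover have "completion N = distr (completion M) (completion N) f"
    using completion.completion_distr_eq[OF f(1)] f(2) by simp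
  ultimately show "measure_preserving (completion M) (completion N) f"
    by (simp add: measure_preserving_iff_distr)
  show "measure_preserving (completion M) N f"
    using f by (simp add: measure_preserving_iff_distr)
qed

lemma measure_preserving_PiM_pair:
  assumes M: "prob_space M" and ij: "i \<in> I" "j \<in> I" "i \<noteq> j"
  shows "measure_preserving (PiM I (\<lambda>_. M)) (M \<Otimes>\<^sub>M M) (\<lambda>x. (x i, x j))"
proof -
  interpret product_prob_space "\<lambda>_. M" I by (intro product_prob_spaceI M)
  interpret M: prob_space M by fact
  have m: "(\<lambda>x. (x i, x j)) \<in> PiM I (\<lambda>_. M) \<rightarrow>\<^sub>M M \<Otimes>\<^sub>M M"
    using ij by measurable
  have "M \<Otimes>\<^sub>M M = distr (PiM I (\<lambda>_. M)) (M \<Otimes>\<^sub>M M) (\<lambda>x. (x i, x j))"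
  proof (rule pair_measure_eqI)
    fix A B assume AB: "A \<in> sets M" "B \<in> sets M"
    have "emeasure M A * emeasure M B = (\<Prod>k\<in>{i, j}. emeasure M (if k = i then A else B))"
      using ij by auto
    also have "\<dots> = emeasure (PiM I (\<lambda>_. M)) {x \<in> space (PiM I (\<lambda>_. M)). \<forall>k\<in>{i,j}. x k \<in> (if k = i then A else B)}"
      using ij AB by (intro emeasure_PiM_Collect[symmetric]) auto
    also have "{x \<in> space (PiM I (\<lambda>_. M)). \<forall>k\<in>{i,j}. x k \<in> (if k = i then A else B)} =
       (\<lambda>x. (x i, x j)) -` (A \<times> B) \<inter> space (PiM I (\<lambda>_. M))"
      using ij by auto
    finally show "emeasure M A * emeasure M B = emeasure (distr (PiM I (\<lambda>_. M)) (M \<Otimes>\<^sub>M M) (\<lambda>x. (x i, x j))) (A \<times> B)"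
      using m AB by (simp add: emeasure_distr)
  qed (simp_all add: M.sigma_finite_measure_axioms)
  with m show ?thesis by (simp add: measure_preserving_iff_distr)
qed

text \<open>A weak isomorphism is measurable from the completion of \<open>M\<close>, whereas
  densities are integrals over the completion of the product; this identity map mediates between the
  two. A box of completed sets differs from the box of their main parts only by null sets in
  finitely many coordinates.\<close>

lemma measure_preserving_PiM_completion:
  assumes M: "prob_space M" and I: "finite I"
  shows "measure_preserving (completion (PiM I (\<lambda>_. M))) (PiM I (\<lambda>_. completion M)) (\<lambda>x. x)"
proof -
  interpret product_prob_space "\<lambda>_. M" I by (intro product_prob_spaceI M)
  interpret M: prob_space M by fact
  interpret cM: prob_space "completion M" by (rule M.prob_space_completion)
  interpret C: product_prob_space "\<lambda>_. completion M" I by (intro product_prob_spaceI) unfold_locales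
  let ?P = "PiM I (\<lambda>_. M)" and ?C = "PiM I (\<lambda>_. completion M)"
  have c: "(\<lambda>x. x i) \<in> completion ?P \<rightarrow>\<^sub>M completion M" if "i \<in> I" for i
    using that PiM_component[of i]
    by (intro measure_preserving_measurable measure_preserving_completion)
       (simp add: measure_preserving_iff_distr)
  have m: "(\<lambda>x. x) \<in> completion ?P \<rightarrow>\<^sub>M ?C"
    by (rule measurable_PiM_single') (use c in \<open>auto simp: space_PiM\<close>)
  have "distr (completion ?P) ?C (\<lambda>x. x) = ?C"
  proof (rule C.PiM_eqI[OF I])
    fix A assume A: "\<And>i. i \<in> I \<Longrightarrow> A i \<in> sets (completion M)"
    have S: "Pi\<^sub>E I A \<in> sets ?C" using A I by (intro sets_PiM_I_finite)
    have eq: "(\<lambda>x. x) -` Pi\<^sub>E I A \<inter> space (completion ?P) = Pi\<^sub>E I A"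
      using sets.sets_into_space[OF S] by (auto simp: space_PiM)
    have S': "Pi\<^sub>E I A \<in> sets (completion ?P)"
      using measurable_sets[OF m S] unfolding eq .
    have mp: "Pi\<^sub>E I (\<lambda>i. main_part M (A i)) \<in> sets ?P"
      using A I by (intro sets_PiM_I_finite) auto
    have "emeasure (distr (completion ?P) ?C (\<lambda>x. x)) (Pi\<^sub>E I A) = emeasure (completion ?P) (Pi\<^sub>E I A)"
      by (subst emeasure_distr[OF m S], subst eq) (rule refl)
    also have "\<dots> = emeasure (completion ?P) (Pi\<^sub>E I (\<lambda>i. main_part M (A i)))"
    proof (rule emeasure_eq_AE)
      have "AE x in ?P. \<forall>i\<in>I. x i \<in> main_part M (A i) \<longleftrightarrow> x i \<in> A i"
        using I A by (intro AE_finite_allI AE_component AE_in_main_part) 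
      then have "AE x in ?P. x \<in> Pi\<^sub>E I A \<longleftrightarrow> x \<in> Pi\<^sub>E I (\<lambda>i. main_part M (A i))"
        by eventually_elim (auto simp: PiE_iff)
      then show "AE x in completion ?P. x \<in> Pi\<^sub>E I A \<longleftrightarrow> x \<in> Pi\<^sub>E I (\<lambda>i. main_part M (A i))"
        by (rule AE_completion)
    qed (use S' mp in auto)
    also have "\<dots> = emeasure ?P (Pi\<^sub>E I (\<lambda>i. main_part M (A i)))"
      using mp by simp
    also have "\<dots> = (\<Prod>i\<in>I. emeasure M (main_part M (A i)))"
      using A I by (intro emeasure_PiM) auto
    also have "\<dots> = (\<Prod>i\<in>I. emeasure (completion M) (A i))"
      using A by (intro prod.cong) auto
    finally show "emeasure (distr (completion ?P) ?C (\<lambda>x. x)) (Pi\<^sub>E I A) = (\<Prod>i\<in>I. emeasure (completion M) (A i))" .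
  qed simp
  with m show ?thesis by (simp add: measure_preserving_iff_distr)
qed

section \<open>Invariance of homomorphism densities\<close>

lemma simple_graph_on_edge:
  assumes "simple_graph_on k E" "e \<in> E"
  shows "Min e \<in> {1..k}" "Max e \<in> {1..k}" "Min e \<noteq> Max e" "e = {Min e, Max e}"
proof -
  from assms have e: "e \<subseteq> {1..k}" "card e = 2" by (auto simp: simple_graph_on_def)
  then obtain a b where ab: "e = {a, b}" "a \<noteq> b" by (auto simp: card_2_iff)
  then have *: "Min e = min a b" "Max e = max a b" by auto
  show "Min e \<in> {1..k}" "Max e \<in> {1..k}" "Min e \<noteq> Max e" "e = {Min e, Max e}"
    unfolding * using e ab by (auto simp: min_def max_def)
qed

lemma simple_graph_on_finite: "simple_graph_on k E \<Longrightarrow> finite E"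
  by (rule finite_subset[of _ "Pow {1..k}"]) (auto simp: simple_graph_on_def)

lemma graphon_PiM_measurable:
  assumes "graphon M W" "i \<in> I" "j \<in> I" "i \<noteq> j"
  shows "(\<lambda>x. W (x i) (x j)) \<in> borel_measurable (completion (PiM I (\<lambda>_. M)))"
proof -
  interpret graphon M W by fact
  have "(\<lambda>x. (x i, x j)) \<in> completion (PiM I (\<lambda>_. M)) \<rightarrow>\<^sub>M completion (M \<Otimes>\<^sub>M M)"
    using assms by (intro measure_preserving_measurable measure_preserving_completion
      measure_preserving_PiM_pair prob_space_axioms)
  from measurable_comp[OF this kernel_measurable] show ?thesis by (simp add: comp_def)
qed

text \<open>A change of variables along \<open>\<phi>\<close> in every coordinate. The two ends of
  an edge are distinct coordinates, so their joint law is the product measure, and identities valid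
  almost everywhere on pairs hold along every edge.\<close>

lemma hom_density_weak_isomorphism:
  assumes MW: "graphon M W" and NU: "graphon N U" and w: "weak_isomorphism M W N U \<phi>"
    and G: "simple_graph_on k E"
  shows "hom_density k E M W = hom_density k E N U"
proof -
  interpret M: graphon M W by fact
  interpret N: graphon N U by fact
  let ?I = "{1..k}"
  let ?PM = "PiM ?I (\<lambda>_. M)" and ?PN = "PiM ?I (\<lambda>_. N)" and ?PC = "PiM ?I (\<lambda>_. completion M)"
  have E: "finite E" using G by (rule simple_graph_on_finite)
  note e = simple_graph_on_edge[OF G]
  \<comment> \<open>\<open>U\<close> is measurable only for the completed product, while the image
    law is computed on the product of copies of \<open>N\<close> itself; hence the integrand is
    rebuilt from a product-measurable version \<open>V\<close>.\<close>
  from completion_ex_borel_measurable_real[OF N.kernel_measurable] obtain V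
    where V[measurable]: "V \<in> borel_measurable (N \<Otimes>\<^sub>M N)" and UV: "AE z in N \<Otimes>\<^sub>M N. (case z of (x, y) \<Rightarrow> U x y) = V z"
    by blast
  have \<phi>: "measure_preserving (completion M) N \<phi>"
    and WU: "AE (x, y) in M \<Otimes>\<^sub>M M. W x y = U (\<phi> x) (\<phi> y)"
    using w by (auto simp: weak_isomorphism_def pull_back_def)
  have [measurable]: "\<phi> \<in> completion M \<rightarrow>\<^sub>M N" using \<phi> by (rule measure_preserving_measurable)
  have "compose ?I \<phi> \<in> ?PC \<rightarrow>\<^sub>M ?PN" unfolding compose_def by measurable
  then have PN: "measure_preserving ?PC ?PN (compose ?I \<phi>)"
    using \<phi> distr_PiM_finite_prob_space'[of ?I "\<lambda>_. completion M" "\<lambda>_. N" \<phi>]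
    by (auto simp: measure_preserving_iff_distr M.prob_space_completion N.prob_space_axioms)
  have \<tau>: "measure_preserving (completion ?PM) ?PN (\<lambda>x. compose ?I \<phi> x)"
    by (rule measure_preserving_comp[OF measure_preserving_PiM_completion PN])
       (simp_all add: M.prob_space_axioms)
  define f where "f y = (\<Prod>e\<in>E. V (y (Min e), y (Max e)))" for y
  have f[measurable]: "f \<in> borel_measurable ?PN"
    unfolding f_def by (intro borel_measurable_prod measurable_compose[OF _ V]
        measurable_Pair measurable_component_singleton e)
  have ae: "AE y in ?PN. \<forall>e\<in>E. U (y (Min e)) (y (Max e)) = V (y (Min e), y (Max e))"
  proof (intro AE_finite_allI E)
    fix d assume "d \<in> E"
    from measure_preserving_AE[OF measure_preserving_PiM_pair[OF N.prob_space_axioms e(1-3)[OF this]] UV]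
    show "AE y in ?PN. U (y (Min d)) (y (Max d)) = V (y (Min d), y (Max d))" by simp
  qed
  have "AE x in ?PM. \<forall>e\<in>E. W (x (Min e)) (x (Max e)) = U (\<phi> (x (Min e))) (\<phi> (x (Max e)))"
  proof (intro AE_finite_allI E)
    fix d assume "d \<in> E"
    from measure_preserving_AE[OF measure_preserving_PiM_pair[OF M.prob_space_axioms e(1-3)[OF this]] WU]
    show "AE x in ?PM. W (x (Min d)) (x (Max d)) = U (\<phi> (x (Min d))) (\<phi> (x (Max d)))" by simp
  qed
  moreover have "AE x in ?PM. \<forall>e\<in>E. U (\<phi> (x (Min e))) (\<phi> (x (Max e))) = V (compose ?I \<phi> x (Min e), compose ?I \<phi> x (Max e))"
    using measure_preserving_AE[OF \<tau> ae] unfolding AE_completion_iff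
    by eventually_elim (use e in \<open>simp add: compose_def\<close>)
  ultimately have "AE x in ?PM. (\<Prod>e\<in>E. W (x (Min e)) (x (Max e))) = f (compose ?I \<phi> x)"
    by eventually_elim (auto simp: f_def intro!: prod.cong)
  then have "hom_density k E M W = (LINT x|(completion ?PM). f (compose ?I \<phi> x))"
    unfolding hom_density_def
    using measurable_compose[OF measure_preserving_measurable[OF \<tau>] f]
    by (intro integral_cong_AE borel_measurable_prod graphon_PiM_measurable[OF MW] e AE_completion) 
  also have "\<dots> = (LINT y|(distr (completion ?PM) ?PN (\<lambda>x. compose ?I \<phi> x)). f y)"
    by (rule integral_distr[OF measure_preserving_measurable[OF \<tau>] f, symmetric])
  also have "\<dots> = (LINT y|?PN. f y)"
    by (simp only: measure_preserving_distr[OF \<tau>])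
  also have "\<dots> = (LINT y|(completion ?PN). f y)"
    by (rule integral_completion[symmetric]) fact
  also have "\<dots> = hom_density k E N U"
    unfolding hom_density_def
  proof (intro integral_cong_AE borel_measurable_prod graphon_PiM_measurable[OF NU] e AE_completion measurable_completion f)
    show "AE x in ?PN. f x = (\<Prod>e\<in>E. U (x (Min e)) (x (Max e)))"
      using ae by eventually_elim (auto simp: f_def intro!: prod.cong)
  qed
  finally show ?thesis .
qed

lemma weakly_isomorphic_hom_density:
  assumes "graphon M W" "graphon M' W'" "weakly_isomorphic T M W M' W'" "simple_graph_on k E"
  shows "hom_density k E M W = hom_density k E M' W'"
  using assms hom_density_weak_isomorphism unfolding weakly_isomorphic_def by metis

lemma isomorphic_mod_0_hom_density:
  assumes "graphon M W" "graphon M' W'" "isomorphic_mod_0 M W M' W'" "simple_graph_on k E"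
  shows "hom_density k E M W = hom_density k E M' W'"
proof -
  from assms(3) obtain \<phi> where "measure_preserving M M' \<phi>"
    and "AE (x, y) in M \<Otimes>\<^sub>M M. pull_back W' \<phi> x y = W x y"
    by (auto simp: isomorphic_mod_0_def isomorphism_mod_0_def)
  then have "weak_isomorphism M W M' W' \<phi>"
    unfolding weak_isomorphism_def
    by (auto intro: measure_preserving_completion elim!: eventually_mono)
  with assms show ?thesis by (intro hom_density_weak_isomorphism)
qed

section \<open>Borel kernels on the line\<close>

lemma AE_pair_swap:
  assumes "sigma_finite_measure M" "AE (x, y) in M \<Otimes>\<^sub>M M. P x y"
  shows "AE (x, y) in M \<Otimes>\<^sub>M M. P y x"
proof -
  interpret pair_sigma_finite M M using assms(1) by (simp add: pair_sigma_finite_def)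
  have "AE z in distr (M \<Otimes>\<^sub>M M) (M \<Otimes>\<^sub>M M) (\<lambda>(x, y). (y, x)). case z of (x, y) \<Rightarrow> P x y"
    using assms(2) by (subst distr_pair_swap[symmetric])
  from AE_distrD[OF _ this] show ?thesis by (simp add: split_beta)
qed

text \<open>Bound, symmetry and measurability hold everywhere and without completion, so Fubini and
  changes of variables apply directly to \<open>U\<close>.\<close>

locale borel_kernel = prob_space P for P :: "real measure" +
  fixes U :: "real \<Rightarrow> real \<Rightarrow> real" and b :: real
  assumes sets_P [measurable_cong, simp]: "sets P = sets borel"
    and U_measurable [measurable]: "(\<lambda>(x, y). U x y) \<in> borel_measurable (borel \<Otimes>\<^sub>M borel)"
    and U_le: "\<bar>U x y\<bar> \<le> b"
    and U_sym: "U x y = U y x"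

lemma (in borel_kernel) space_P [simp]: "space P = UNIV"
  using sets_eq_imp_space_eq[OF sets_P] by simp

lemma (in borel_kernel) graphon: "graphon P U"
proof
  have "(\<lambda>(x, y). U x y) \<in> borel_measurable (P \<Otimes>\<^sub>M P)" by measurable
  then show "(\<lambda>(x, y). U x y) \<in> borel_measurable (completion (P \<Otimes>\<^sub>M P))"
    by (rule measurable_completion)
qed (use U_le U_sym in auto)

lemma graphon_borel_kernel:
  assumes "graphon M W"
  obtains \<psi> U b where "\<psi> \<in> borel_measurable M" "borel_kernel (distr M borel \<psi>) U b"
    "AE (x, y) in M \<Otimes>\<^sub>M M. W x y = U (\<psi> x) (\<psi> y)"
proof -
  interpret graphon M W by fact
  from kernel_bounded obtain b where b: "\<And>x y. x \<in> space M \<Longrightarrow> y \<in> space M \<Longrightarrow> \<bar>W x y\<bar> \<le> b" by blast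
  from not_empty obtain z where "z \<in> space M" by blast
  with b[of z z] have b0: "0 \<le> b" by linarith
  from completion_ex_borel_measurable_real[OF kernel_measurable] obtain V
    where V: "V \<in> borel_measurable (M \<Otimes>\<^sub>M M)" and WV: "AE z in M \<Otimes>\<^sub>M M. (case z of (x, y) \<Rightarrow> W x y) = V z"
    by blast
  obtain \<psi> G where \<psi>[measurable]: "\<psi> \<in> borel_measurable M"
    and G[measurable]: "G \<in> borel_measurable (borel \<Otimes>\<^sub>M borel)"
    and VG: "\<And>x y. x \<in> space M \<Longrightarrow> y \<in> space M \<Longrightarrow> V (x, y) = G (\<psi> x :: real, \<psi> y)"
    by (rule borel_measurable_pair_factor[OF V]) blast
  \<comment> \<open>The representative \<open>G\<close> obeys the bound and the symmetry only almost
    everywhere. Clamping and averaging over both orders enforce them everywhere and change nothing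
    at points where they already hold.\<close>
  define clamp where "clamp r = max (- b) (min b r)" for r
  have [measurable]: "clamp \<in> borel_measurable borel" unfolding clamp_def by measurable
  define U where "U s t = (clamp (G (s, t)) + clamp (G (t, s))) / 2" for s t
  have WG: "AE (x, y) in M \<Otimes>\<^sub>M M. W x y = G (\<psi> x, \<psi> y)"
    using WV AE_space by eventually_elim (auto simp: space_pair_measure VG)
  have "AE (x, y) in M \<Otimes>\<^sub>M M. W x y = U (\<psi> x) (\<psi> y)"
    using WG AE_pair_swap[OF sigma_finite_measure_axioms WG] AE_space
  proof eventually_elim
    case (elim z)
    obtain x y where z: "z = (x, y)" by (cases z)
    with elim have xy: "x \<in> space M" "y \<in> space M" by (auto simp: space_pair_measure)
    with elim z kernel_symmetric[OF xy] b[OF xy] show ?case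
      by (auto simp: U_def clamp_def max_def min_def)
  qed
  moreover have "borel_kernel (distr M borel \<psi>) U b"
  proof -
    interpret D: prob_space "distr M borel \<psi>" by (rule prob_space_distr) simp
    show ?thesis
    proof
      show "(\<lambda>(x, y). U x y) \<in> borel_measurable (borel \<Otimes>\<^sub>M borel)" unfolding U_def by measurable
      fix x y show "U x y = U y x" by (simp add: U_def)
      have "\<bar>clamp r\<bar> \<le> b" for r using b0 by (auto simp: clamp_def)
      from this[of "G (x, y)"] this[of "G (y, x)"] show "\<bar>U x y\<bar> \<le> b"
        by (auto simp: U_def abs_le_iff field_simps)
    qed simp
  qed
  ultimately show ?thesis using that \<psi> by blast
qed

section \<open>Moments determine laws\<close>

lemma le_0_of_le_mult:
  fixes x :: real
  assumes "\<And>e. 0 < e \<Longrightarrow> x \<le> e * (h + k)" "0 \<le> h" "0 \<le> k"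
  shows "x \<le> 0"
proof (rule field_le_epsilon)
  fix e :: real assume e: "0 < e"
  have "x \<le> e / (h + k + 1) * (h + k)" using assms e by (intro assms(1)) auto
  also have "\<dots> \<le> e" using assms(2,3) e by (simp add: field_simps)
  finally show "x \<le> 0 + e" by simp
qed

text \<open>Signed measures on a compact interval are determined by their power moments: Weierstrass
  extends equality from polynomials to continuous functions, dominated convergence to half-lines,
  and a Dynkin argument to Borel sets. The factor \<open>H\<close> may change sign, so it can later
  contain the other coordinates of a random sequence.\<close>

lemma integral_eq_of_power_moments:
  fixes H :: "'a \<Rightarrow> real" and H' :: "'b \<Rightarrow> real"
  assumes H: "integrable M H" and H': "integrable M' H'"
    and [measurable]: "Y \<in> borel_measurable M" "Y' \<in> borel_measurable M'"
    and Y: "\<And>x. x \<in> space M \<Longrightarrow> \<bar>Y x\<bar> \<le> c" and Y': "\<And>x. x \<in> space M' \<Longrightarrow> \<bar>Y' x\<bar> \<le> c"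
    and mom: "\<And>k. (LINT x|M. H x * Y x ^ k) = (LINT x|M'. H' x * Y' x ^ k)"
    and A: "A \<in> sets borel"
  shows "(LINT x|M. H x * indicator A (Y x)) = (LINT x|M'. H' x * indicator A (Y' x))"
proof -
  have [measurable]: "H \<in> borel_measurable M" "H' \<in> borel_measurable M'" using H H' by auto
  have intg: "integrable N (\<lambda>x. K x * f (Z x))"
    if K: "integrable N K" and [measurable]: "Z \<in> borel_measurable N" "f \<in> borel_measurable borel"
      and Z: "\<And>x. x \<in> space N \<Longrightarrow> \<bar>Z x\<bar> \<le> c" and f: "\<And>t. \<bar>t\<bar> \<le> c \<Longrightarrow> \<bar>f t\<bar> \<le> d"
    for N :: "'z measure" and K Z and f :: "real \<Rightarrow> real" and d
  proof -
    have [measurable]: "K \<in> borel_measurable N" using K by auto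
    have "\<bar>K x * f (Z x)\<bar> \<le> \<bar>d * \<bar>K x\<bar>\<bar>" if "x \<in> space N" for x
      using mult_left_mono[OF f[OF Z[OF that]], of "\<bar>K x\<bar>"]
      by (intro order.trans[OF _ abs_ge_self]) (simp add: abs_mult mult.commute)
    then show ?thesis
      by (intro Bochner_Integration.integrable_bound[OF integrable_mult_right[OF integrable_abs[OF K], of d]])
         (simp_all add: AE_I2)
  qed
  note intM = intg[OF H \<open>Y \<in> borel_measurable M\<close> _ Y] and intM' = intg[OF H' \<open>Y' \<in> borel_measurable M'\<close> _ Y']
  have poly: "(LINT x|M. H x * p (Y x)) = (LINT x|M'. H' x * p (Y' x))" if "real_polynomial_function p" for p
  proof -
    from that obtain a n where p: "p = (\<lambda>x. \<Sum>i\<le>n. a i * x ^ i)"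
      by (auto simp: real_polynomial_function_iff_sum)
    have "\<bar>t ^ i\<bar> \<le> c ^ i" if "\<bar>t\<bar> \<le> c" for t i
      using that by (simp add: power_abs power_mono)
    then have i: "integrable M (\<lambda>x. H x * Y x ^ i)" "integrable M' (\<lambda>x. H' x * Y' x ^ i)" for i
      using intM[of "\<lambda>t. t ^ i" "c ^ i"] intM'[of "\<lambda>t. t ^ i" "c ^ i"] by auto
    have expand: "(LINT x|N. K x * p (Z x)) = (\<Sum>i\<le>n. a i * (LINT x|N. K x * Z x ^ i))"
      if "\<And>i. integrable N (\<lambda>x. K x * Z x ^ i)" for N :: "'z measure" and K Z :: "'z \<Rightarrow> real"
    proof -
      have "(LINT x|N. K x * p (Z x)) = (LINT x|N. (\<Sum>i\<le>n. a i * (K x * Z x ^ i)))"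
        by (simp add: p sum_distrib_left mult_ac)
      also have "\<dots> = (\<Sum>i\<le>n. a i * (LINT x|N. K x * Z x ^ i))"
        using that by (subst Bochner_Integration.integral_sum) auto
      finally show ?thesis .
    qed
    show ?thesis by (simp only: expand[OF i(1)] expand[OF i(2)] mom)
  qed
  have cont: "(LINT x|M. H x * f (Y x)) = (LINT x|M'. H' x * f (Y' x))"
    if f: "continuous_on UNIV f" for f :: "real \<Rightarrow> real"
  proof -
    have fm: "f \<in> borel_measurable borel" using f by (rule borel_measurable_continuous_onI)
    have "bounded (f ` {-c..c})"
      using f by (intro compact_imp_bounded compact_continuous_image) (auto intro: continuous_on_subset)
    then obtain d where d: "\<And>t. \<bar>t\<bar> \<le> c \<Longrightarrow> \<bar>f t\<bar> \<le> d"
      by (force simp: bounded_iff abs_le_iff)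
    let ?h = "LINT x|M. \<bar>H x\<bar>" and ?h' = "LINT x|M'. \<bar>H' x\<bar>"
    have "\<bar>(LINT x|M. H x * f (Y x)) - (LINT x|M'. H' x * f (Y' x))\<bar> \<le> e * (?h + ?h')" if e: "0 < e" for e
    proof -
      obtain g where g: "real_polynomial_function g" "\<And>t. t \<in> {-c..c} \<Longrightarrow> \<bar>f t - g t\<bar> < e"
        using Stone_Weierstrass_real_polynomial_function[of "{-c..c}" f e] f e
        by (auto intro: continuous_on_subset)
      have g': "\<bar>f t - g t\<bar> \<le> e" if "\<bar>t\<bar> \<le> c" for t
        using g(2)[of t] that by (simp add: abs_le_iff[of t] less_imp_le)
      have "continuous_on UNIV g"
        using g(1) by (auto simp: real_polynomial_function_iff_sum intro!: continuous_intros)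
      then have gm: "g \<in> borel_measurable borel" by (rule borel_measurable_continuous_onI)
      have gd: "\<bar>g t\<bar> \<le> d + e" if "\<bar>t\<bar> \<le> c" for t using g'[OF that] d[OF that] by linarith
      have I: "\<bar>(LINT x|N. K x * f (Z x)) - (LINT x|N. K x * g (Z x))\<bar> \<le> e * (LINT x|N. \<bar>K x\<bar>)"
        if K: "integrable N K" and Zm: "Z \<in> borel_measurable N" and Z: "\<And>x. x \<in> space N \<Longrightarrow> \<bar>Z x\<bar> \<le> c"
        for N :: "'z measure" and K Z :: "'z \<Rightarrow> real"
      proof -
        note i = intg[OF K Zm fm Z d] intg[OF K Zm gm Z gd]
        have "\<bar>(LINT x|N. K x * f (Z x)) - (LINT x|N. K x * g (Z x))\<bar> = \<bar>LINT x|N. K x * (f (Z x) - g (Z x))\<bar>"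
          using i by (simp add: right_diff_distrib Bochner_Integration.integral_diff)
        also have "\<dots> \<le> (LINT x|N. \<bar>K x * (f (Z x) - g (Z x))\<bar>)"
          by (rule integral_abs_bound)
        also have "\<dots> \<le> (LINT x|N. e * \<bar>K x\<bar>)"
        proof (rule integral_mono)
          show "integrable N (\<lambda>x. \<bar>K x * (f (Z x) - g (Z x))\<bar>)"
            using i by (simp add: right_diff_distrib)
          show "integrable N (\<lambda>x. e * \<bar>K x\<bar>)" using K by simp
          show "\<bar>K x * (f (Z x) - g (Z x))\<bar> \<le> e * \<bar>K x\<bar>" if "x \<in> space N" for x
            using mult_left_mono[OF g'[OF Z[OF that]], of "\<bar>K x\<bar>"] by (simp add: abs_mult mult.commute)
        qed
        finally show ?thesis by simp
      qed
      note I[OF H \<open>Y \<in> borel_measurable M\<close> Y] I[OF H' \<open>Y' \<in> borel_measurable M'\<close> Y']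
      then show ?thesis using poly[OF g(1)] unfolding distrib_left by linarith
    qed
    moreover have "0 \<le> ?h" "0 \<le> ?h'" by simp_all
    ultimately have "\<bar>(LINT x|M. H x * f (Y x)) - (LINT x|M'. H' x * f (Y' x))\<bar> \<le> 0"
      by (rule le_0_of_le_mult)
    then show ?thesis by simp
  qed
  have half: "(LINT x|M. H x * indicator {..a} (Y x)) = (LINT x|M'. H' x * indicator {..a} (Y' x))" for a
  proof -
    \<comment> \<open>For \<open>n > 0\<close> these are ramps equal to 1 up to \<open>a\<close> and
      to 0 from \<open>a + 1/n\<close> on; they converge pointwise to the indicator of the closed
      half-line.\<close>
    define f where "f n t = max 0 (min 1 (1 - real n * (t - a)))" for n t
    have f1: "\<bar>f n t\<bar> \<le> 1" for n t by (auto simp: f_def)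
    have fc: "continuous_on UNIV (f n)" for n unfolding f_def by (intro continuous_intros)
    have [measurable]: "f n \<in> borel_measurable borel" for n using fc by (rule borel_measurable_continuous_onI)
    have lim: "(\<lambda>n. f n t) \<longlonglongrightarrow> indicator {..a} t" for t
    proof (cases "t \<le> a")
      case True
      then have "f n t = 1" for n by (auto simp: f_def mult_nonneg_nonpos)
      with True show ?thesis by simp
    next
      case False
      then obtain m where m: "1 / (t - a) < real m" using reals_Archimedean2 by blast
      have "f n t = 0" if "m \<le> n" for n
      proof -
        have "1 < real m * (t - a)" using m False by (simp add: field_simps)
        also have "\<dots> \<le> real n * (t - a)" using that False by (intro mult_right_mono) auto
        finally show ?thesis by (simp add: f_def)
      qed
      then have "\<forall>\<^sub>F n in sequentially. f n t = 0" by (auto simp: eventually_sequentially)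
      with False show ?thesis by (auto intro: tendsto_eventually)
    qed
    have b: "\<bar>z * f n t\<bar> \<le> \<bar>z\<bar>" for z n t
      using mult_left_mono[OF f1, of "\<bar>z\<bar>" n t] by (simp add: abs_mult)
    have l: "(\<lambda>n. LINT x|N. K x * f n (Z x)) \<longlonglongrightarrow> (LINT x|N. K x * indicator {..a} (Z x))"
      if K: "integrable N K" and [measurable]: "Z \<in> borel_measurable N" for N :: "'z measure" and K Z :: "'z \<Rightarrow> real"
    proof -
      have [measurable]: "K \<in> borel_measurable N" using K by auto
      show ?thesis
        using K by (intro integral_dominated_convergence[where w="\<lambda>x. \<bar>K x\<bar>"]) (auto intro!: tendsto_mult lim AE_I2 b)
    qed
    show ?thesis
      using l[OF H \<open>Y \<in> borel_measurable M\<close>] l[OF H' \<open>Y' \<in> borel_measurable M'\<close>] unfolding cont[OF fc] by (rule LIMSEQ_unique)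
  qed
  have int: "integrable M (\<lambda>x. H x * indicator A (Y x))" "integrable M' (\<lambda>x. H' x * indicator A (Y' x))"
    if "A \<in> sets borel" for A
    using that intM[of "indicator A" 1] intM'[of "indicator A" 1] by (auto split: split_indicator)
  have B: "(borel :: real measure) = sigma UNIV (range atMost)"
    by (rule borel_eq_atMost)
  have "Int_stable (range (atMost :: real \<Rightarrow> _))" by (auto simp: Int_stable_def)
  moreover have "range (atMost :: real \<Rightarrow> _) \<subseteq> Pow UNIV" by simp
  moreover have "A \<in> sigma_sets UNIV (range (atMost :: real \<Rightarrow> _))" using A unfolding B by simp
  ultimately show ?thesis
  proof (induction rule: sigma_sets_induct_disjoint)
    case (basic A) then show ?case using half by auto
  next
    case empty show ?case by simp
  next
    case (compl A)
    then have [measurable]: "A \<in> sets borel" unfolding B by simp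
    have *: "(LINT x|M. H x) = (LINT x|M'. H' x)" using mom[of 0] by simp
    have ind: "indicator (UNIV - A) t = (1 - indicator A t :: real)" for t by (auto split: split_indicator)
    show ?case
      using compl.IH * H H' int[of A]
      by (simp add: ind right_diff_distrib Bochner_Integration.integral_diff)
  next
    case (union A)
    then have [measurable]: "A i \<in> sets borel" for i unfolding B by (auto simp: subset_eq)
    have s: "(\<lambda>i. indicator (A i) t) sums (indicator (\<Union>i. A i) t :: real)" for t
      using indicator_sums[of A t] union(1) by (auto simp: disjoint_family_on_def)
    have [measurable]: "(\<Union>i. A i) \<in> sets borel" by measurable
    have lim: "(\<lambda>n. LINT x|M. H x * (\<Sum>i<n. indicator (A i) (Y x))) \<longlonglongrightarrow> (LINT x|M. H x * indicator (\<Union>i. A i) (Y x))"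
        if H: "integrable M H" and [measurable]: "Y \<in> borel_measurable M" for M and H :: "'z \<Rightarrow> real" and Y :: "'z \<Rightarrow> real"
    proof -
      have [measurable]: "H \<in> borel_measurable M" using H by auto
      have le: "(\<Sum>i<n. indicator (A i) t) \<le> (indicator (\<Union>i. A i) t :: real)" for n t
        using sum_le_suminf[OF sums_summable[OF s[of t]], of "{..<n}"] sums_unique[OF s[of t]] by simp
      have "\<bar>\<Sum>i<n. indicator (A i) t :: real\<bar> \<le> 1" for n t
        by (subst abs_of_nonneg, rule sum_nonneg, simp, rule order.trans[OF le indicator_le_1])
      from mult_left_mono[OF this abs_ge_zero]
      have b: "\<bar>z * (\<Sum>i<n. indicator (A i) t)\<bar> \<le> \<bar>z\<bar>" for z :: real and n t
        by (simp add: abs_mult)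
      show ?thesis
        using H s unfolding sums_def
        by (intro integral_dominated_convergence[where w="\<lambda>x. \<bar>H x\<bar>"]) (auto intro!: tendsto_mult AE_I2 b)
    qed
    have "(LINT x|M. H x * (\<Sum>i<n. indicator (A i) (Y x))) = (LINT x|M'. H' x * (\<Sum>i<n. indicator (A i) (Y' x)))" for n
    proof -
      have "(LINT x|M. (\<Sum>i<n. H x * indicator (A i) (Y x))) = (LINT x|M'. (\<Sum>i<n. H' x * indicator (A i) (Y' x)))"
        using int union by (subst (1 2) Bochner_Integration.integral_sum) auto
      then show ?thesis by (simp only: sum_distrib_left)
    qed
    with lim[of M H Y] lim[of M' H' Y'] H H' show ?case
      by (auto intro: LIMSEQ_unique)
  qed
qed

text \<open>Coordinates pass one at a time from powers to indicators of Borel sets, which settles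
  all cylinder sets and hence the law. The weight \<open>w\<close> gives the same for measures with
  a density, as required for the kernel-weighted law of a pair.\<close>

lemma distr_eq_of_moments:
  fixes X :: "'i::countable \<Rightarrow> 'a \<Rightarrow> real" and X' :: "'i \<Rightarrow> 'b \<Rightarrow> real"
  assumes M: "finite_measure M" and M': "finite_measure M'"
    and [measurable]: "\<And>i. X i \<in> borel_measurable M" "\<And>i. X' i \<in> borel_measurable M'"
    and X: "\<And>i. \<exists>c. \<forall>x\<in>space M. \<bar>X i x\<bar> \<le> c" and X': "\<And>i. \<exists>c. \<forall>x\<in>space M'. \<bar>X' i x\<bar> \<le> c"
    and w: "integrable M w" "\<And>x. x \<in> space M \<Longrightarrow> 0 \<le> w x" and w': "integrable M' w'" "\<And>x. x \<in> space M' \<Longrightarrow> 0 \<le> w' x"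
    and mom: "\<And>l. (LINT x|M. w x * (\<Prod>i\<leftarrow>l. X i x)) = (LINT x|M'. w' x * (\<Prod>i\<leftarrow>l. X' i x))"
  shows "distr (density M w) (PiM UNIV (\<lambda>_. borel)) (\<lambda>x i. X i x) =
    distr (density M' w') (PiM UNIV (\<lambda>_. borel)) (\<lambda>x i. X' i x)"
proof -
  have [measurable]: "w \<in> borel_measurable M" "w' \<in> borel_measurable M'" using w w' by auto
  have "\<exists>c. (\<forall>x\<in>space M. \<bar>X i x\<bar> \<le> c) \<and> (\<forall>x\<in>space M'. \<bar>X' i x\<bar> \<le> c)" for i
  proof -
    from X[of i] X'[of i] obtain c d where "\<forall>x\<in>space M. \<bar>X i x\<bar> \<le> c" "\<forall>x\<in>space M'. \<bar>X' i x\<bar> \<le> d" by blast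
    then show ?thesis by (intro exI[of _ "max c d"]) (auto simp: le_max_iff_disj)
  qed
  then obtain c where c: "\<And>i x. x \<in> space M \<Longrightarrow> \<bar>X i x\<bar> \<le> c i" "\<And>i x. x \<in> space M' \<Longrightarrow> \<bar>X' i x\<bar> \<le> c i"
    by metis
  have int: "integrable N (\<lambda>x. v x * (\<Prod>i\<leftarrow>l. Z i x) * (\<Prod>i\<in>F. indicator (A i) (Z i x)))"
    if "integrable N v" and Zm[measurable]: "\<And>i. Z i \<in> borel_measurable N" and Z: "\<And>i x. x \<in> space N \<Longrightarrow> \<bar>Z i x\<bar> \<le> c i"
      and [measurable]: "\<And>i. A i \<in> sets borel"
    for N :: "'z measure" and v and Z :: "'i \<Rightarrow> 'z \<Rightarrow> real" and l F and A :: "'i \<Rightarrow> real set"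
  proof (rule Bochner_Integration.integrable_bound[of N "\<lambda>x. (\<Prod>i\<leftarrow>l. c i) * v x"])
    have [measurable]: "v \<in> borel_measurable N" using that by auto
    have [measurable]: "(\<lambda>x. \<Prod>i\<leftarrow>l. Z i x) \<in> borel_measurable N" by (induction l) auto
    show "(\<lambda>x. v x * (\<Prod>i\<leftarrow>l. Z i x) * (\<Prod>i\<in>F. indicator (A i) (Z i x))) \<in> borel_measurable N" by measurable
    have 1: "\<bar>\<Prod>i\<leftarrow>l. Z i x\<bar> \<le> (\<Prod>i\<leftarrow>l. c i)" if "x \<in> space N" for x
      by (induction l) (auto simp: abs_mult intro!: mult_mono Z that order.trans[OF abs_ge_zero Z[OF that]])
    have 2: "\<bar>\<Prod>i\<in>F. indicator (A i) (Z i x) :: real\<bar> \<le> 1" for x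
      by (auto simp: abs_prod intro!: prod_le_1)
    have "\<bar>v x * (\<Prod>i\<leftarrow>l. Z i x) * (\<Prod>i\<in>F. indicator (A i) (Z i x))\<bar> \<le> \<bar>(\<Prod>i\<leftarrow>l. c i) * v x\<bar>" if "x \<in> space N" for x
    proof -
      have "\<bar>v x * (\<Prod>i\<leftarrow>l. Z i x) * (\<Prod>i\<in>F. indicator (A i) (Z i x))\<bar> \<le> (\<bar>v x\<bar> * (\<Prod>i\<leftarrow>l. c i)) * 1"
        unfolding abs_mult using 1[OF that] 2
        by (intro mult_mono mult_nonneg_nonneg) (auto intro: order.trans[OF abs_ge_zero])
      also have "\<dots> \<le> \<bar>(\<Prod>i\<leftarrow>l. c i) * v x\<bar>"
        by (auto simp: abs_mult mult.commute intro!: mult_left_mono)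
      finally show ?thesis .
    qed
    then show "AE x in N. norm (v x * (\<Prod>i\<leftarrow>l. Z i x) * (\<Prod>i\<in>F. indicator (A i) (Z i x))) \<le> norm ((\<Prod>i\<leftarrow>l. c i) * v x)"
      by auto
  qed (use that in auto)
  have claim: "(LINT x|M. w x * (\<Prod>i\<leftarrow>l. X i x) * (\<Prod>i\<in>F. indicator (A i) (X i x))) =
      (LINT x|M'. w' x * (\<Prod>i\<leftarrow>l. X' i x) * (\<Prod>i\<in>F. indicator (A i) (X' i x)))"
    if "finite F" "\<And>i. A i \<in> sets borel" for F l A
    using that
  proof (induction F arbitrary: l rule: finite_induct)
    case empty then show ?case by (simp add: mom)
  next
    case (insert j F)
    have "(LINT x|M. (w x * (\<Prod>i\<leftarrow>l. X i x) * (\<Prod>i\<in>F. indicator (A i) (X i x))) * indicator (A j) (X j x)) =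
      (LINT x|M'. (w' x * (\<Prod>i\<leftarrow>l. X' i x) * (\<Prod>i\<in>F. indicator (A i) (X' i x))) * indicator (A j) (X' j x))"
    proof (rule integral_eq_of_power_moments[where c="c j"])
      \<comment> \<open>The power of the new coordinate \<open>j\<close> joins the monomial, which
        is why \<open>l\<close> stays arbitrary in the induction.\<close>
      show "(LINT x|M. (w x * (\<Prod>i\<leftarrow>l. X i x) * (\<Prod>i\<in>F. indicator (A i) (X i x))) * X j x ^ k) =
        (LINT x|M'. (w' x * (\<Prod>i\<leftarrow>l. X' i x) * (\<Prod>i\<in>F. indicator (A i) (X' i x))) * X' j x ^ k)" for k
        using insert.IH[OF insert.prems, of "replicate k j @ l"]
        by (simp add: prod_list_replicate mult_ac)
    qed (use insert c w w' in \<open>auto intro!: int\<close>)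
    with insert show ?case by (simp add: mult_ac)
  qed
  have fin: "finite_measure (density N v)" if "integrable N v" "\<And>x. x \<in> space N \<Longrightarrow> 0 \<le> v x" for N :: "'z measure" and v :: "'z \<Rightarrow> real"
    using that by (intro finite_measureI) (auto simp: emeasure_density nn_integral_eq_integral cong: nn_integral_cong)
  have emb: "emeasure (distr (density N v) (PiM UNIV (\<lambda>_. borel)) (\<lambda>x i. Z i x)) (prod_emb UNIV (\<lambda>_. borel) F (Pi\<^sub>E F A)) =
      ennreal (LINT x|N. v x * (\<Prod>i\<leftarrow>[]. Z i x) * (\<Prod>i\<in>F. indicator (A i) (Z i x)))"
    if v: "integrable N v" "\<And>x. x \<in> space N \<Longrightarrow> 0 \<le> v x" and Zm[measurable]: "\<And>i. Z i \<in> borel_measurable N" and Z: "\<And>i x. x \<in> space N \<Longrightarrow> \<bar>Z i x\<bar> \<le> c i"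
      and A[measurable]: "\<And>i. A i \<in> sets borel" and F: "finite F"
    for N :: "'z measure" and v and Z :: "'i \<Rightarrow> 'z \<Rightarrow> real" and F and A :: "'i \<Rightarrow> real set"
  proof -
    have [measurable]: "v \<in> borel_measurable N" using v by auto
    have [measurable]: "(\<lambda>x i. Z i x) \<in> N \<rightarrow>\<^sub>M PiM UNIV (\<lambda>_. borel)"
      by (rule measurable_PiM_single') auto
    have S: "prod_emb UNIV (\<lambda>_. borel) F (Pi\<^sub>E F A) \<in> sets (PiM UNIV (\<lambda>_. borel :: real measure))"
      using F by (intro sets_PiM_I) auto
    have "emeasure (distr (density N v) (PiM UNIV (\<lambda>_. borel)) (\<lambda>x i. Z i x)) (prod_emb UNIV (\<lambda>_. borel) F (Pi\<^sub>E F A)) =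
      emeasure (density N v) ({x\<in>space N. \<forall>i\<in>F. Z i x \<in> A i})"
      using S F by (subst emeasure_distr) (auto simp: prod_emb_def intro!: arg_cong2[where f=emeasure])
    also have "\<dots> = (\<integral>\<^sup>+x. ennreal (v x) * indicator {x\<in>space N. \<forall>i\<in>F. Z i x \<in> A i} x \<partial>N)"
      using F by (intro emeasure_density) auto
    also have "\<dots> = (\<integral>\<^sup>+x. ennreal (v x * (\<Prod>i\<leftarrow>[]. Z i x) * (\<Prod>i\<in>F. indicator (A i) (Z i x))) \<partial>N)"
    proof (rule nn_integral_cong)
      fix x assume x: "x \<in> space N"
      have "(\<Prod>i\<in>F. indicator (A i) (Z i x)) = (indicator {x\<in>space N. \<forall>i\<in>F. Z i x \<in> A i} x :: real)"
        using F x by (auto simp: indicator_def prod_eq_1_iff intro: prod_zero)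
      then show "ennreal (v x) * indicator {x\<in>space N. \<forall>i\<in>F. Z i x \<in> A i} x = ennreal (v x * (\<Prod>i\<leftarrow>[]. Z i x) * (\<Prod>i\<in>F. indicator (A i) (Z i x)))"
        by (simp split: split_indicator)
    qed
    also have "\<dots> = ennreal (LINT x|N. v x * (\<Prod>i\<leftarrow>[]. Z i x) * (\<Prod>i\<in>F. indicator (A i) (Z i x)))"
      using v int[of N v Z A "[]" F] Z by (intro nn_integral_eq_integral) (auto intro!: AE_I2 mult_nonneg_nonneg prod_nonneg)
    finally show ?thesis .
  qed
  show ?thesis
  proof (rule measure_eqI_PiM_infinite)
    show "finite_measure (distr (density M w) (PiM UNIV (\<lambda>_. borel)) (\<lambda>x i. X i x))"
      by (intro finite_measure.finite_measure_distr fin w measurable_PiM_single') auto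
    fix A and J :: "'i set" assume J: "finite J" and A: "\<And>i. i \<in> J \<Longrightarrow> A i \<in> sets (borel :: real measure)"
    define A' where "A' i = (if i \<in> J then A i else UNIV)" for i
    have A': "A' i \<in> sets borel" for i using A by (simp add: A'_def)
    have "Pi\<^sub>E J A = Pi\<^sub>E J A'" by (auto simp: A'_def PiE_iff)
    then show "emeasure (distr (density M w) (PiM UNIV (\<lambda>_. borel)) (\<lambda>x i. X i x)) (prod_emb UNIV (\<lambda>_. borel) J (Pi\<^sub>E J A)) =
      emeasure (distr (density M' w') (PiM UNIV (\<lambda>_. borel)) (\<lambda>x i. X' i x)) (prod_emb UNIV (\<lambda>_. borel) J (Pi\<^sub>E J A))"
      using claim[OF J A', of "[]"] emb[OF w _ c(1) A' J] emb[OF w' _ c(2) A' J] by simp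
  qed simp_all
qed

section \<open>Perfect measures\<close>

text \<open>This is perfectness in the sense of Gnedenko and Kolmogorov. It replaces the measurability of
  analytic sets: it lets us pick points in the images of sets of full measure.\<close>

definition perfect_measure :: "'a measure \<Rightarrow> bool" where
  "perfect_measure M \<longleftrightarrow> (\<forall>f\<in>borel_measurable M. \<forall>A\<in>sets M.
     \<exists>B\<in>sets (borel :: real measure). B \<subseteq> f ` A \<and> A - f -` B \<in> null_sets M)"

lemma perfect_measureD:
  fixes f :: "'a \<Rightarrow> real"
  assumes "perfect_measure M" "f \<in> borel_measurable M" "A \<in> sets M"
  obtains B where "B \<in> sets borel" "B \<subseteq> f ` A" "A - f -` B \<in> null_sets M"
  using assms unfolding perfect_measure_def by blast

text \<open>Lusin's theorem. For every rational, \<open>A\<close> is split at that level of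
  \<open>f\<close> and both pieces are approximated by compact sets from inside. On the intersection
  \<open>K\<close> of these approximations each level set is relatively open and closed, which makes
  \<open>f\<close> continuous there.\<close>

lemma lusin_compact:
  fixes M :: "'a::t2_space measure" and f :: "'a \<Rightarrow> real"
  assumes fin: "finite_measure M"
    and inner: "\<And>A e. A \<in> sets M \<Longrightarrow> 0 < e \<Longrightarrow> \<exists>K\<subseteq>A. compact K \<and> K \<in> sets M \<and> measure M (A - K) < e"
    and f[measurable]: "f \<in> borel_measurable M" and A[measurable]: "A \<in> sets M" and e: "0 < e"
  obtains K where "K \<subseteq> A" "compact K" "K \<in> sets M" "measure M (A - K) \<le> e" "continuous_on K f"
proof -
  interpret finite_measure M by fact
  let ?q = "\<lambda>n. real_of_rat (nat_to_rat_surj n)"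
  \<comment> \<open>At each rational two pieces lose at most \<open>d n\<close> each; doubled and
    summed over \<open>n\<close> this gives \<open>e\<close>.\<close>
  define d where "d n = e / 2 * (1/2) ^ Suc n" for n :: nat
  have d: "0 < d n" for n using e by (simp add: d_def)
  let ?S = "\<lambda>n t. {x\<in>A. (f x < ?q n) = t}"
  have S: "?S n t \<in> sets M" for n t
  proof -
    have "?S n t = {x\<in>space M. (f x < ?q n) = t} \<inter> A"
      using sets.sets_into_space[OF A] by auto
    then show ?thesis by simp
  qed
  have "\<forall>p. \<exists>K. K \<subseteq> ?S (fst p) (snd p) \<and> compact K \<and> K \<in> sets M \<and> measure M (?S (fst p) (snd p) - K) < d (fst p)"
    using inner[OF S d] by blast
  then obtain C where "\<forall>p. C p \<subseteq> ?S (fst p) (snd p) \<and> compact (C p) \<and> C p \<in> sets M \<and> measure M (?S (fst p) (snd p) - C p) < d (fst p)"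
    unfolding choice_iff ..
  then have C: "C (n, t) \<subseteq> ?S n t" "compact (C (n, t))" "C (n, t) \<in> sets M" "measure M (?S n t - C (n, t)) < d n" for n t
    by (metis fst_conv snd_conv)+
  note C(3)[measurable]
  define K where "K = (\<Inter>n. C (n, True) \<union> C (n, False))"
  have K_sub: "K \<subseteq> C (n, True) \<union> C (n, False)" for n by (auto simp: K_def)
  show ?thesis
  proof
    show "K \<subseteq> A" using K_sub[of 0] C(1)[of 0] by blast
    show "compact K"
    proof -
      have "closed K" unfolding K_def using C(2) by (intro closed_INT ballI closed_Un compact_imp_closed) auto
      moreover have "K = (C (0, True) \<union> C (0, False)) \<inter> K" using K_sub[of 0] by auto
      ultimately show ?thesis using C(2) by (metis compact_Int_closed compact_Un)
    qed
    show "K \<in> sets M" unfolding K_def by measurable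
    have m: "measure M (A - (C (n, True) \<union> C (n, False))) \<le> e * (1/2) ^ Suc n" for n
    proof -
      have "measure M (A - (C (n, True) \<union> C (n, False))) \<le> measure M ((?S n True - C (n, True)) \<union> (?S n False - C (n, False)))"
        by (rule finite_measure_mono, blast, intro sets.Un sets.Diff S C(3))
      also have "\<dots> \<le> measure M (?S n True - C (n, True)) + measure M (?S n False - C (n, False))"
        by (intro measure_Un_le sets.Diff S C(3))
      also have "\<dots> \<le> d n + d n" using C(4)[of n True] C(4)[of n False] by simp
      finally show ?thesis by (simp add: d_def)
    qed
    have sm: "(\<lambda>n. e * (1/2) ^ Suc n) sums (e * 1)" by (intro sums_mult power_half_series)
    have sm': "summable (\<lambda>n. measure M (A - (C (n, True) \<union> C (n, False))))"
      using m by (intro summable_comparison_test'[OF sums_summable[OF sm]]) auto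
    have "measure M (A - K) = measure M (\<Union>n. A - (C (n, True) \<union> C (n, False)))"
      by (auto simp: K_def intro!: arg_cong[where f="measure M"])
    also have "\<dots> \<le> (\<Sum>n. measure M (A - (C (n, True) \<union> C (n, False))))"
      using sm' by (intro finite_measure_subadditive_countably) auto
    also have "\<dots> \<le> (\<Sum>n. e * (1/2) ^ Suc n)"
      using m sm' sums_summable[OF sm] by (intro suminf_le) auto
    also have "\<dots> = e" using sums_unique[OF sm] by simp
    finally show "measure M (A - K) \<le> e" .
    have ev: "eventually (\<lambda>y. (f y < ?q n) = (f x < ?q n)) (at x within K)" if "x \<in> K" for x n
    proof -
      let ?t = "f x < ?q n"
      have "x \<in> - C (n, \<not> ?t)" using C(1)[of n "\<not> ?t"] by auto
      moreover have "open (- C (n, \<not> ?t))" using C(2) by (simp add: compact_imp_closed open_Compl)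
      ultimately have "eventually (\<lambda>y. y \<in> - C (n, \<not> ?t)) (at x within K)"
        by (intro eventually_at_topological[THEN iffD2]) blast
      moreover have "eventually (\<lambda>y. y \<in> K) (at x within K)" by (simp add: eventually_at_filter)
      ultimately show ?thesis
      proof eventually_elim
        case (elim y)
        then have "y \<in> C (n, ?t)" using K_sub[of n] by (cases ?t) auto
        with C(1)[of n ?t] show ?case by blast
      qed
    qed
    have rat: "\<exists>n. u < ?q n \<and> ?q n < v" if "u < v" for u v
      using of_rat_dense[OF that] surj_nat_to_rat_surj by (metis surjD)
    show "continuous_on K f"
      unfolding continuous_on_def
    proof (intro ballI order_tendstoI)
      fix x a assume x: "x \<in> K" and a: "a < f x"
      from rat[OF a] obtain n where "a < ?q n" "?q n < f x" by blast
      with ev[OF x, of n] show "eventually (\<lambda>y. a < f y) (at x within K)"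
        by (auto elim!: eventually_mono)
    next
      fix x a assume x: "x \<in> K" and a: "f x < a"
      from rat[OF a] obtain n where "f x < ?q n" "?q n < a" by blast
      with ev[OF x, of n] show "eventually (\<lambda>y. f y < a) (at x within K)"
        by (auto elim!: eventually_mono)
    qed
  qed
qed

text \<open>Continuous images of the compact Lusin sets \<open>K n\<close> are compact. Their
  countable union is a Borel subset of the image of \<open>A\<close>, and the \<open>K n\<close>
  exhaust \<open>A\<close> up to a null set.\<close>

lemma perfect_measure_inner_regular:
  fixes M :: "'a::t2_space measure"
  assumes fin: "finite_measure M"
    and inner: "\<And>A e. A \<in> sets M \<Longrightarrow> 0 < e \<Longrightarrow> \<exists>K\<subseteq>A. compact K \<and> K \<in> sets M \<and> measure M (A - K) < e"
  shows "perfect_measure M"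
  unfolding perfect_measure_def
proof (intro ballI)
  interpret finite_measure M by fact
  fix f :: "'a \<Rightarrow> real" and A assume f[measurable]: "f \<in> borel_measurable M" and A[measurable]: "A \<in> sets M"
  have "\<exists>K\<subseteq>A. compact K \<and> K \<in> sets M \<and> measure M (A - K) \<le> inverse (real (Suc n)) \<and> continuous_on K f" for n
    by (rule lusin_compact[OF fin inner f A, of "inverse (real (Suc n))"]) auto
  then obtain K where K: "\<And>n. K n \<subseteq> A" "\<And>n. compact (K n)" "\<And>n. K n \<in> sets M"
    "\<And>n. measure M (A - K n) \<le> inverse (real (Suc n))" "\<And>n. continuous_on (K n) f" by metis
  let ?B = "\<Union>n. f ` K n"
  have B: "?B \<in> sets borel"
    using K by (intro sets.countable_UN'' borel_closed compact_imp_closed compact_continuous_image) auto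
  have S: "A - f -` ?B \<in> sets M"
  proof -
    have "A - f -` ?B = A - (f -` ?B \<inter> space M)" using sets.sets_into_space[OF A] by auto
    then show ?thesis using B by simp
  qed
  have "measure M (A - f -` ?B) \<le> inverse (real (Suc n))" for n
  proof -
    have "measure M (A - f -` ?B) \<le> measure M (A - K n)"
      using S K(3)[of n] by (intro finite_measure_mono) auto
    with K(4)[of n] show ?thesis by simp
  qed
  then have "measure M (A - f -` ?B) \<le> 0"
    using LIMSEQ_inverse_real_of_nat by (intro LIMSEQ_le_const) auto
  then have "A - f -` ?B \<in> null_sets M"
    using S by (auto simp: null_sets_def emeasure_eq_measure measure_le_0_iff)
  with B K(1) show "\<exists>B\<in>sets borel. B \<subseteq> f ` A \<and> A - f -` B \<in> null_sets M"
    by (intro bexI[of _ ?B]) auto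
qed

lemma perfect_measure_borel:
  fixes M :: "'a::polish_space measure"
  assumes "finite_measure M" and sets: "sets M = sets borel"
  shows "perfect_measure M"
proof -
  interpret finite_measure M by fact
  show ?thesis
  proof (rule perfect_measure_inner_regular[OF assms(1)])
    fix A and e :: real assume A: "A \<in> sets M" and e: "0 < e"
    show "\<exists>K\<subseteq>A. compact K \<and> K \<in> sets M \<and> measure M (A - K) < e"
    proof (cases "emeasure M A = 0")
      case True
      then show ?thesis using e by (intro exI[of _ "{}"]) (auto simp: measure_def)
    next
      case False
      have "emeasure M A - ennreal e < emeasure M A"
        using False e by (intro ennreal_between) (auto simp: zero_less_iff_neq_zero less_top[symmetric])
      also have "emeasure M A = (SUP K\<in>{K. K \<subseteq> A \<and> compact K}. emeasure M K)"
        using A sets by (intro inner_regular) auto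
      finally obtain K where K: "K \<subseteq> A" "compact K" "emeasure M A - ennreal e < emeasure M K"
        by (auto simp: less_SUP_iff)
      have KM: "K \<in> sets M" using K(2) sets by (simp add: borel_compact)
      have "measure M A - e < measure M K"
        using K(3) e by (cases "measure M A - e < 0") (auto simp: emeasure_eq_measure ennreal_minus ennreal_less_iff intro: less_le_trans[OF _ measure_nonneg])
      moreover have "measure M (A - K) = measure M A - measure M K"
        using A KM K(1) by (rule finite_measure_Diff)
      ultimately show ?thesis using K KM by (intro exI[of _ K]) auto
    qed
  qed
qed

section \<open>Perfectness of Lebesgue spaces\<close>

lemma perfect_measure_lebesgue_on: "perfect_measure (lebesgue_on {a..b::real})"
proof -
  interpret finite_measure "lebesgue_on {a..b}"
    by (rule finite_measure_lebesgue_on) simp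
  show ?thesis
  proof (rule perfect_measure_inner_regular[OF finite_measure_axioms])
    fix A :: "real set" and e :: real assume A: "A \<in> sets (lebesgue_on {a..b})" and e: "0 < e"
    then have A': "A \<in> sets lebesgue" "A \<subseteq> {a..b}" by (auto simp: sets_restrict_space_iff)
    obtain T where T: "closed T" "T \<subseteq> A" "A - T \<in> lmeasurable" "emeasure lebesgue (A - T) < ennreal e"
      by (rule sets_lebesgue_inner_closed[OF A'(1) e])
    have "compact ({a..b} \<inter> T)" using T(1) by (intro compact_Int_closed) auto
    moreover have "{a..b} \<inter> T = T" using T A' by auto
    moreover have "T \<in> sets lebesgue" using T(1) by auto
    moreover have "measure (lebesgue_on {a..b}) (A - T) < e"
    proof -
      have "measure (lebesgue_on {a..b}) (A - T) = measure lebesgue (A - T)"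
        using A' by (intro measure_restrict_space) auto
      also have "\<dots> < e"
        using T(3,4) e by (simp add: emeasure_eq_measure2 ennreal_less_iff)
      finally show ?thesis .
    qed
    ultimately show "\<exists>K\<subseteq>A. compact K \<and> K \<in> sets (lebesgue_on {a..b}) \<and> measure (lebesgue_on {a..b}) (A - K) < e"
      using T A' by (intro exI[of _ T]) (auto simp: sets_restrict_space_iff)
  qed
qed

text \<open>The second summand is carried by \<open>nat\<close>, so its image under \<open>f\<close>
  is countable and therefore Borel. It can be added to \<open>B\<close> in full, and only the null
  set of the first summand remains.\<close>

lemma perfect_measure_disjoint_union:
  fixes M :: "'a measure" and N :: "nat measure"
  assumes M: "perfect_measure M"
  shows "perfect_measure (disjoint_union_measure M N)"
  unfolding perfect_measure_def
proof (intro ballI)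
  let ?D = "disjoint_union_measure M N"
  fix f :: "'a + nat \<Rightarrow> real" and A assume f[measurable]: "f \<in> borel_measurable ?D" and A: "A \<in> sets ?D"
  have "Inl \<in> M \<rightarrow>\<^sub>M ?D"
  proof (rule measurableI)
    fix S assume "S \<in> sets ?D"
    then show "Inl -` S \<inter> space M \<in> sets M" by (auto simp: sets_disjoint_union_measure)
  qed auto
  from measurable_compose[OF this f] have fl: "(\<lambda>x. f (Inl x)) \<in> borel_measurable M" .
  have Al: "Inl -` A \<in> sets M" and Ar: "Inr -` A \<in> sets N" and A_sub: "A \<subseteq> space ?D"
    using A sets.sets_into_space[OF A] by (auto simp: sets_disjoint_union_measure)
  from perfect_measureD[OF M fl Al] obtain B where B: "B \<in> sets borel"
    "B \<subseteq> (\<lambda>x. f (Inl x)) ` (Inl -` A)" "Inl -` A - (\<lambda>x. f (Inl x)) -` B \<in> null_sets M" by blast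
  define C where "C = B \<union> (\<lambda>n. f (Inr n)) ` (Inr -` A)"
  have C: "C \<in> sets borel"
    unfolding C_def using B(1) sets.countable[of "(\<lambda>n. f (Inr n)) ` (Inr -` A)" borel]
    by (intro sets.Un) auto
  have S: "A - f -` C \<in> sets ?D"
  proof -
    have "A - f -` C = A - (f -` C \<inter> space ?D)" using A_sub by auto
    then show ?thesis using A C measurable_sets[OF f C] by simp
  qed
  have r: "Inr -` (A - f -` C) = {}" by (auto simp: C_def)
  have "emeasure M (Inl -` (A - f -` C)) \<le> emeasure M (Inl -` A - (\<lambda>x. f (Inl x)) -` B)"
    using B(3) by (intro emeasure_mono) (auto simp: C_def)
  then have "emeasure ?D (A - f -` C) = 0"
    using B(3) S by (simp add: emeasure_disjoint_union_measure r null_sets_def)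
  with S C B(2) show "\<exists>B\<in>sets borel. B \<subseteq> f ` A \<and> A - f -` B \<in> null_sets ?D"
    by (intro bexI[of _ C]) (auto simp: C_def null_sets_def)
qed

lemma isomorphism_mod_0E:
  assumes "isomorphism_mod_0 M L \<theta>"
  obtains N N' \<iota> where "\<theta> \<in> M \<rightarrow>\<^sub>M L" "distr M L \<theta> = L" "N \<in> null_sets M" "N' \<in> null_sets L"
    "\<iota> \<in> restrict_space L (space L - N') \<rightarrow>\<^sub>M M"
    "\<And>x. x \<in> space M - N \<Longrightarrow> \<theta> x \<in> space L - N'" "\<And>x. x \<in> space M - N \<Longrightarrow> \<iota> (\<theta> x) = x"
proof -
  from assms obtain N N' where mp: "measure_preserving M L \<theta>" and N: "N \<in> null_sets M" "N' \<in> null_sets L"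
    and iso: "measure_isomorphism (restrict_space M (space M - N)) (restrict_space L (space L - N')) \<theta>"
    unfolding isomorphism_mod_0_def by blast
  have sp: "space (restrict_space M (space M - N)) = space M - N" "space (restrict_space L (space L - N')) = space L - N'"
    by (auto simp: space_restrict_space)
  let ?\<iota> = "inv_into (space M - N) \<theta>"
  have bij: "bij_betw \<theta> (space M - N) (space L - N')"
    and i: "?\<iota> \<in> restrict_space L (space L - N') \<rightarrow>\<^sub>M restrict_space M (space M - N)"
    using iso by (auto simp: measure_isomorphism_def sp measure_preserving_def)
  show ?thesis
  proof
    show "\<theta> \<in> M \<rightarrow>\<^sub>M L" "distr M L \<theta> = L" using mp by (auto simp: measure_preserving_iff_distr)
    show "?\<iota> \<in> restrict_space L (space L - N') \<rightarrow>\<^sub>M M"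
      using measurable_compose[OF i measurable_restrict_space1[OF measurable_ident]] by simp
  qed (use N bij in \<open>auto simp: bij_betw_def\<close>)
qed

lemma perfect_measure_iso:
  assumes iso: "isomorphism_mod_0 M L \<theta>" and L: "perfect_measure L"
  shows "perfect_measure M"
  unfolding perfect_measure_def
proof (intro ballI)
  fix f :: "'a \<Rightarrow> real" and A assume f[measurable]: "f \<in> borel_measurable M" and A[measurable]: "A \<in> sets M"
  obtain N N' \<iota> where \<theta>: "\<theta> \<in> M \<rightarrow>\<^sub>M L" "distr M L \<theta> = L" and N: "N \<in> null_sets M" "N' \<in> null_sets L"
    and \<iota>: "\<iota> \<in> restrict_space L (space L - N') \<rightarrow>\<^sub>M M"
    and inv: "\<And>x. x \<in> space M - N \<Longrightarrow> \<theta> x \<in> space L - N'" "\<And>x. x \<in> space M - N \<Longrightarrow> \<iota> (\<theta> x) = x"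
    by (rule isomorphism_mod_0E[OF iso]) blast
  have O: "space L - N' \<in> sets L" using N(2) by auto
  \<comment> \<open>The value 0 on the null set is harmless: \<open>A'\<close> lies outside
    \<open>N'\<close>, so \<open>g\<close> equals \<open>f\<close> after \<open>\<iota>\<close> at
    every point of \<open>A'\<close>.\<close>
  define g where "g y = (if y \<in> space L - N' then f (\<iota> y) else 0)" for y
  have g: "g \<in> borel_measurable L"
    unfolding g_def using O measurable_compose[OF \<iota> f]
    by (intro measurable_restrict_space_iff[THEN iffD1]) (simp_all add: Int_absorb2)
  define A' where "A' = \<iota> -` A \<inter> (space L - N')"
  have A': "A' \<in> sets L"
    using measurable_sets[OF \<iota> A] O by (simp add: A'_def space_restrict_space sets_restrict_space_iff Int_absorb1)
  from perfect_measureD[OF L g A'] obtain B where B: "B \<in> sets borel" "B \<subseteq> g ` A'" "A' - g -` B \<in> null_sets L" by blast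
  have S: "A - f -` B \<in> sets M"
  proof -
    have "A - f -` B = A - (f -` B \<inter> space M)" using sets.sets_into_space[OF A] by auto
    then show ?thesis using B(1) by simp
  qed
  have "\<theta> -` (A' - g -` B) \<inter> space M \<in> null_sets M"
    using B(3) \<theta> by (auto simp: null_sets_def emeasure_distr[symmetric] measurable_sets)
  then have n: "N \<union> (\<theta> -` (A' - g -` B) \<inter> space M) \<in> null_sets M" using N(1) by auto
  have "A - f -` B \<subseteq> N \<union> (\<theta> -` (A' - g -` B) \<inter> space M)"
    using inv sets.sets_into_space[OF A] by (auto simp: A'_def g_def)
  then have "A - f -` B \<in> null_sets M" by (rule null_sets_subset[OF n S])
  moreover have "B \<subseteq> f ` A" using B(2) by (auto simp: A'_def g_def)
  ultimately show "\<exists>B\<in>sets borel. B \<subseteq> f ` A \<and> A - f -` B \<in> null_sets M" using B(1) by blast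
qed

lemma perfect_measure_lebesgue_space: "lebesgue_space M \<Longrightarrow> perfect_measure M"
  unfolding lebesgue_space_def
  using perfect_measure_iso perfect_measure_disjoint_union[OF perfect_measure_lebesgue_on] by blast

section \<open>Anchored densities\<close>

abbreviation borel2 :: "(real \<times> real) measure" where "borel2 \<equiv> borel \<Otimes>\<^sub>M borel"

text \<open>This class is closed under sums, products, composition and integration over one
  variable, so integrability and the use of Fubini follow from the shape of a term.\<close>

definition bdd_measurable :: "'a measure \<Rightarrow> ('a \<Rightarrow> real) \<Rightarrow> bool" where
  "bdd_measurable M f \<longleftrightarrow> f \<in> borel_measurable M \<and> (\<exists>c. \<forall>x\<in>space M. \<bar>f x\<bar> \<le> c)"

lemma bdd_measurableI:
  "f \<in> borel_measurable M \<Longrightarrow> (\<And>x. x \<in> space M \<Longrightarrow> \<bar>f x\<bar> \<le> c) \<Longrightarrow> bdd_measurable M f"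
  by (auto simp: bdd_measurable_def)

lemma bdd_measurable_measurable [measurable_dest]:
  "bdd_measurable M f \<Longrightarrow> f \<in> borel_measurable M"
  by (auto simp: bdd_measurable_def)

lemma bdd_measurableE:
  assumes "bdd_measurable M f"
  obtains c where "0 \<le> c" "\<And>x. x \<in> space M \<Longrightarrow> \<bar>f x\<bar> \<le> c"
proof -
  from assms obtain c where "\<And>x. x \<in> space M \<Longrightarrow> \<bar>f x\<bar> \<le> c" by (auto simp: bdd_measurable_def)
  then have "\<And>x. x \<in> space M \<Longrightarrow> \<bar>f x\<bar> \<le> max 0 c" by (simp add: le_max_iff_disj)
  then show ?thesis using that[of "max 0 c"] by simp
qed

lemma bdd_measurable_const [intro]: "bdd_measurable M (\<lambda>_. c)"
  by (rule bdd_measurableI[of _ _ "\<bar>c\<bar>"]) simp_all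

lemma bdd_measurable_indicator [intro]: "A \<in> sets M \<Longrightarrow> bdd_measurable M (indicator A)"
  by (rule bdd_measurableI[of _ _ 1]) (auto split: split_indicator)

lemma bdd_measurable_mult [intro]:
  assumes "bdd_measurable M f" "bdd_measurable M g"
  shows "bdd_measurable M (\<lambda>x. f x * g x)"
proof -
  obtain c where c: "0 \<le> c" "\<And>x. x \<in> space M \<Longrightarrow> \<bar>f x\<bar> \<le> c" by (rule bdd_measurableE[OF assms(1)]) blast
  obtain d where d: "0 \<le> d" "\<And>x. x \<in> space M \<Longrightarrow> \<bar>g x\<bar> \<le> d" by (rule bdd_measurableE[OF assms(2)]) blast
  show ?thesis
    using assms c d by (intro bdd_measurableI[of _ _ "c * d"]) (auto simp: abs_mult intro!: mult_mono)
qed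

lemma bdd_measurable_add [intro]:
  assumes "bdd_measurable M f" "bdd_measurable M g"
  shows "bdd_measurable M (\<lambda>x. f x + g x)"
proof -
  obtain c where c: "0 \<le> c" "\<And>x. x \<in> space M \<Longrightarrow> \<bar>f x\<bar> \<le> c" by (rule bdd_measurableE[OF assms(1)]) blast
  obtain d where d: "0 \<le> d" "\<And>x. x \<in> space M \<Longrightarrow> \<bar>g x\<bar> \<le> d" by (rule bdd_measurableE[OF assms(2)]) blast
  show ?thesis
    using assms c d
    by (intro bdd_measurableI[of _ _ "c + d"]) (auto intro: order.trans[OF abs_triangle_ineq] add_mono)
qed

lemma bdd_measurable_diff [intro]:
  assumes "bdd_measurable M f" "bdd_measurable M g"
  shows "bdd_measurable M (\<lambda>x. f x - g x)"
  using bdd_measurable_add[OF assms(1) bdd_measurable_mult[OF bdd_measurable_const[of _ "-1"] assms(2)]]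
  by simp

lemma bdd_measurable_prod [intro]:
  "(\<And>i. i \<in> I \<Longrightarrow> bdd_measurable M (f i)) \<Longrightarrow> bdd_measurable M (\<lambda>x. \<Prod>i\<in>I. f i x)"
  by (induction I rule: infinite_finite_induct) auto

lemma bdd_measurable_sum [intro]:
  "(\<And>i. i \<in> I \<Longrightarrow> bdd_measurable M (f i)) \<Longrightarrow> bdd_measurable M (\<lambda>x. \<Sum>i\<in>I. f i x)"
  by (induction I rule: infinite_finite_induct) auto

lemma bdd_measurable_prod_list [intro]:
  "(\<And>i. i \<in> set l \<Longrightarrow> bdd_measurable M (f i)) \<Longrightarrow> bdd_measurable M (\<lambda>x. \<Prod>i\<leftarrow>l. f i x)"
  by (induction l) auto

lemma bdd_measurable_compose:
  assumes "g \<in> M \<rightarrow>\<^sub>M N" "bdd_measurable N f"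
  shows "bdd_measurable M (\<lambda>x. f (g x))"
proof -
  obtain c where c: "\<And>x. x \<in> space N \<Longrightarrow> \<bar>f x\<bar> \<le> c" by (rule bdd_measurableE[OF assms(2)]) blast
  show ?thesis
    using assms measurable_compose[of g M N f borel] measurable_space[OF assms(1)]
    by (intro bdd_measurableI[of _ _ c] c) auto
qed

lemma (in finite_measure) integrable_bdd_measurable:
  assumes "bdd_measurable M f" shows "integrable M f"
  using assms unfolding bdd_measurable_def by (auto intro!: integrable_const_bound AE_I2)

lemma (in prob_space) bdd_measurable_integral:
  assumes "bdd_measurable (N \<Otimes>\<^sub>M M) (\<lambda>(x, y). f x y)"
  shows "bdd_measurable N (\<lambda>x. LINT y|M. f x y)"
proof -
  obtain c where c: "0 \<le> c" "\<And>z. z \<in> space (N \<Otimes>\<^sub>M M) \<Longrightarrow> \<bar>case z of (x, y) \<Rightarrow> f x y\<bar> \<le> c"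
    by (rule bdd_measurableE[OF assms]) blast
  have [measurable]: "(\<lambda>(x, y). f x y) \<in> borel_measurable (N \<Otimes>\<^sub>M M)" using assms by measurable
  show ?thesis
  proof (rule bdd_measurableI[of _ _ c])
    fix x assume x: "x \<in> space N"
    have b: "\<bar>f x y\<bar> \<le> c" if "y \<in> space M" for y using c(2)[of "(x, y)"] x that by (simp add: space_pair_measure)
    have [measurable]: "f x \<in> borel_measurable M" using x by measurable
    have "integrable M (f x)" using b by (intro integrable_const_bound[of _ c]) (auto intro!: AE_I2)
    then have "\<bar>LINT y|M. f x y\<bar> \<le> (LINT y|M. \<bar>f x y\<bar>)" by (intro integral_abs_bound)
    also have "\<dots> \<le> (LINT y|M. c)" using b \<open>integrable M (f x)\<close> by (intro integral_mono) auto
    finally show "\<bar>LINT y|M. f x y\<bar> \<le> c" by (simp add: prob_space)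
  qed measurable
qed

lemma finite_Union_card_2: "finite A \<Longrightarrow> \<forall>e\<in>A. card e = 2 \<Longrightarrow> finite (\<Union>A)"
  by (intro finite_Union) (auto intro!: card_ge_0_finite)

section \<open>Kernel integrals over an i.i.d. sequence of points\<close>

context borel_kernel
begin

abbreviation P2 :: "(real \<times> real) measure" where "P2 \<equiv> P \<Otimes>\<^sub>M P"

lemma measurable_P_iff [simp]: "measurable M P = borel_measurable M"
  by (rule measurable_cong_sets) simp_all

lemma pair_prob_space: "pair_prob_space P P" ..

lemma bdd_measurable_U:
  assumes [measurable]: "f \<in> borel_measurable M" "g \<in> borel_measurable M"
  shows "bdd_measurable M (\<lambda>x. U (f x) (g x))"
proof (rule bdd_measurableI[of _ _ b])
  have "(\<lambda>x. case (f x, g x) of (x, y) \<Rightarrow> U x y) \<in> borel_measurable M" by measurable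
  then show "(\<lambda>x. U (f x) (g x)) \<in> borel_measurable M" by simp
qed (rule U_le)

definition T2 :: "real \<Rightarrow> real \<Rightarrow> real" where
  "T2 x y = (LINT u|P. U x u * U u y)"

lemma bdd_measurable_T2_pair: "bdd_measurable (borel2) (\<lambda>(x, y). T2 x y)"
proof -
  have "bdd_measurable ((borel2) \<Otimes>\<^sub>M P) (\<lambda>(z, u). U (fst z) u * U u (snd z))"
    unfolding split_beta by (intro bdd_measurable_mult bdd_measurable_U) measurable
  from bdd_measurable_integral[OF this] show ?thesis by (simp add: T2_def split_beta')
qed

lemma bdd_measurable_T2:
  assumes [measurable]: "f \<in> borel_measurable M" "g \<in> borel_measurable M"
  shows "bdd_measurable M (\<lambda>x. T2 (f x) (g x))"
  using bdd_measurable_compose[OF _ bdd_measurable_T2_pair, of "\<lambda>x. (f x, g x)" M] by simp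

abbreviation Q :: "(nat \<Rightarrow> real) measure" where "Q \<equiv> \<Pi>\<^sub>M i\<in>UNIV. P"

lemma prob_space_Q: "prob_space Q"
  by (intro prob_space_PiM prob_space_axioms)

lemma coordinate_measurable [measurable]: "(\<lambda>\<xi>. \<xi> i) \<in> borel_measurable Q"
proof -
  have "(\<lambda>\<xi>. \<xi> i) \<in> Q \<rightarrow>\<^sub>M P" by measurable
  then show ?thesis by simp
qed

lemma measurable_upd [measurable (raw)]:
  assumes [measurable]: "f \<in> M \<rightarrow>\<^sub>M Q" "g \<in> borel_measurable M"
  shows "(\<lambda>x. (f x)(k := g x)) \<in> M \<rightarrow>\<^sub>M Q"
proof -
  have "g \<in> M \<rightarrow>\<^sub>M P" by measurable
  then show ?thesis by (intro measurable_fun_upd[where J=UNIV] assms) auto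
qed

lemma integral_fresh:
  assumes h: "bdd_measurable Q h"
  shows "(LINT \<xi>|Q. (LINT u|P. h (\<xi>(k := u)))) = (LINT \<xi>|Q. h \<xi>)"
proof -
  interpret Q: prob_space Q by (rule prob_space_Q)
  interpret PQ: pair_prob_space P Q ..
  have m: "(\<lambda>(u, \<xi>). \<xi>(k := u)) \<in> P \<Otimes>\<^sub>M Q \<rightarrow>\<^sub>M Q" by measurable
  have "(LINT \<xi>|Q. h \<xi>) = (LINT \<xi>|(distr (P \<Otimes>\<^sub>M Q) Q (\<lambda>(u, \<xi>). \<xi>(k := u))). h \<xi>)"
    using distr_pair_PiM_eq_PiM[of UNIV "\<lambda>_. P" k] prob_space_axioms by simp
  also have "\<dots> = (LINT (u, \<xi>)|(P \<Otimes>\<^sub>M Q). h (\<xi>(k := u)))"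
    using m h by (subst integral_distr) (auto simp: split_beta')
  also have "\<dots> = (LINT \<xi>|Q. (LINT u|P. h (\<xi>(k := u))))"
    using bdd_measurable_compose[OF m h]
    by (intro PQ.integral_snd[symmetric] PQ.integrable_bdd_measurable) (simp add: split_beta')
  finally show ?thesis by simp
qed

text \<open>An inner integral over a new point becomes the coordinate \<open>k\<close>, provided
  that the remaining factor \<open>g\<close> does not look at \<open>k\<close>. This is how
  integration variables turn into vertices.\<close>

lemma integral_fresh1:
  assumes "bdd_measurable Q g" "bdd_measurable Q h" "\<And>\<xi> u. g (\<xi>(k := u)) = g \<xi>"
  shows "(LINT \<xi>|Q. g \<xi> * (LINT u|P. h (\<xi>(k := u)))) = (LINT \<xi>|Q. g \<xi> * h \<xi>)"
  using integral_fresh[of "\<lambda>\<xi>. g \<xi> * h \<xi>" k] assms by auto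

lemma integral_fresh2:
  assumes g: "bdd_measurable Q g" and h: "bdd_measurable Q h"
    and g1: "\<And>\<xi> u. g (\<xi>(k := u)) = g \<xi>" and g2: "\<And>\<xi> u. g (\<xi>(k' := u)) = g \<xi>" 
  shows "(LINT \<xi>|Q. g \<xi> * (LINT z|P2. h (\<xi>(k := fst z, k' := snd z)))) = (LINT \<xi>|Q. g \<xi> * h \<xi>)"
proof -
  interpret PP: pair_prob_space P P by (rule pair_prob_space)
  have m: "(\<lambda>z. \<xi>(k := fst z, k' := snd z)) \<in> P2 \<rightarrow>\<^sub>M Q" for \<xi>
  proof -
    have "(\<lambda>_. \<xi>) \<in> P2 \<rightarrow>\<^sub>M Q" by (intro measurable_const) (simp add: space_PiM)
    then show ?thesis by measurable
  qed
  have i: "(LINT z|P2. h (\<xi>(k := fst z, k' := snd z))) = (LINT u|P. (LINT v|P. h (\<xi>(k := u, k' := v))))" for \<xi>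
    using PP.integral_fst[of "\<lambda>u v. h (\<xi>(k := u, k' := v))"]
      PP.integrable_bdd_measurable[OF bdd_measurable_compose[OF m h], of \<xi>]
    by (simp add: split_beta')
  have "bdd_measurable (Q \<Otimes>\<^sub>M P) (\<lambda>(\<xi>, v). h (\<xi>(k' := v)))"
    unfolding split_beta by (intro bdd_measurable_compose[OF _ h]) measurable
  from integral_fresh1[OF g bdd_measurable_integral[OF this] g1]
  have "(LINT \<xi>|Q. g \<xi> * (LINT u|P. (LINT v|P. h (\<xi>(k := u, k' := v))))) = (LINT \<xi>|Q. g \<xi> * (LINT v|P. h (\<xi>(k' := v))))"
    by simp
  also have "\<dots> = (LINT \<xi>|Q. g \<xi> * h \<xi>)"
    by (rule integral_fresh1[OF g h g2])
  finally show ?thesis by (simp only: i)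
qed

definition edge_prod :: "nat set set \<Rightarrow> (nat \<Rightarrow> real) \<Rightarrow> real" where
  "edge_prod A \<xi> = (\<Prod>e\<in>A. U (\<xi> (Min e)) (\<xi> (Max e)))"

text \<open>Each pair stands for a path of length two through an anonymous middle vertex. A list
  allows repeated pairs; their paths will receive different middle vertices.\<close>

definition path_prod :: "(nat \<times> nat) list \<Rightarrow> (nat \<Rightarrow> real) \<Rightarrow> real" where
  "path_prod L \<xi> = (\<Prod>(i, j)\<leftarrow>L. T2 (\<xi> i) (\<xi> j))"

text \<open>\<open>z\<close> holds two free vertices. The flag adds the edge between them, and the
  lists attach them to anchors by paths of length two, a repeated entry being a power of a
  coordinate. Each free vertex thus carries a monomial in its anchor coordinates, and the index type
  is countable.\<close>

definition anchored_density :: "bool \<times> nat list \<times> nat list \<Rightarrow> (nat \<Rightarrow> real) \<Rightarrow> real" where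
  "anchored_density = (\<lambda>(f, l, l') \<xi>. LINT z|P2. (if f then U (fst z) (snd z) else 1) *
     ((\<Prod>i\<leftarrow>l. T2 (fst z) (\<xi> i)) * (\<Prod>i\<leftarrow>l'. T2 (snd z) (\<xi> i))))"

definition anchored_prod :: "(bool \<times> nat list \<times> nat list) list \<Rightarrow> (nat \<Rightarrow> real) \<Rightarrow> real" where
  "anchored_prod C \<xi> = (\<Prod>c\<leftarrow>C. anchored_density c \<xi>)"

lemma bdd_measurable_edge_prod: "bdd_measurable Q (edge_prod A)"
  unfolding edge_prod_def[abs_def] by (intro bdd_measurable_prod bdd_measurable_U) measurable

lemma bdd_measurable_path_prod: "bdd_measurable Q (path_prod L)"
  unfolding path_prod_def[abs_def] split_beta
  by (intro bdd_measurable_prod_list bdd_measurable_T2) measurable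

lemma bdd_measurable_anchored_density: "bdd_measurable Q (anchored_density c)"
proof -
  interpret PP: pair_prob_space P P by (rule pair_prob_space)
  obtain f l l' where c: "c = (f, l, l')" by (cases c)
  have "bdd_measurable (Q \<Otimes>\<^sub>M P2) (\<lambda>(\<xi>, z). (if f then U (fst z) (snd z) else 1) *
     ((\<Prod>i\<leftarrow>l. T2 (fst z) (\<xi> i)) * (\<Prod>i\<leftarrow>l'. T2 (snd z) (\<xi> i))))"
    unfolding split_beta
    by (cases f; simp only: if_True if_False;
        intro bdd_measurable_mult bdd_measurable_prod_list bdd_measurable_T2 bdd_measurable_U bdd_measurable_const) measurable
  from PP.bdd_measurable_integral[OF this] show ?thesis
    by (simp add: anchored_density_def c)
qed

lemma bdd_measurable_anchored_prod: "bdd_measurable Q (anchored_prod C)"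
  unfolding anchored_prod_def[abs_def]
  by (intro bdd_measurable_prod_list bdd_measurable_anchored_density)

lemma edge_prod_insert:
  assumes "finite A" "{i, j} \<notin> A" "i \<noteq> j"
  shows "edge_prod (insert {i, j} A) \<xi> = U (\<xi> i) (\<xi> j) * edge_prod A \<xi>"
proof -
  have "U (\<xi> (Min {i, j})) (\<xi> (Max {i, j})) = U (\<xi> i) (\<xi> j)"
    using assms(3) U_sym by (cases "i < j") (auto simp: min_def max_def)
  with assms show ?thesis by (simp add: edge_prod_def)
qed

lemma edge_prod_fresh:
  assumes "k \<notin> \<Union>A" "\<forall>e\<in>A. card e = 2"
  shows "edge_prod A (\<xi>(k := u)) = edge_prod A \<xi>"
  unfolding edge_prod_def
proof (intro prod.cong refl)
  fix e assume e: "e \<in> A"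
  then have "finite e" "e \<noteq> {}" using assms(2) by (auto intro: card_ge_0_finite)
  then have "Min e \<in> e" "Max e \<in> e" by auto
  then have "Min e \<noteq> k" "Max e \<noteq> k" using e assms(1) by auto
  then show "U ((\<xi>(k := u)) (Min e)) ((\<xi>(k := u)) (Max e)) = U (\<xi> (Min e)) (\<xi> (Max e))" by simp
qed

lemma path_prod_fresh:
  assumes "k \<notin> fst ` set L \<union> snd ` set L"
  shows "path_prod L (\<xi>(k := u)) = path_prod L \<xi>"
  using assms by (induction L) (auto simp: path_prod_def)

lemma anchored_prod_fresh:
  assumes "k \<notin> (\<Union>(f, l, l')\<in>set C. set l \<union> set l')"
  shows "anchored_prod C (\<xi>(k := u)) = anchored_prod C \<xi>"
  using assms
proof (induction C)
  case (Cons c C)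
  obtain f l l' where c: "c = (f, l, l')" by (cases c)
  have "(\<Prod>i\<leftarrow>m. T2 x ((\<xi>(k := u)) i)) = (\<Prod>i\<leftarrow>m. T2 x (\<xi> i))" if "k \<notin> set m" for m x
    using that by (induction m) auto
  with Cons show ?case by (simp add: anchored_prod_def anchored_density_def c)
qed (simp add: anchored_prod_def)

section \<open>Anchored moments as densities of simple graphs\<close>

lemma integral_edge_prod:
  assumes A: "finite A" "\<forall>e\<in>A. card e = 2" and n: "\<Union>A \<subseteq> {..<n}"
  shows "(LINT \<xi>|Q. edge_prod A \<xi>) = hom_density n ((`) Suc ` A) P U"
proof -
  let ?G = "(`) Suc ` A" and ?I = "{1..n}"
  \<comment> \<open>Coordinates of the sequence start at 0, vertices of a graph at 1: vertex
    \<open>i\<close> reads coordinate \<open>i - 1\<close>.\<close>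
  let ?r = "\<lambda>\<omega>. \<lambda>i\<in>?I. \<omega> (i - 1)"
  have mr: "?r \<in> Q \<rightarrow>\<^sub>M PiM ?I (\<lambda>_. P)" by measurable
  have d: "distr Q (PiM ?I (\<lambda>_. P)) ?r = PiM ?I (\<lambda>_. P)"
    by (rule distr_PiM_reindex[of UNIV "\<lambda>_. P" "\<lambda>i. i - 1" ?I]) (auto simp: prob_space_axioms inj_on_def)
  have G: "simple_graph_on n ?G"
    using A n by (force simp: simple_graph_on_def card_image)
  have [measurable]: "(\<lambda>x. \<Prod>e\<in>?G. U (x (Min e)) (x (Max e))) \<in> borel_measurable (PiM ?I (\<lambda>_. P))"
  proof (rule borel_measurable_prod, rule bdd_measurable_measurable, rule bdd_measurable_U)
    fix e assume "e \<in> ?G"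
    note e = simple_graph_on_edge[OF G this]
    have "(\<lambda>x. x (Min e)) \<in> PiM ?I (\<lambda>_. P) \<rightarrow>\<^sub>M P" "(\<lambda>x. x (Max e)) \<in> PiM ?I (\<lambda>_. P) \<rightarrow>\<^sub>M P"
      by (rule measurable_component_singleton[of _ ?I "\<lambda>_. P"]; fact e)+
    then show "(\<lambda>x. x (Min e)) \<in> borel_measurable (PiM ?I (\<lambda>_. P))" "(\<lambda>x. x (Max e)) \<in> borel_measurable (PiM ?I (\<lambda>_. P))"
      by simp_all
  qed
  have "hom_density n ?G P U = (LINT x|(PiM ?I (\<lambda>_. P)). (\<Prod>e\<in>?G. U (x (Min e)) (x (Max e))))"
    unfolding hom_density_def by (rule integral_completion) measurable
  also have "\<dots> = (LINT x|(distr Q (PiM ?I (\<lambda>_. P)) ?r). (\<Prod>e\<in>?G. U (x (Min e)) (x (Max e))))"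
    by (simp only: d)
  also have "\<dots> = (LINT \<xi>|Q. (\<Prod>e\<in>?G. U (?r \<xi> (Min e)) (?r \<xi> (Max e))))"
    by (rule integral_distr[OF mr]) measurable
  also have "(\<lambda>\<xi>. \<Prod>e\<in>?G. U (?r \<xi> (Min e)) (?r \<xi> (Max e))) = edge_prod A"
  proof
    fix \<xi>
    have "inj_on ((`) Suc) A" by (auto simp: inj_on_def inj_image_eq_iff)
    then have "(\<Prod>e\<in>?G. U (?r \<xi> (Min e)) (?r \<xi> (Max e))) = (\<Prod>e\<in>A. U (?r \<xi> (Min (Suc ` e))) (?r \<xi> (Max (Suc ` e))))"
      by (simp only: prod.reindex comp_def)
    also have "\<dots> = edge_prod A \<xi>"
      unfolding edge_prod_def
    proof (intro prod.cong refl)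
      fix e assume e: "e \<in> A"
      then have fe: "finite e" "e \<noteq> {}" using A(2) by (auto intro: card_ge_0_finite)
      then have me: "Min (Suc ` e) = Suc (Min e)" "Max (Suc ` e) = Suc (Max e)"
        by (auto simp: mono_Min_commute[symmetric] mono_Max_commute[symmetric] mono_Suc)
      have "Min e \<in> e" "Max e \<in> e" using fe by auto
      then have "Min e < n" "Max e < n" using e n by auto
      then show "U (?r \<xi> (Min (Suc ` e))) (?r \<xi> (Max (Suc ` e))) = U (\<xi> (Min e)) (\<xi> (Max e))"
        unfolding me by simp
    qed
    finally show "(\<Prod>e\<in>?G. U (?r \<xi> (Min e)) (?r \<xi> (Max e))) = edge_prod A \<xi>" .
  qed
  finally show ?thesis ..
qed

text \<open>The middle vertex of the path takes the fresh coordinate \<open>k\<close>. Both new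
  edges contain \<open>k\<close>, hence are absent from \<open>A\<close>, and
  \<open>i \<noteq> j\<close> keeps them apart, so the edge set stays simple however often the pair
  occurs in the list.\<close>

lemma integral_path_prod_step:
  assumes A: "finite A" "\<forall>e\<in>A. card e = 2" and ij: "i \<noteq> j"
    and k: "k \<notin> \<Union>A" "k \<notin> fst ` set ((i, j) # L) \<union> snd ` set ((i, j) # L)"
  shows "(LINT \<xi>|Q. edge_prod A \<xi> * path_prod ((i, j) # L) \<xi>) =
    (LINT \<xi>|Q. edge_prod (insert {i, k} (insert {k, j} A)) \<xi> * path_prod L \<xi>)"
proof -
  define h where "h \<xi> = U (\<xi> i) (\<xi> k) * U (\<xi> k) (\<xi> j)" for \<xi> :: "nat \<Rightarrow> real"
  have kij: "k \<noteq> i" "k \<noteq> j" using k by auto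
  have ins: "edge_prod (insert {i, k} (insert {k, j} A)) \<xi> = h \<xi> * edge_prod A \<xi>" for \<xi>
  proof -
    have "{k, j} \<notin> A" "{i, k} \<notin> insert {k, j} A" using k ij kij by (auto simp: doubleton_eq_iff)
    then show ?thesis using A kij by (simp add: edge_prod_insert h_def)
  qed
  have "(LINT \<xi>|Q. edge_prod A \<xi> * path_prod ((i, j) # L) \<xi>) =
    (LINT \<xi>|Q. (edge_prod A \<xi> * path_prod L \<xi>) * (LINT u|P. h (\<xi>(k := u))))"
    using kij by (simp add: path_prod_def h_def T2_def mult_ac)
  also have "\<dots> = (LINT \<xi>|Q. (edge_prod A \<xi> * path_prod L \<xi>) * h \<xi>)"
  proof (rule integral_fresh1)
    show "bdd_measurable Q h"
      unfolding h_def[abs_def] by (intro bdd_measurable_mult bdd_measurable_U) measurable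
    fix \<xi> u show "edge_prod A (\<xi>(k := u)) * path_prod L (\<xi>(k := u)) = edge_prod A \<xi> * path_prod L \<xi>"
      using A k by (subst edge_prod_fresh, simp, simp, subst path_prod_fresh) auto
  qed (intro bdd_measurable_mult bdd_measurable_edge_prod bdd_measurable_path_prod)
  also have "\<dots> = (LINT \<xi>|Q. edge_prod (insert {i, k} (insert {k, j} A)) \<xi> * path_prod L \<xi>)"
    by (simp add: ins mult_ac)
  finally show ?thesis .
qed

text \<open>The two free vertices of the factor take the fresh coordinates \<open>k\<close> and
  \<open>k'\<close>. Every factor gets its own pair, so the edge between them is new; the links to
  the anchors are only queued as paths.\<close>

lemma integral_anchored_prod_step:
  assumes A: "finite A" "\<forall>e\<in>A. card e = 2" and kk: "k \<noteq> k'"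
    and k: "k \<notin> \<Union>A" "k \<notin> fst ` set L \<union> snd ` set L" "k \<notin> (\<Union>(f, l, l')\<in>set ((f, l, l') # C). set l \<union> set l')"
    and k': "k' \<notin> \<Union>A" "k' \<notin> fst ` set L \<union> snd ` set L" "k' \<notin> (\<Union>(f, l, l')\<in>set ((f, l, l') # C). set l \<union> set l')"
  shows "(LINT \<xi>|Q. edge_prod A \<xi> * path_prod L \<xi> * anchored_prod ((f, l, l') # C) \<xi>) =
    (LINT \<xi>|Q. edge_prod (if f then insert {k, k'} A else A) \<xi> *
       path_prod (map (Pair k) l @ map (Pair k') l' @ L) \<xi> * anchored_prod C \<xi>)"
proof -
  define h where "h \<xi> = (if f then U (\<xi> k) (\<xi> k') else 1) *
     ((\<Prod>i\<leftarrow>l. T2 (\<xi> k) (\<xi> i)) * (\<Prod>i\<leftarrow>l'. T2 (\<xi> k') (\<xi> i)))" for \<xi> :: "nat \<Rightarrow> real"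
  have T: "(\<Prod>i\<leftarrow>m. T2 x ((\<xi>(k := u, k' := v)) i)) = (\<Prod>i\<leftarrow>m. T2 x (\<xi> i))" if "k \<notin> set m" "k' \<notin> set m" for m x \<xi> u v
    using that by (induction m) auto
  have hu: "h (\<xi>(k := u, k' := v)) = (if f then U u v else 1) *
     ((\<Prod>i\<leftarrow>l. T2 u (\<xi> i)) * (\<Prod>i\<leftarrow>l'. T2 v (\<xi> i)))" for \<xi> u v
    unfolding h_def using k k' kk by (subst T, simp, simp, subst T) auto
  have ins: "(edge_prod A \<xi> * path_prod L \<xi> * anchored_prod C \<xi>) * h \<xi> =
     edge_prod (if f then insert {k, k'} A else A) \<xi> *
       path_prod (map (Pair k) l @ map (Pair k') l' @ L) \<xi> * anchored_prod C \<xi>" for \<xi>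
  proof -
    have "edge_prod (if f then insert {k, k'} A else A) \<xi> = (if f then U (\<xi> k) (\<xi> k') else 1) * edge_prod A \<xi>"
    proof -
      have "{k, k'} \<notin> A" using k(1) by blast
      then show ?thesis using A kk by (simp add: edge_prod_insert)
    qed
    moreover have "path_prod (map (Pair k) l @ map (Pair k') l' @ L) \<xi> =
      (\<Prod>i\<leftarrow>l. T2 (\<xi> k) (\<xi> i)) * (\<Prod>i\<leftarrow>l'. T2 (\<xi> k') (\<xi> i)) * path_prod L \<xi>"
      by (simp add: path_prod_def comp_def)
    ultimately show ?thesis by (simp add: h_def mult_ac)
  qed
  have "(LINT \<xi>|Q. edge_prod A \<xi> * path_prod L \<xi> * anchored_prod ((f, l, l') # C) \<xi>) =
    (LINT \<xi>|Q. (edge_prod A \<xi> * path_prod L \<xi> * anchored_prod C \<xi>) * (LINT z|P2. h (\<xi>(k := fst z, k' := snd z))))"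
    unfolding hu by (simp add: anchored_prod_def anchored_density_def mult_ac)
  also have "\<dots> = (LINT \<xi>|Q. (edge_prod A \<xi> * path_prod L \<xi> * anchored_prod C \<xi>) * h \<xi>)"
  proof (rule integral_fresh2)
    show "bdd_measurable Q h"
      unfolding h_def[abs_def]
      by (cases f; simp only: if_True if_False;
        intro bdd_measurable_mult bdd_measurable_prod_list bdd_measurable_T2 bdd_measurable_U bdd_measurable_const) measurable
    fix \<xi> u
    show "edge_prod A (\<xi>(k := u)) * path_prod L (\<xi>(k := u)) * anchored_prod C (\<xi>(k := u)) =
       edge_prod A \<xi> * path_prod L \<xi> * anchored_prod C \<xi>"
      using A k edge_prod_fresh[of k A] path_prod_fresh[of k L] anchored_prod_fresh[of k C] by simp
    show "edge_prod A (\<xi>(k' := u)) * path_prod L (\<xi>(k' := u)) * anchored_prod C (\<xi>(k' := u)) =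
       edge_prod A \<xi> * path_prod L \<xi> * anchored_prod C \<xi>"
      using A k' edge_prod_fresh[of k' A] path_prod_fresh[of k' L] anchored_prod_fresh[of k' C] by simp
  qed (intro bdd_measurable_mult bdd_measurable_edge_prod bdd_measurable_path_prod bdd_measurable_anchored_prod)
  also have "\<dots> = (LINT \<xi>|Q. edge_prod (if f then insert {k, k'} A else A) \<xi> *
       path_prod (map (Pair k) l @ map (Pair k') l' @ L) \<xi> * anchored_prod C \<xi>)"
    by (simp only: ins)
  finally show ?thesis .
qed

end

text \<open>The graph is chosen before the kernel. This uniformity turns equality of densities into
  equality of \<open>F\<close> for two kernels on different measures.\<close>

definition simple_density :: "(real measure \<Rightarrow> (real \<Rightarrow> real \<Rightarrow> real) \<Rightarrow> real) \<Rightarrow> bool" where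
  "simple_density F \<longleftrightarrow> (\<exists>n G. simple_graph_on n G \<and> (\<forall>P U b. borel_kernel P U b \<longrightarrow> F P U = hom_density n G P U))"

lemma simple_densityI:
  "simple_graph_on n G \<Longrightarrow> (\<And>P U b. borel_kernel P U b \<Longrightarrow> F P U = hom_density n G P U) \<Longrightarrow> simple_density F"
  unfolding simple_density_def by blast

lemma simple_density_cong:
  "simple_density F \<Longrightarrow> (\<And>P U b. borel_kernel P U b \<Longrightarrow> F' P U = F P U) \<Longrightarrow> simple_density F'"
  unfolding simple_density_def by metis

abbreviation path_mean :: "nat set set \<Rightarrow> (nat \<times> nat) list \<Rightarrow> real measure \<Rightarrow> (real \<Rightarrow> real \<Rightarrow> real) \<Rightarrow> real" where
  "path_mean A L P U \<equiv> LINT \<xi>|(\<Pi>\<^sub>M i\<in>UNIV. P). borel_kernel.edge_prod U A \<xi> * borel_kernel.path_prod P U L \<xi>"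

abbreviation anchored_mean :: "nat set set \<Rightarrow> (nat \<times> nat) list \<Rightarrow> (bool \<times> nat list \<times> nat list) list \<Rightarrow>
    real measure \<Rightarrow> (real \<Rightarrow> real \<Rightarrow> real) \<Rightarrow> real" where
  "anchored_mean A L C P U \<equiv> LINT \<xi>|(\<Pi>\<^sub>M i\<in>UNIV. P). borel_kernel.edge_prod U A \<xi> * borel_kernel.path_prod P U L \<xi> *
     borel_kernel.anchored_prod P U C \<xi>"

text \<open>Each path uses up a fresh vertex, which exists because only finitely many occur so far;
  the edge set is generalized since it grows along the way.\<close>

lemma simple_density_path_mean:
  assumes "finite A" "\<forall>e\<in>A. card e = 2" "\<forall>(i, j)\<in>set L. i \<noteq> j"
  shows "simple_density (path_mean A L)"
  using assms
proof (induction L arbitrary: A)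
  case Nil
  have "finite (\<Union>A)" using Nil(1,2) by (rule finite_Union_card_2)
  then obtain n where n: "\<Union>A \<subseteq> {..<n}" by (auto simp: finite_nat_set_iff_bounded)
  show ?case
  proof (rule simple_densityI)
    show "simple_graph_on n ((`) Suc ` A)"
      using Nil n by (force simp: simple_graph_on_def card_image)
    show "path_mean A [] P U = hom_density n ((`) Suc ` A) P U" if "borel_kernel P U b" for P U b
      using borel_kernel.integral_edge_prod[OF that Nil(1,2) n] by (simp add: borel_kernel.path_prod_def[OF that])
  qed
next
  case (Cons p L)
  obtain i j where p: "p = (i, j)" by (cases p)
  have "finite (\<Union>A)" using Cons.prems(1,2) by (rule finite_Union_card_2)
  then have "finite (\<Union>A \<union> (fst ` set (p # L) \<union> snd ` set (p # L)))" by simp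
  from ex_new_if_finite[OF infinite_UNIV_nat this]
  obtain k where k: "k \<notin> \<Union>A" "k \<notin> fst ` set (p # L) \<union> snd ` set (p # L)" by auto
  have ij: "i \<noteq> j" using Cons.prems p by auto
  have "\<forall>e\<in>insert {i, k} (insert {k, j} A). card e = 2" using Cons.prems k p by auto
  then have "simple_density (path_mean (insert {i, k} (insert {k, j} A)) L)"
    using Cons.IH Cons.prems by simp
  then show ?case
  proof (rule simple_density_cong)
    fix P U b assume B: "borel_kernel P U b"
    show "path_mean A (p # L) P U = path_mean (insert {i, k} (insert {k, j} A)) L P U"
      using borel_kernel.integral_path_prod_step[OF B Cons.prems(1,2) ij k[unfolded p]] by (simp add: p)
  qed
qed

text \<open>Anchored factors are dissolved before the paths, because each one appends paths to
  \<open>L\<close> while no path creates an anchored factor. Every new path joins a fresh vertex to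
  an anchor, which keeps its ends distinct.\<close>

lemma simple_density_anchored_mean:
  assumes "finite A" "\<forall>e\<in>A. card e = 2" "\<forall>(i, j)\<in>set L. i \<noteq> j"
  shows "simple_density (anchored_mean A L C)"
  using assms
proof (induction C arbitrary: A L)
  case Nil
  from simple_density_path_mean[OF Nil] show ?case
    by (rule simple_density_cong) (simp add: borel_kernel.anchored_prod_def)
next
  case (Cons c C)
  obtain f l l' where c: "c = (f, l, l')" by (cases c)
  let ?S = "\<Union>A \<union> (fst ` set L \<union> snd ` set L) \<union> (\<Union>(f, l, l')\<in>set (c # C). set l \<union> set l')"
  have "finite (\<Union>A)" using Cons.prems(1,2) by (rule finite_Union_card_2)
  then have fin: "finite ?S" by (auto split: prod.split)
  from ex_new_if_finite[OF infinite_UNIV_nat fin] obtain k where k: "k \<notin> ?S" by blast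
  from ex_new_if_finite[OF infinite_UNIV_nat, of "insert k ?S"] fin
  obtain k' where k': "k' \<notin> ?S" "k' \<noteq> k" by auto
  let ?A = "if f then insert {k, k'} A else A" and ?L = "map (Pair k) l @ map (Pair k') l' @ L"
  have "finite ?A" "\<forall>e\<in>?A. card e = 2" using Cons.prems k' by auto
  moreover have "\<forall>(i, j)\<in>set ?L. i \<noteq> j" using Cons.prems(3) k k' by (auto simp: c)
  ultimately have "simple_density (anchored_mean ?A ?L C)" by (rule Cons.IH)
  then show ?case
  proof (rule simple_density_cong)
    fix P U b assume B: "borel_kernel P U b"
    show "anchored_mean A L (c # C) P U = anchored_mean ?A ?L C P U"
      using borel_kernel.integral_anchored_prod_step[OF B Cons.prems(1,2), of k k' L f l l' C] k k'
      by (simp add: c)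
  qed
qed

lemma anchored_density_moments:
  assumes B: "borel_kernel P U b" and B': "borel_kernel P' U' b'"
    and dens: "\<And>k E. simple_graph_on k E \<Longrightarrow> hom_density k E P U = hom_density k E P' U'"
  shows "(LINT \<xi>|(\<Pi>\<^sub>M i\<in>UNIV. P). (\<Prod>c\<leftarrow>C. borel_kernel.anchored_density P U c \<xi>)) =
    (LINT \<xi>|(\<Pi>\<^sub>M i\<in>UNIV. P'). (\<Prod>c\<leftarrow>C. borel_kernel.anchored_density P' U' c \<xi>))"
proof -
  have "simple_density (anchored_mean {} [] C)" by (rule simple_density_anchored_mean) simp_all
  then obtain n G where G: "simple_graph_on n G"
    and eq: "\<forall>P U b. borel_kernel P U b \<longrightarrow> anchored_mean {} [] C P U = hom_density n G P U"
    unfolding simple_density_def by (elim exE conjE)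
  have "anchored_mean {} [] C P U = anchored_mean {} [] C P' U'"
    by (simp only: eq[rule_format, OF B] eq[rule_format, OF B'] dens[OF G])
  then show ?thesis
    by (simp add: borel_kernel.edge_prod_def[OF B] borel_kernel.edge_prod_def[OF B']
      borel_kernel.path_prod_def[OF B] borel_kernel.path_prod_def[OF B']
      borel_kernel.anchored_prod_def[OF B] borel_kernel.anchored_prod_def[OF B'])
qed

section \<open>Typical anchors\<close>

text \<open>By monotone convergence the sum of the \<open>X k\<close> has finite expectation, so it
  is finite almost surely and its terms tend to 0.\<close>

lemma (in prob_space) AE_tendsto_0_of_summable:
  fixes X :: "nat \<Rightarrow> 'a \<Rightarrow> real"
  assumes int: "\<And>k. integrable M (X k)" and pos: "\<And>k x. 0 \<le> X k x"
    and le: "\<And>k. expectation (X k) \<le> c k" and c: "summable c"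
  shows "AE x in M. (\<lambda>k. X k x) \<longlonglongrightarrow> 0"
proof -
  have [measurable]: "X k \<in> borel_measurable M" for k using int by auto
  have c0: "0 \<le> c k" for k using le[of k] pos by (auto intro: order.trans[rotated] integral_nonneg_AE)
  have "(\<integral>\<^sup>+x. (\<Sum>k. ennreal (X k x)) \<partial>M) = (\<Sum>k. \<integral>\<^sup>+x. ennreal (X k x) \<partial>M)"
    by (intro nn_integral_suminf) measurable
  also have "\<dots> = (\<Sum>k. ennreal (expectation (X k)))"
    using int pos by (intro suminf_cong nn_integral_eq_integral) auto
  also have "\<dots> \<le> (\<Sum>k. ennreal (c k))"
    using le by (intro suminf_le summableI) (auto intro: ennreal_leI)
  also have "\<dots> < \<infinity>"
    using c c0 by (simp add: suminf_ennreal2)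
  finally have "AE x in M. (\<Sum>k. ennreal (X k x)) \<noteq> \<infinity>"
    by (intro nn_integral_PInf_AE) auto
  then show ?thesis
  proof eventually_elim
    case (elim x)
    then have "summable (\<lambda>k. X k x)" using pos by (intro summable_suminf_not_top) auto
    then show ?case by (rule summable_LIMSEQ_zero)
  qed
qed

lemma (in prob_space) expectation_square_le:
  assumes "bdd_measurable M f"
  shows "(expectation f)\<^sup>2 \<le> expectation (\<lambda>x. (f x)\<^sup>2)"
proof -
  have "integrable M f" "integrable M (\<lambda>x. (f x)\<^sup>2)"
    using assms unfolding power2_eq_square by (auto intro: integrable_bdd_measurable)
  then have "variance f = expectation (\<lambda>x. (f x)\<^sup>2) - (expectation f)\<^sup>2" by (rule variance_eq)
  with variance_positive[of f] show ?thesis by simp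
qed

section \<open>The law of large numbers for anchors\<close>

context borel_kernel
begin

lemma bdd_measurable_P_iff [simp]: "bdd_measurable P f \<longleftrightarrow> bdd_measurable borel f"
  by (simp only: bdd_measurable_def measurable_cong_sets[OF sets_P refl] space_P space_borel)

lemma bdd_measurable_PP_iff [simp]: "bdd_measurable P2 f \<longleftrightarrow> bdd_measurable (borel2) f"
  by (simp only: bdd_measurable_def measurable_cong_sets[OF sets_pair_measure_cong[OF sets_P sets_P] refl]
    space_pair_measure space_P space_borel)

lemma Fubini_bounded:
  assumes "bdd_measurable (borel2) (\<lambda>(x, y). f x y)"
  shows "(LINT x|P. (LINT y|P. f x y)) = (LINT y|P. (LINT x|P. f x y))"
    and "(LINT x|P. (LINT y|P. f x y)) = (LINT z|P2. f (fst z) (snd z))"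
proof -
  interpret PP: pair_prob_space P P by (rule pair_prob_space)
  have i: "integrable P2 (\<lambda>(x, y). f x y)"
    using assms by (intro PP.integrable_bdd_measurable) simp
  show "(LINT x|P. (LINT y|P. f x y)) = (LINT y|P. (LINT x|P. f x y))"
    by (rule PP.Fubini_integral[OF i, symmetric])
  show "(LINT x|P. (LINT y|P. f x y)) = (LINT z|P2. f (fst z) (snd z))"
    using PP.integral_fst[OF i] by (simp add: split_beta')
qed

text \<open>Independence and zero mean remove the off-diagonal terms of the squared sum; the
  \<open>n\<close> diagonal terms are at most \<open>C^2\<close> each, against the factor
  \<open>1/n^2\<close>.\<close>

lemma mean_square_sum:
  assumes z: "bdd_measurable borel z" and C: "\<And>y. \<bar>z y\<bar> \<le> C" and z0: "(LINT y|P. z y) = 0" and n: "0 < n"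
  shows "(LINT \<xi>|Q. ((\<Sum>i<n. z (\<xi> i)) / real n)\<^sup>2) \<le> C\<^sup>2 / real n"
proof -
  interpret Q: prob_space Q by (rule prob_space_Q)
  have bz: "bdd_measurable Q (\<lambda>\<xi>. z (\<xi> i))" for i
    by (rule bdd_measurable_compose[OF _ z]) measurable
  have zz: "(LINT \<xi>|Q. z (\<xi> i) * z (\<xi> j)) \<le> (if i = j then C\<^sup>2 else 0)" for i j
  proof (cases "i = j")
    case True
    have "(LINT \<xi>|Q. z (\<xi> i) * z (\<xi> j)) \<le> (LINT \<xi>|Q. C\<^sup>2)"
    proof (rule integral_mono)
      show "integrable Q (\<lambda>\<xi>. z (\<xi> i) * z (\<xi> j))"
        by (intro Q.integrable_bdd_measurable bdd_measurable_mult bz)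
      show "z (\<xi> i) * z (\<xi> j) \<le> C\<^sup>2" for \<xi>
        using True C[of "\<xi> i"] abs_le_square_iff[of "z (\<xi> i)" C] by (simp add: power2_eq_square)
    qed simp
    with True show ?thesis by (simp add: Q.prob_space)
  next
    case False
    have mp: "measure_preserving Q P2 (\<lambda>\<xi>. (\<xi> i, \<xi> j))"
      by (rule measure_preserving_PiM_pair) (use False prob_space_axioms in auto)
    have b: "bdd_measurable (borel2) (\<lambda>(x, y). z x * z y)"
      unfolding split_beta' by (intro bdd_measurable_mult bdd_measurable_compose[OF _ z]) measurable
    have [measurable]: "z \<in> borel_measurable borel" using z by measurable
    have "(LINT \<xi>|Q. z (\<xi> i) * z (\<xi> j)) = (LINT y|(distr Q P2 (\<lambda>\<xi>. (\<xi> i, \<xi> j))). z (fst y) * z (snd y))"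
      using measure_preserving_measurable[OF mp] by (subst integral_distr) auto
    also have "\<dots> = (LINT x|P. (LINT y|P. z x * z y))"
      by (simp only: measure_preserving_distr[OF mp] Fubini_bounded(2)[OF b])
    also have "\<dots> = 0" by (simp add: z0)
    finally show ?thesis using False by simp
  qed
  have "(LINT \<xi>|Q. ((\<Sum>i<n. z (\<xi> i)) / real n)\<^sup>2) = (LINT \<xi>|Q. (\<Sum>i<n. \<Sum>j<n. z (\<xi> i) * z (\<xi> j)) / (real n)\<^sup>2)"
    by (simp add: power_divide power2_eq_square[of "sum _ _"] sum_product)
  also have "\<dots> = (\<Sum>i<n. \<Sum>j<n. LINT \<xi>|Q. z (\<xi> i) * z (\<xi> j)) / (real n)\<^sup>2"
    by (simp add: Bochner_Integration.integral_sum Bochner_Integration.integrable_sum Q.integrable_bdd_measurable bdd_measurable_mult bz)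
  also have "\<dots> \<le> (\<Sum>i<n. \<Sum>j<n. if i = j then C\<^sup>2 else 0) / (real n)\<^sup>2"
    by (intro divide_right_mono sum_mono zz) simp
  also have "\<dots> = C\<^sup>2 / real n" using n by (simp add: power2_eq_square)
  finally show ?thesis .
qed

text \<open>The test functions \<open>arctan ^ m\<close> are bounded and their moments determine a law on the line.\<close>

definition T2_test :: "nat \<Rightarrow> real \<Rightarrow> real" where
  "T2_test m x = (LINT y|P. T2 x y * arctan y ^ m)"

text \<open>The squared distance in \<open>L^2(P)\<close> between a Monte Carlo average over the
  first \<open>n\<close> anchors and the integral that it estimates.\<close>

definition empirical_error :: "nat \<Rightarrow> nat \<Rightarrow> (nat \<Rightarrow> real) \<Rightarrow> real" where
  "empirical_error m n \<xi> =
     (LINT x|P. ((\<Sum>i<n. T2 x (\<xi> i) * arctan (\<xi> i) ^ m) / real n - T2_test m x)\<^sup>2)"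

text \<open>Any subsequence serves the limit argument, and along powers of two the error bound of
  order \<open>1/n\<close> is summable, which gives almost sure convergence without a finer
  estimate. Only countably many \<open>m\<close> occur, so the exceptional set stays null.\<close>

definition good :: "(nat \<Rightarrow> real) \<Rightarrow> bool" where
  "good \<xi> \<longleftrightarrow> (\<forall>m. (\<lambda>k. empirical_error m (2 ^ k) \<xi>) \<longlonglongrightarrow> 0)"

lemma arctan_power_le: "\<bar>arctan y ^ m\<bar> \<le> 2 ^ m"
proof -
  have "\<bar>arctan y\<bar> \<le> 2"
    using arctan_ubound[of y] arctan_lbound[of y] pi_less_4 by (auto simp: abs_le_iff)
  then show ?thesis by (simp add: power_abs power_mono)
qed

lemma bdd_measurable_arctan [intro]:
  assumes [measurable]: "f \<in> borel_measurable M"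
  shows "bdd_measurable M (\<lambda>x. arctan (f x) ^ m)"
  by (rule bdd_measurableI[of _ _ "2 ^ m"]) (auto simp: arctan_power_le)

lemma bdd_measurable_T2_arctan:
  assumes [measurable]: "f \<in> borel_measurable M" "g \<in> borel_measurable M"
  shows "bdd_measurable M (\<lambda>x. T2 (f x) (g x) * arctan (g x) ^ m)"
  by (intro bdd_measurable_mult bdd_measurable_T2 bdd_measurable_arctan) measurable

lemma bdd_measurable_T2_test [intro]:
  assumes [measurable]: "f \<in> borel_measurable M"
  shows "bdd_measurable M (\<lambda>x. T2_test m (f x))"
proof -
  have "bdd_measurable (borel \<Otimes>\<^sub>M P) (\<lambda>(x, y). T2 x y * arctan y ^ m)"
    unfolding split_beta' by (intro bdd_measurable_T2_arctan) measurable
  from bdd_measurable_compose[OF assms bdd_measurable_integral[OF this]]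
  show ?thesis by (simp add: T2_test_def)
qed

text \<open>For fixed \<open>x\<close> the centred samples are bounded by \<open>2 * c\<close>, so
  the mean square of their average is at most \<open>(2 * c)^2 / n\<close>. The bound is uniform in
  \<open>x\<close>, and Fubini turns it into a bound for the expected error.\<close>

lemma AE_good: "AE \<xi> in Q. good \<xi>"
  unfolding good_def
proof (subst AE_all_countable, rule allI)
  fix m
  interpret Q: prob_space Q by (rule prob_space_Q)
  interpret PQ: pair_prob_space P Q ..
  have "bdd_measurable (borel2) (\<lambda>(x, y). T2 x y * arctan y ^ m)"
    unfolding split_beta' by (intro bdd_measurable_T2_arctan) measurable
  then obtain c where c: "0 \<le> c" "\<And>z. \<bar>case z of (x, y) \<Rightarrow> T2 x y * arctan y ^ m\<bar> \<le> c"
    by (rule bdd_measurableE) (auto simp: space_pair_measure)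
  have c: "0 \<le> c" "\<bar>T2 x y * arctan y ^ m\<bar> \<le> c" for x y using c(1) c(2)[of "(x, y)"] by simp_all
  let ?Z = "\<lambda>x y. T2 x y * arctan y ^ m - T2_test m x"
  have T2m: "bdd_measurable borel (\<lambda>y. T2 x y * arctan y ^ m)" for x
    by (intro bdd_measurable_T2_arctan) measurable
  have ct: "\<bar>T2_test m x\<bar> \<le> c" for x
  proof -
    have "\<bar>T2_test m x\<bar> \<le> (LINT y|P. \<bar>T2 x y * arctan y ^ m\<bar>)"
      unfolding T2_test_def by (rule integral_abs_bound)
    also have "\<dots> \<le> (LINT y|P. c)"
      using T2m c by (intro integral_mono integrable_abs integrable_bdd_measurable) auto
    finally show ?thesis using prob_space by simp
  qed
  have err: "Q.expectation (empirical_error m n) \<le> (2 * c)\<^sup>2 / real n" if n: "0 < n" for n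
  proof -
    have *: "(\<Sum>i<n. T2 x (\<xi> i) * arctan (\<xi> i) ^ m) / real n - T2_test m x = (\<Sum>i<n. ?Z x (\<xi> i)) / real n" for x \<xi>
      using n by (simp add: sum_subtractf diff_divide_distrib)
    have "bdd_measurable (P \<Otimes>\<^sub>M Q) (\<lambda>(x, \<xi>). ((\<Sum>i<n. ?Z x (\<xi> i)) / real n)\<^sup>2)"
      unfolding split_beta' divide_inverse power2_eq_square
      by (intro bdd_measurable_mult bdd_measurable_sum bdd_measurable_diff bdd_measurable_T2_arctan
        bdd_measurable_T2_test bdd_measurable_const) measurable
    then have i: "integrable (P \<Otimes>\<^sub>M Q) (\<lambda>(x, \<xi>). ((\<Sum>i<n. ?Z x (\<xi> i)) / real n)\<^sup>2)"
      by (rule PQ.integrable_bdd_measurable)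
    have "Q.expectation (empirical_error m n) = (LINT x|P. (LINT \<xi>|Q. ((\<Sum>i<n. ?Z x (\<xi> i)) / real n)\<^sup>2))"
      unfolding empirical_error_def[abs_def] * by (rule PQ.Fubini_integral[OF i])
    also have "\<dots> \<le> (LINT x|P. (2 * c)\<^sup>2 / real n)"
    proof (rule integral_mono)
      show "integrable P (\<lambda>x. LINT \<xi>|Q. ((\<Sum>i<n. ?Z x (\<xi> i)) / real n)\<^sup>2)"
        by (rule PQ.integrable_fst[OF i])
      fix x
      show "(LINT \<xi>|Q. ((\<Sum>i<n. ?Z x (\<xi> i)) / real n)\<^sup>2) \<le> (2 * c)\<^sup>2 / real n"
      proof (rule mean_square_sum[OF _ _ _ n])
        show "bdd_measurable borel (?Z x)" using T2m by auto
        show "\<bar>?Z x y\<bar> \<le> 2 * c" for y using c(2)[of x y] ct[of x] by linarith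
        show "(LINT y|P. ?Z x y) = 0"
          using T2m[of x] integrable_bdd_measurable[of "\<lambda>y. T2 x y * arctan y ^ m"] prob_space
          by (simp add: T2_test_def Bochner_Integration.integral_diff)
      qed
    qed simp
    also have "\<dots> = (2 * c)\<^sup>2 / real n" using prob_space by simp
    finally show ?thesis .
  qed
  show "AE \<xi> in Q. (\<lambda>k. empirical_error m (2 ^ k) \<xi>) \<longlonglongrightarrow> 0"
  proof (rule Q.AE_tendsto_0_of_summable)
    fix k
    have "bdd_measurable (Q \<Otimes>\<^sub>M P) (\<lambda>(\<xi>, x). ((\<Sum>i<2^k. T2 x (\<xi> i) * arctan (\<xi> i) ^ m) / real (2^k) - T2_test m x)\<^sup>2)"
      unfolding split_beta' divide_inverse power2_eq_square
      by (intro bdd_measurable_mult bdd_measurable_sum bdd_measurable_diff bdd_measurable_T2_arctan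
        bdd_measurable_T2_test bdd_measurable_const) measurable
    from bdd_measurable_integral[OF this]
    show "integrable Q (empirical_error m (2 ^ k))"
      unfolding empirical_error_def[abs_def] by (rule Q.integrable_bdd_measurable)
    show "0 \<le> empirical_error m (2 ^ k) \<xi>" for \<xi> by (simp add: empirical_error_def)
    show "Q.expectation (empirical_error m (2 ^ k)) \<le> (2 * c)\<^sup>2 * (1 / 2) ^ k"
      using err[of "2 ^ k"] by (simp add: power_divide)
  qed (intro summable_mult summable_geometric, simp)
qed

text \<open>The measure with density \<open>f\<close> may have unbounded support, but its image
  under \<open>arctan\<close> has bounded support. Vanishing power moments make that image zero, and
  \<open>arctan\<close> is injective.\<close>

lemma AE_0_of_arctan_moments:
  assumes f: "bdd_measurable borel f" and mom: "\<And>m. (LINT y|P. f y * arctan y ^ m) = 0"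
  shows "AE y in P. f y = 0"
proof -
  have [measurable]: "f \<in> borel_measurable borel" using f by measurable
  have i: "integrable P f" using f by (intro integrable_bdd_measurable) simp
  have A: "(LINT y|P. f y * indicator A y) = 0" if A[measurable]: "A \<in> sets borel" for A
  proof -
    have arct: "arctan \<in> borel_measurable P"
      unfolding measurable_cong_sets[OF sets_P refl]
      by (intro borel_measurable_continuous_onI continuous_on_arctan continuous_on_id)
    \<comment> \<open>\<open>tan\<close> is periodic; the cut to \<open>{- pi/2 <..< pi/2}\<close>
      selects the branch that inverts \<open>arctan\<close>.\<close>
    let ?A = "tan -` A \<inter> {- pi/2 <..< pi/2}"
    have "(\<lambda>t. tan t :: real) \<in> borel_measurable borel" unfolding tan_def by measurable
    from measurable_sets[OF this A] have A': "?A \<in> sets borel" by simp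
    have "(LINT y|P. f y * indicator ?A (arctan y)) = (LINT y|P. 0 * indicator ?A (arctan y))"
    proof (rule integral_eq_of_power_moments[where c=2])
      show "\<bar>arctan x\<bar> \<le> 2" for x using arctan_power_le[of x 1] by simp
      then show "\<bar>arctan x\<bar> \<le> 2" for x .
      show "arctan \<in> borel_measurable P" "arctan \<in> borel_measurable P" by (fact arct)+
    qed (use i A' mom in auto)
    moreover have "indicator ?A (arctan y) = (indicator A y :: real)" for y
      using arctan_lbound[of y] arctan_ubound[of y] by (auto simp: indicator_def tan_arctan)
    ultimately show ?thesis by simp
  qed
  have "(LINT y|P. f y * f y) = 0"
  proof -
    have "(LINT y|P. \<bar>f y\<bar>) = (LINT y|P. f y * indicator {y. 0 \<le> f y} y - f y * indicator {y. \<not> 0 \<le> f y} y)"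
      by (intro Bochner_Integration.integral_cong) (auto split: split_indicator)
    also have "\<dots> = 0"
      using A[of "{y. 0 \<le> f y}"] A[of "{y. \<not> 0 \<le> f y}"] f
      by (subst Bochner_Integration.integral_diff)
         (auto intro!: integrable_bdd_measurable bdd_measurable_mult bdd_measurable_indicator)
    finally have "AE y in P. \<bar>f y\<bar> = 0"
      using i by (subst (asm) integral_nonneg_eq_0_iff_AE) auto
    then show ?thesis by (intro integral_eq_zero_AE) auto
  qed
  then show ?thesis
    using f by (subst (asm) integral_nonneg_eq_0_iff_AE) (auto intro!: integrable_bdd_measurable)
qed

text \<open>Goodness turns orthogonality at the anchors into orthogonality of \<open>g\<close> to
  every \<open>T2_test m\<close>, these being limits in \<open>L^2\<close> of weighted averages of
  the \<open>T2 x (\<xi> i)\<close>. So all \<open>arctan\<close> moments of \<open>k\<close>, the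
  image of \<open>g\<close> under \<open>T2\<close>, vanish and \<open>k = 0\<close> almost
  everywhere. Then \<open>v\<close>, the image of \<open>g\<close> under \<open>U\<close>, vanishes
  because the integral of \<open>k * g\<close> is that of \<open>v * v\<close>.\<close>

lemma good_orthogonal:
  assumes \<xi>: "good \<xi>" and g: "bdd_measurable borel g"
    and orth: "\<And>i. (LINT x|P. g x * T2 x (\<xi> i)) = 0"
  shows "AE y in P. (LINT x|P. g x * U x y) = 0"
proof -
  have [measurable]: "g \<in> borel_measurable borel" using g by measurable
  have bg: "bdd_measurable M (\<lambda>x. g (f x))" if "f \<in> borel_measurable M" for f :: "'z \<Rightarrow> real" and M
    using that g by (rule bdd_measurable_compose)
  obtain c where c: "0 \<le> c" "\<And>x. \<bar>g x\<bar> \<le> c" by (rule bdd_measurableE[OF g]) auto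
  define k where "k y = (LINT x|P. g x * T2 x y)" for y
  define v where "v u = (LINT x|P. g x * U x u)" for u
  have "bdd_measurable (borel \<Otimes>\<^sub>M P) (\<lambda>(y, x). g x * T2 x y)"
    unfolding split_beta' by (intro bdd_measurable_mult bg bdd_measurable_T2) measurable
  from bdd_measurable_integral[OF this] have bk: "bdd_measurable borel k" by (simp add: k_def[abs_def])
  have "bdd_measurable (borel \<Otimes>\<^sub>M P) (\<lambda>(y, x). g x * U x y)"
    unfolding split_beta' by (intro bdd_measurable_mult bg bdd_measurable_U) measurable
  from bdd_measurable_integral[OF this] have bv: "bdd_measurable borel v" by (simp add: v_def[abs_def])
  have bv': "bdd_measurable M (\<lambda>x. v (f x))" if "f \<in> borel_measurable M" for f :: "'z \<Rightarrow> real" and M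
    using that bv by (rule bdd_measurable_compose)
  have test0: "(LINT x|P. g x * T2_test m x) = 0" for m
  proof -
    let ?F = "\<lambda>n x. (\<Sum>i<n. T2 x (\<xi> i) * arctan (\<xi> i) ^ m) / real n"
    have bF: "bdd_measurable borel (?F n)" for n
      unfolding divide_inverse
      by (intro bdd_measurable_mult bdd_measurable_sum bdd_measurable_T2 bdd_measurable_const) measurable
    have F0: "(LINT x|P. g x * ?F n x) = 0" for n
    proof -
      have "(LINT x|P. g x * ?F n x) = (LINT x|P. (\<Sum>i<n. (g x * T2 x (\<xi> i)) * (arctan (\<xi> i) ^ m / real n)))"
        by (simp add: sum_distrib_left sum_divide_distrib mult_ac)
      also have "\<dots> = (\<Sum>i<n. (LINT x|P. g x * T2 x (\<xi> i)) * (arctan (\<xi> i) ^ m / real n))"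
      proof (subst Bochner_Integration.integral_sum)
        fix i
        have "bdd_measurable borel (\<lambda>x. (g x * T2 x (\<xi> i)) * (arctan (\<xi> i) ^ m / real n))"
          by (intro bdd_measurable_mult bg bdd_measurable_T2 bdd_measurable_const) measurable
        then show "integrable P (\<lambda>x. (g x * T2 x (\<xi> i)) * (arctan (\<xi> i) ^ m / real n))"
          by (intro integrable_bdd_measurable) simp
      qed simp
      finally show ?thesis by (simp add: orth)
    qed
    have bT: "bdd_measurable borel (T2_test m)" using bdd_measurable_T2_test[of "\<lambda>x. x" borel m] by simp
    \<comment> \<open>By \<open>F0\<close> the averages contribute nothing, so only the error term
      is left; it is estimated by the square inequality for expectations and the bound
      \<open>c\<close> on \<open>g\<close>.\<close>
    have le: "(LINT x|P. g x * T2_test m x)\<^sup>2 \<le> c\<^sup>2 * empirical_error m (2 ^ j) \<xi>" for j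
    proof -
      let ?E = "\<lambda>x. ?F (2 ^ j) x - T2_test m x"
      have bE: "bdd_measurable borel (\<lambda>x. g x * ?E x)" "bdd_measurable borel (\<lambda>x. ?E x * ?E x)"
        by (intro bdd_measurable_mult bdd_measurable_diff g bF bT)+
      have i: "integrable P (\<lambda>x. g x * ?F (2 ^ j) x)" "integrable P (\<lambda>x. g x * T2_test m x)"
        using bdd_measurable_mult[OF g bF] bdd_measurable_mult[OF g bT]
        by (simp_all only: integrable_bdd_measurable bdd_measurable_P_iff)
      have "(LINT x|P. g x * ?E x) = (LINT x|P. g x * ?F (2 ^ j) x) - (LINT x|P. g x * T2_test m x)"
        by (simp only: right_diff_distrib Bochner_Integration.integral_diff[OF i])
      then have "(LINT x|P. g x * T2_test m x)\<^sup>2 = (LINT x|P. g x * ?E x)\<^sup>2"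
        by (simp only: F0) simp
      also have "\<dots> \<le> (LINT x|P. (g x * ?E x)\<^sup>2)"
        using bE(1) by (intro expectation_square_le) simp
      also have "\<dots> \<le> (LINT x|P. c\<^sup>2 * (?E x)\<^sup>2)"
      proof (rule integral_mono)
        show "integrable P (\<lambda>x. (g x * ?E x)\<^sup>2)"
          using bdd_measurable_mult[OF bE(1) bE(1)] unfolding power2_eq_square
          by (intro integrable_bdd_measurable) simp
        show "integrable P (\<lambda>x. c\<^sup>2 * (?E x)\<^sup>2)"
          using bE(2) unfolding power2_eq_square[of "_ - _"]
          by (intro integrable_mult_right integrable_bdd_measurable) simp
        show "(g x * ?E x)\<^sup>2 \<le> c\<^sup>2 * (?E x)\<^sup>2" for x
          using c abs_le_square_iff[of "g x" c] unfolding power_mult_distrib by (intro mult_right_mono) auto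
      qed
      finally show ?thesis by (simp add: empirical_error_def)
    qed
    have "(\<lambda>j. c\<^sup>2 * empirical_error m (2 ^ j) \<xi>) \<longlonglongrightarrow> c\<^sup>2 * 0"
      using \<xi> by (intro tendsto_mult tendsto_const) (simp add: good_def)
    from LIMSEQ_le_const[OF this, of "(LINT x|P. g x * T2_test m x)\<^sup>2"] le
    show ?thesis by simp
  qed
  have "AE y in P. k y = 0"
  proof (rule AE_0_of_arctan_moments[OF bk])
    fix m
    have b: "bdd_measurable (borel2) (\<lambda>(x, y). g x * (T2 x y * arctan y ^ m))"
      unfolding split_beta' by (intro bdd_measurable_mult bg bdd_measurable_T2_arctan) measurable
    have "(LINT y|P. k y * arctan y ^ m) = (LINT y|P. (LINT x|P. g x * (T2 x y * arctan y ^ m)))"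
      by (simp add: k_def flip: mult.assoc integral_mult_left_zero)
    also have "\<dots> = (LINT x|P. (LINT y|P. g x * (T2 x y * arctan y ^ m)))"
      by (rule Fubini_bounded(1)[OF b, symmetric])
    also have "\<dots> = (LINT x|P. g x * T2_test m x)" by (simp add: T2_test_def)
    finally show "(LINT y|P. k y * arctan y ^ m) = 0" by (simp add: test0)
  qed
  then have k0: "(LINT y|P. k y * g y) = 0"
    by (intro integral_eq_zero_AE) auto
  have kv: "k y = (LINT u|P. v u * U u y)" for y
  proof -
    have b: "bdd_measurable (borel2) (\<lambda>(x, u). g x * (U x u * U u y))"
      unfolding split_beta' by (intro bdd_measurable_mult bg bdd_measurable_U) measurable
    have "k y = (LINT x|P. (LINT u|P. g x * (U x u * U u y)))"
      by (simp add: k_def T2_def)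
    also have "\<dots> = (LINT u|P. (LINT x|P. g x * (U x u * U u y)))"
      by (rule Fubini_bounded(1)[OF b])
    finally show ?thesis by (simp add: v_def flip: mult.assoc integral_mult_left_zero)
  qed
  have b: "bdd_measurable (borel2) (\<lambda>(y, u). v u * (U u y * g y))"
    unfolding split_beta' by (intro bdd_measurable_mult bg bv' bdd_measurable_U) measurable
  \<comment> \<open>\<open>T2\<close> is the square of the symmetric kernel \<open>U\<close>: moving
    one factor to the other side leaves the squared norm of \<open>v\<close>.\<close>
  have "(LINT y|P. k y * g y) = (LINT y|P. (LINT u|P. v u * (U u y * g y)))"
    by (simp add: kv flip: mult.assoc integral_mult_left_zero)
  also have "\<dots> = (LINT u|P. (LINT y|P. v u * (U u y * g y)))"
    by (rule Fubini_bounded(1)[OF b])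
  also have "\<dots> = (LINT u|P. v u * v u)"
    by (simp add: v_def U_sym mult.commute)
  finally have "(LINT u|P. v u * v u) = 0" using k0 by simp
  then have "AE u in P. v u * v u = 0"
    using bv by (subst (asm) integral_nonneg_eq_0_iff_AE) (auto intro!: integrable_bdd_measurable)
  then show ?thesis by (simp add: v_def)
qed

end

section \<open>Factoring a kernel through the anchor map\<close>

lemma Radon_Nikodym_le:
  assumes fin: "finite_measure N" and sets: "sets L = sets N" and le: "\<And>A. A \<in> sets N \<Longrightarrow> emeasure L A \<le> emeasure N A"
  obtains a :: "'a \<Rightarrow> real" where "a \<in> borel_measurable N" "\<And>y. 0 \<le> a y" "\<And>y. a y \<le> 1" "L = density N a"
proof -
  interpret N: finite_measure N by fact
  have "absolutely_continuous N L"
    unfolding absolutely_continuous_def null_sets_def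
    using sets le by (force simp: le_zero_eq intro: order.antisym)
  from N.Radon_Nikodym[OF this sets] obtain r where r[measurable]: "r \<in> borel_measurable N" and L: "density N r = L"
    by blast
  \<comment> \<open>On \<open>?A\<close> the density exceeds 1, while \<open>L\<close> gives
    \<open>?A\<close> at most the mass that \<open>N\<close> does; hence the integral of
    \<open>r - 1\<close> over \<open>?A\<close> is 0 and \<open>?A\<close> is null.\<close>
  let ?A = "{y\<in>space N. 1 < r y}"
  have A[measurable]: "?A \<in> sets N" by measurable
  have "(\<integral>\<^sup>+y. r y * indicator ?A y - indicator ?A y \<partial>N) = (\<integral>\<^sup>+y. r y * indicator ?A y \<partial>N) - (\<integral>\<^sup>+y. indicator ?A y \<partial>N)"
  proof (rule nn_integral_diff)
    show "(\<integral>\<^sup>+y. indicator ?A y \<partial>N) \<noteq> \<infinity>" by (simp add: N.emeasure_eq_measure)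
    show "AE y in N. indicator ?A y \<le> r y * indicator ?A y"
      by (rule AE_I2) (simp add: indicator_def less_imp_le)
  qed measurable
  also have "\<dots> = emeasure L ?A - emeasure N ?A"
    using emeasure_density[OF r A] by (simp add: L)
  also have "\<dots> = 0"
    using le[OF A] by (intro diff_eq_0_ennreal le_less_trans[OF le[OF A]]) (simp_all add: N.emeasure_eq_measure)
  finally have "AE y in N. r y * indicator ?A y - indicator ?A y = 0"
    by (subst (asm) nn_integral_0_iff_AE) auto
  then have r1: "AE y in N. r y \<le> 1"
    using AE_space
  proof eventually_elim
    case (elim y)
    show ?case
    proof (rule ccontr)
      assume "\<not> r y \<le> 1"
      with elim have "r y - 1 = 0" "1 < r y" by auto
      then show False by (auto simp: diff_eq_0_iff_ennreal dest: leD)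
    qed
  qed
  \<comment> \<open>Truncation at 1 changes \<open>r\<close> only on a null set and yields a finite
    real density with both bounds everywhere.\<close>
  define a where "a y = enn2real (min 1 (r y))" for y
  have "density N r = density N a"
  proof (rule density_cong)
    show "AE y in N. r y = ennreal (a y)"
      using r1
    proof eventually_elim
      case (elim y)
      then have "r y < top" by (rule le_less_trans) simp
      with elim show ?case by (simp add: a_def min_absorb2)
    qed
  qed (auto simp: a_def)
  moreover have "a y \<le> 1" for y
  proof -
    have "enn2real (min 1 (r y)) \<le> enn2real 1" by (intro enn2real_mono) auto
    then show ?thesis by (simp add: a_def)
  qed
  moreover have "a \<in> borel_measurable N" unfolding a_def[abs_def] by measurable
  moreover have "0 \<le> a y" for y by (simp add: a_def)
  ultimately show ?thesis using that[of a] L by simp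
qed

text \<open>\<open>a\<close> after \<open>\<phi>\<close> is a version of the conditional expectation
  of \<open>f\<close> given \<open>\<phi>\<close>. The hypothesis \<open>eq\<close> speaks only of
  image measures, so a single \<open>a\<close> can serve two different spaces whose image measures
  agree.\<close>

lemma integral_factor_density:
  fixes f :: "'a \<Rightarrow> real" and a :: "'b \<Rightarrow> real"
  assumes \<phi>[measurable]: "\<phi> \<in> M \<rightarrow>\<^sub>M N" and f[measurable]: "f \<in> borel_measurable M" and f0: "\<And>x. 0 \<le> f x"
    and a[measurable]: "a \<in> borel_measurable N" and a0: "\<And>y. 0 \<le> a y"
    and eq: "distr (density M f) N \<phi> = density (distr M N \<phi>) a"
    and h[measurable]: "h \<in> borel_measurable N"
  shows "(LINT x|M. f x * h (\<phi> x)) = (LINT x|M. a (\<phi> x) * h (\<phi> x))"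
proof -
  have "(LINT x|M. f x * h (\<phi> x)) = (LINT x|(density M f). h (\<phi> x))"
    using f0 by (subst integral_real_density) auto
  also have "\<dots> = (LINT y|(distr (density M f) N \<phi>). h y)"
    by (rule integral_distr[symmetric]) auto
  also have "\<dots> = (LINT y|(distr M N \<phi>). a y * h y)"
    unfolding eq using a0 by (subst integral_real_density) auto
  also have "\<dots> = (LINT x|M. a (\<phi> x) * h (\<phi> x))"
    by (rule integral_distr) auto
  finally show ?thesis .
qed

lemma factor_density_exists:
  fixes f :: "'a \<Rightarrow> real"
  assumes M: "finite_measure M" and \<phi>[measurable]: "\<phi> \<in> M \<rightarrow>\<^sub>M N" and f[measurable]: "f \<in> borel_measurable M"
    and f01: "\<And>x. f x \<le> 1"
  obtains a :: "'b \<Rightarrow> real" where "a \<in> borel_measurable N" "\<And>y. 0 \<le> a y" "\<And>y. a y \<le> 1"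
    "distr (density M f) N \<phi> = density (distr M N \<phi>) a"
proof -
  interpret M: finite_measure M by fact
  have "emeasure (distr (density M f) N \<phi>) A \<le> emeasure (distr M N \<phi>) A" if "A \<in> sets (distr M N \<phi>)" for A
  proof -
    have [measurable]: "A \<in> sets N" using that by simp
    have "emeasure (distr (density M f) N \<phi>) A = (\<integral>\<^sup>+x. ennreal (f x) * indicator (\<phi> -` A \<inter> space M) x \<partial>M)"
      by (simp add: emeasure_distr emeasure_density)
    also have "\<dots> \<le> (\<integral>\<^sup>+x. indicator (\<phi> -` A \<inter> space M) x \<partial>M)"
      using f01 by (intro nn_integral_mono) (auto split: split_indicator)
    also have "\<dots> = emeasure (distr M N \<phi>) A" by (simp add: emeasure_distr)
    finally show ?thesis .
  qed
  then obtain a :: "'b \<Rightarrow> real" where "a \<in> borel_measurable (distr M N \<phi>)" "\<And>y. 0 \<le> a y" "\<And>y. a y \<le> 1"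
    "distr (density M f) N \<phi> = density (distr M N \<phi>) a"
    by (rule Radon_Nikodym_le[OF M.finite_measure_distr[OF \<phi>], rotated]) simp_all
  then show ?thesis using that by simp
qed

text \<open>Rectangles are stable under intersection and generate the product, so the measures with
  densities \<open>f\<close> and \<open>g\<close> coincide, and densities are unique almost
  everywhere.\<close>

lemma (in pair_prob_space) AE_eq_of_rectangles:
  fixes f g :: "'a \<times> 'b \<Rightarrow> real"
  assumes f: "bdd_measurable (M1 \<Otimes>\<^sub>M M2) f" "\<And>z. 0 \<le> f z" and g: "bdd_measurable (M1 \<Otimes>\<^sub>M M2) g" "\<And>z. 0 \<le> g z"
    and eq: "\<And>A C. A \<in> sets M1 \<Longrightarrow> C \<in> sets M2 \<Longrightarrow>
      (LINT z|(M1 \<Otimes>\<^sub>M M2). f z * (indicator A (fst z) * indicator C (snd z))) = (LINT z|(M1 \<Otimes>\<^sub>M M2). g z * (indicator A (fst z) * indicator C (snd z)))"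
  shows "AE z in M1 \<Otimes>\<^sub>M M2. f z = g z"
proof -
  let ?P = "M1 \<Otimes>\<^sub>M M2"
  have [measurable]: "f \<in> borel_measurable ?P" "g \<in> borel_measurable ?P" using f g by auto
  have em: "emeasure (density ?P h) (A \<times> C) = ennreal (LINT z|?P. h z * (indicator A (fst z) * indicator C (snd z)))"
    if h: "bdd_measurable ?P h" "\<And>z. 0 \<le> h z" and [measurable]: "A \<in> sets M1" "C \<in> sets M2" for h :: "'a \<times> 'b \<Rightarrow> real" and A C
  proof -
    have [measurable]: "h \<in> borel_measurable ?P" using h by auto
    have "bdd_measurable ?P (\<lambda>z. indicator A (fst z))" "bdd_measurable ?P (\<lambda>z. indicator C (snd z))"
      using bdd_measurable_compose[OF measurable_fst bdd_measurable_indicator[of A M1]]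
        bdd_measurable_compose[OF measurable_snd bdd_measurable_indicator[of C M2]] by simp_all
    then have i: "integrable ?P (\<lambda>z. h z * (indicator A (fst z) * indicator C (snd z)))"
      by (intro integrable_bdd_measurable bdd_measurable_mult h)
    have "emeasure (density ?P h) (A \<times> C) = (\<integral>\<^sup>+z. ennreal (h z) * indicator (A \<times> C) z \<partial>?P)"
      by (intro emeasure_density) auto
    also have "\<dots> = (\<integral>\<^sup>+z. ennreal (h z * (indicator A (fst z) * indicator C (snd z))) \<partial>?P)"
      by (intro nn_integral_cong) (auto split: split_indicator)
    also have "\<dots> = ennreal (LINT z|?P. h z * (indicator A (fst z) * indicator C (snd z)))"
      using i h by (intro nn_integral_eq_integral) auto
    finally show ?thesis .
  qed
  have "density ?P f = density ?P g"
  proof (rule measure_eqI_generator_eq[OF Int_stable_pair_measure_generator[of M1 M2]])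
    show "{a \<times> b |a b. a \<in> sets M1 \<and> b \<in> sets M2} \<subseteq> Pow (space M1 \<times> space M2)"
      by (rule pair_measure_closed)
    fix X assume "X \<in> {a \<times> b |a b. a \<in> sets M1 \<and> b \<in> sets M2}"
    then show "emeasure (density ?P f) X = emeasure (density ?P g) X"
      using em[OF f] em[OF g] eq by auto
  next
    show "range (\<lambda>_::nat. space M1 \<times> space M2) \<subseteq> {a \<times> b |a b. a \<in> sets M1 \<and> b \<in> sets M2}" by auto
    show "emeasure (density ?P f) (space M1 \<times> space M2) \<noteq> \<infinity>" for i :: nat
      using em[OF f, of "space M1" "space M2"] by simp
  qed (auto simp: sets_pair_measure)
  then have "AE z in ?P. ennreal (f z) = ennreal (g z)"
    by (intro density_unique) auto
  then show ?thesis by (elim eventually_mono) (simp add: f(2) g(2))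
qed

section \<open>Kernels as functions of the anchor map\<close>

context borel_kernel
begin

text \<open>Coding makes every \<open>T2 x (\<xi> i)\<close> a Borel function of one real-valued
  map.\<close>

definition anchor_map :: "(nat \<Rightarrow> real) \<Rightarrow> real \<Rightarrow> real" where
  "anchor_map \<xi> x = seq_code (\<lambda>i. T2 x (\<xi> i))"

lemma measurable_anchor_map [measurable]: "anchor_map \<xi> \<in> borel_measurable borel"
  unfolding anchor_map_def[abs_def]
  by (rule measurable_seq_code, rule bdd_measurable_measurable, rule bdd_measurable_T2) measurable

text \<open>\<open>\<alpha>\<close> is the conditional probability of \<open>A\<close> given the
  anchor map. The difference of \<open>indicator A\<close> and \<open>\<alpha>\<close> after that
  map is orthogonal to bounded functions of the map, in particular to each
  \<open>T2 x (\<xi> i)\<close>, so \<open>good_orthogonal\<close> shows that \<open>U\<close>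
  annihilates it.\<close>

lemma good_factor_integral:
  assumes \<xi>: "good \<xi>" and A[measurable]: "A \<in> sets borel"
  obtains \<alpha> where "\<alpha> \<in> borel_measurable borel" "\<And>s. 0 \<le> \<alpha> s" "\<And>s. \<alpha> s \<le> 1"
    "\<And>h. h \<in> borel_measurable borel \<Longrightarrow> (LINT x|P. h (anchor_map \<xi> x) * indicator A x) = (LINT x|P. h (anchor_map \<xi> x) * \<alpha> (anchor_map \<xi> x))"
    "AE y in P. (LINT x|P. U x y * indicator A x) = (LINT x|P. U x y * \<alpha> (anchor_map \<xi> x))"
proof -
  let ?\<phi> = "anchor_map \<xi>"
  have \<phi>[measurable]: "?\<phi> \<in> P \<rightarrow>\<^sub>M borel" using measurable_anchor_map measurable_cong_sets[OF sets_P refl] by blast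
  have f: "(indicator A :: real \<Rightarrow> real) \<in> borel_measurable P"
    by (rule borel_measurable_indicator) (simp add: A)
  obtain \<alpha> :: "real \<Rightarrow> real" where \<alpha>[measurable]: "\<alpha> \<in> borel_measurable borel" and \<alpha>01: "\<And>s. 0 \<le> \<alpha> s" "\<And>s. \<alpha> s \<le> 1"
    and d: "distr (density P (indicator A :: real \<Rightarrow> real)) borel ?\<phi> = density (distr P borel ?\<phi>) \<alpha>"
    by (rule factor_density_exists[OF finite_measure_axioms \<phi> f]) (auto split: split_indicator)
  have eq: "(LINT x|P. h (?\<phi> x) * indicator A x) = (LINT x|P. h (?\<phi> x) * \<alpha> (?\<phi> x))" if "h \<in> borel_measurable borel" for h
    using integral_factor_density[OF \<phi> f _ \<alpha> \<alpha>01(1) d that] by (simp add: mult.commute)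
  define g where "g x = indicator A x - \<alpha> (?\<phi> x)" for x
  have b: "bdd_measurable borel (indicator A :: real \<Rightarrow> real)" by auto
  have b\<alpha>: "bdd_measurable borel (\<lambda>x. \<alpha> (?\<phi> x))"
    by (rule bdd_measurableI[of _ _ 1]) (use \<alpha>01 in auto)
  have bg: "bdd_measurable borel g" unfolding g_def[abs_def] by (intro bdd_measurable_diff b b\<alpha>)
  have diff: "(LINT x|P. g x * w x) = (LINT x|P. w x * indicator A x) - (LINT x|P. w x * \<alpha> (?\<phi> x))" if "bdd_measurable borel w" for w
  proof -
    have "integrable P (\<lambda>x. w x * indicator A x)" "integrable P (\<lambda>x. w x * \<alpha> (?\<phi> x))"
      using that b b\<alpha> by (simp_all only: integrable_bdd_measurable bdd_measurable_mult bdd_measurable_P_iff)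
    then show ?thesis by (simp add: g_def left_diff_distrib mult.commute[of "indicator A _"] mult.commute[of "\<alpha> _"] Bochner_Integration.integral_diff)
  qed
  have "AE y in P. (LINT x|P. g x * U x y) = 0"
  proof (rule good_orthogonal[OF \<xi> bg])
    fix i
    have "(LINT x|P. g x * T2 x (\<xi> i)) = (LINT x|P. seq_decode i (?\<phi> x) * indicator A x) - (LINT x|P. seq_decode i (?\<phi> x) * \<alpha> (?\<phi> x))"
      using diff[OF bdd_measurable_T2[of "\<lambda>x. x" borel "\<lambda>_. \<xi> i"]] by (simp add: anchor_map_def)
    also have "\<dots> = 0" using eq[of "seq_decode i"] by simp
    finally show "(LINT x|P. g x * T2 x (\<xi> i)) = 0" .
  qed
  then have "AE y in P. (LINT x|P. U x y * indicator A x) = (LINT x|P. U x y * \<alpha> (?\<phi> x))"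
    by eventually_elim (use diff[OF bdd_measurable_U[of "\<lambda>x. x" borel]] in simp)
  with \<alpha> \<alpha>01 eq show ?thesis using that by blast
qed

text \<open>It suffices to test on rectangles \<open>A \<times> C\<close>. Since \<open>U\<close>
  does not distinguish a set from its conditional probability, the indicators may be replaced by
  functions of the anchor map, against which \<open>a\<close> represents the kernel by
  \<open>d\<close>. Then the indicators are restored, because \<open>a\<close> itself sees only the
  anchor map. The shift and scaling by \<open>b\<close> turn \<open>U\<close> into a density with
  values in \<open>[0, 1]\<close>.\<close>

lemma good_factor:
  assumes \<xi>: "good \<xi>" and b: "0 < b"
    and a[measurable]: "a \<in> borel_measurable (borel2)" and a01: "\<And>z. 0 \<le> a z" "\<And>z. a z \<le> 1"
    and d: "distr (density P2 (\<lambda>z. (U (fst z) (snd z) + b) / (2 * b))) (borel2)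
        (\<lambda>z. (anchor_map \<xi> (fst z), anchor_map \<xi> (snd z))) =
      density (distr P2 (borel2) (\<lambda>z. (anchor_map \<xi> (fst z), anchor_map \<xi> (snd z)))) a"
  shows "AE (x, y) in P2. (U x y + b) / (2 * b) = a (anchor_map \<xi> x, anchor_map \<xi> y)"
proof -
  interpret PP: pair_prob_space P P by (rule pair_prob_space)
  let ?\<phi> = "anchor_map \<xi>" and ?f = "\<lambda>x y. (U x y + b) / (2 * b)"
  let ?F = "\<lambda>x y. a (?\<phi> x, ?\<phi> y)"
  have \<phi>[measurable]: "?\<phi> \<in> borel_measurable P" using measurable_anchor_map measurable_cong_sets[OF sets_P refl] by blast
  have f01: "0 \<le> ?f x y" for x y using U_le[of x y] b by (simp add: abs_le_iff)
  have bf: "bdd_measurable M (\<lambda>z. ?f (p z) (q z))" if [measurable]: "p \<in> borel_measurable M" "q \<in> borel_measurable M" for p q :: "'z \<Rightarrow> real" and M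
    unfolding divide_inverse
    by (intro bdd_measurable_mult bdd_measurable_add bdd_measurable_const bdd_measurable_U) measurable
  have bF: "bdd_measurable M (\<lambda>z. ?F (p z) (q z))" if [measurable]: "p \<in> borel_measurable M" "q \<in> borel_measurable M" for p q :: "'z \<Rightarrow> real" and M
    by (rule bdd_measurableI[of _ _ 1]) (use a01 in auto)
  have "AE z in P2. ?f (fst z) (snd z) = ?F (fst z) (snd z)"
  proof (rule PP.AE_eq_of_rectangles)
    show "bdd_measurable P2 (\<lambda>z. ?f (fst z) (snd z))" by (rule bf) measurable
    show "bdd_measurable P2 (\<lambda>z. ?F (fst z) (snd z))" by (rule bF) measurable
    show "0 \<le> ?f (fst z) (snd z)" "0 \<le> ?F (fst z) (snd z)" for z by (rule f01) (rule a01)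
    fix A C assume "A \<in> sets P" "C \<in> sets P"
    then have [measurable]: "A \<in> sets borel" "C \<in> sets borel" by simp_all
    obtain \<alpha> where \<alpha>[measurable]: "\<alpha> \<in> borel_measurable borel" and \<alpha>01: "\<And>s. 0 \<le> \<alpha> s" "\<And>s. \<alpha> s \<le> 1"
      and \<alpha>h: "\<And>h. h \<in> borel_measurable borel \<Longrightarrow> (LINT x|P. h (?\<phi> x) * indicator A x) = (LINT x|P. h (?\<phi> x) * \<alpha> (?\<phi> x))"
      and \<alpha>U: "AE y in P. (LINT x|P. U x y * indicator A x) = (LINT x|P. U x y * \<alpha> (?\<phi> x))"
      by (rule good_factor_integral[OF \<xi> \<open>A \<in> sets borel\<close>]) blast
    obtain \<gamma> where \<gamma>[measurable]: "\<gamma> \<in> borel_measurable borel" and \<gamma>01: "\<And>s. 0 \<le> \<gamma> s" "\<And>s. \<gamma> s \<le> 1"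
      and \<gamma>h: "\<And>h. h \<in> borel_measurable borel \<Longrightarrow> (LINT x|P. h (?\<phi> x) * indicator C x) = (LINT x|P. h (?\<phi> x) * \<gamma> (?\<phi> x))"
      and \<gamma>U: "AE y in P. (LINT x|P. U x y * indicator C x) = (LINT x|P. U x y * \<gamma> (?\<phi> x))"
      by (rule good_factor_integral[OF \<xi> \<open>C \<in> sets borel\<close>]) blast
    have bA: "bdd_measurable borel (indicator A :: real \<Rightarrow> real)" and bC: "bdd_measurable borel (indicator C :: real \<Rightarrow> real)" by auto
    have b\<alpha>: "bdd_measurable borel (\<lambda>x. \<alpha> (?\<phi> x))" and b\<gamma>: "bdd_measurable borel (\<lambda>x. \<gamma> (?\<phi> x))"
      by (rule bdd_measurableI[of _ _ 1]; use \<alpha>01 \<gamma>01 in auto)+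
    have I: "bdd_measurable (borel2) (\<lambda>(x, y). K x y * (p x * q y))"
      if "bdd_measurable (borel2) (\<lambda>z. K (fst z) (snd z))" "bdd_measurable borel p" "bdd_measurable borel q" for K p q
      unfolding split_beta'
      by (intro bdd_measurable_mult that bdd_measurable_compose[OF measurable_fst] bdd_measurable_compose[OF measurable_snd])
    have swap: "(LINT z|P2. K (fst z) (snd z) * (p (fst z) * q (snd z))) = (LINT y|P. (LINT x|P. K x y * p x) * q y)"
        "(LINT z|P2. K (fst z) (snd z) * (p (fst z) * q (snd z))) = (LINT x|P. (LINT y|P. K x y * q y) * p x)"
      if "bdd_measurable (borel2) (\<lambda>z. K (fst z) (snd z))" "bdd_measurable borel p" "bdd_measurable borel q" for K p q
      using Fubini_bounded[OF I[OF that]]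
      by (simp_all add: mult.assoc[symmetric] mult.commute[of "p _" "q _"] flip: integral_mult_left_zero) (simp_all add: mult_ac)
    have bU2: "bdd_measurable (borel2) (\<lambda>z. U (fst z) (snd z))" by (rule bdd_measurable_U) measurable
    have bf2: "bdd_measurable (borel2) (\<lambda>z. ?f (fst z) (snd z))" by (rule bf) measurable
    have bF2: "bdd_measurable (borel2) (\<lambda>z. ?F (fst z) (snd z))" by (rule bF) measurable
    have bU1: "bdd_measurable borel (\<lambda>x. U x y)" "bdd_measurable borel (\<lambda>y. U x y)" for x y
      by (rule bdd_measurable_U; measurable)+
    have fint: "(LINT x|P. ?f x y * p x) = ((LINT x|P. U x y * p x) + b * (LINT x|P. p x)) / (2 * b)"
      if "bdd_measurable borel p" for p y
    proof -
      have "integrable P (\<lambda>x. U x y * p x)" "integrable P p"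
        using that bU1 by (simp_all only: integrable_bdd_measurable bdd_measurable_mult bdd_measurable_P_iff)
      then show ?thesis by (simp add: distrib_right add_divide_distrib)
    qed
    have e: "(LINT x|P. indicator A x) = (LINT x|P. \<alpha> (?\<phi> x))" "(LINT x|P. indicator C x) = (LINT x|P. \<gamma> (?\<phi> x))"
      using \<alpha>h[of "\<lambda>_. 1"] \<gamma>h[of "\<lambda>_. 1"] by simp_all
    \<comment> \<open>Symmetry carries the replacement for \<open>C\<close> over to the second
      argument.\<close>
    have fs: "?f x y = ?f y x" for x y by (simp add: U_sym)
    have fA: "AE y in P. (LINT x|P. ?f x y * indicator A x) = (LINT x|P. ?f x y * \<alpha> (?\<phi> x))"
      unfolding fint[OF bA] fint[OF b\<alpha>] e using \<alpha>U by eventually_elim (simp only:)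
    have "AE y in P. (LINT x|P. ?f x y * indicator C x) = (LINT x|P. ?f x y * \<gamma> (?\<phi> x))"
      unfolding fint[OF bC] fint[OF b\<gamma>] e using \<gamma>U by eventually_elim (simp only:)
    then have fC: "AE x in P. (LINT y|P. ?f x y * indicator C y) = (LINT y|P. ?f x y * \<gamma> (?\<phi> y))"
      by (subst (1 2) fs)
    have m1: "(\<lambda>y. (LINT x|P. K x y * p x) * q y) \<in> borel_measurable P" "(\<lambda>x. (LINT y|P. K x y * q y) * p x) \<in> borel_measurable P"
      if K: "bdd_measurable (borel2) (\<lambda>z. K (fst z) (snd z))" and p: "bdd_measurable borel p" and q: "bdd_measurable borel q" for K p q
    proof -
      have "bdd_measurable (borel \<Otimes>\<^sub>M P) (\<lambda>(y, x). K x y * p x)"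
        using bdd_measurable_compose[OF _ K, of "\<lambda>z. (snd z, fst z)" "borel \<Otimes>\<^sub>M P"]
          bdd_measurable_compose[OF _ p, of snd "borel \<Otimes>\<^sub>M P"]
        unfolding split_beta' by (intro bdd_measurable_mult) simp_all
      note 1 = bdd_measurable_mult[OF bdd_measurable_integral[OF this] q]
      have "bdd_measurable (borel \<Otimes>\<^sub>M P) (\<lambda>(x, y). K x y * q y)"
        using bdd_measurable_compose[OF _ K, of "\<lambda>z. (fst z, snd z)" "borel \<Otimes>\<^sub>M P"]
          bdd_measurable_compose[OF _ q, of snd "borel \<Otimes>\<^sub>M P"]
        unfolding split_beta' by (intro bdd_measurable_mult) simp_all
      note 2 = bdd_measurable_mult[OF bdd_measurable_integral[OF this] p]
      from 1 2 show "(\<lambda>y. (LINT x|P. K x y * p x) * q y) \<in> borel_measurable P" "(\<lambda>x. (LINT y|P. K x y * q y) * p x) \<in> borel_measurable P"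
        by (simp_all only: bdd_measurable_measurable flip: bdd_measurable_P_iff)
    qed
    have "(LINT z|P2. ?f (fst z) (snd z) * (indicator A (fst z) * indicator C (snd z))) =
        (LINT z|P2. ?f (fst z) (snd z) * (\<alpha> (?\<phi> (fst z)) * indicator C (snd z)))"
      unfolding swap(1)[OF bf2 bA bC] swap(1)[OF bf2 b\<alpha> bC]
      using fA by (intro integral_cong_AE m1(1)[OF bf2 bA bC] m1(1)[OF bf2 b\<alpha> bC]) (elim eventually_mono, simp only:)
    also have "\<dots> = (LINT z|P2. ?f (fst z) (snd z) * (\<alpha> (?\<phi> (fst z)) * \<gamma> (?\<phi> (snd z))))"
      unfolding swap(2)[OF bf2 b\<alpha> bC] swap(2)[OF bf2 b\<alpha> b\<gamma>]
      using fC by (intro integral_cong_AE m1(2)[OF bf2 b\<alpha> bC] m1(2)[OF bf2 b\<alpha> b\<gamma>]) (elim eventually_mono, simp only:)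
    \<comment> \<open>Here \<open>d\<close> enters: both test functions now factor through the
      anchor map, so the kernel may be replaced by its conditional expectation.\<close>
    also have "\<dots> = (LINT z|P2. ?F (fst z) (snd z) * (\<alpha> (?\<phi> (fst z)) * \<gamma> (?\<phi> (snd z))))"
      using integral_factor_density[of "\<lambda>z. (?\<phi> (fst z), ?\<phi> (snd z))" "P2" "borel2" "\<lambda>z. ?f (fst z) (snd z)" a "\<lambda>s. \<alpha> (fst s) * \<gamma> (snd s)"]
        f01 a01 d by (simp add: bdd_measurable_measurable[OF bf])
    also have "\<dots> = (LINT z|P2. ?F (fst z) (snd z) * (indicator A (fst z) * \<gamma> (?\<phi> (snd z))))"
      unfolding swap(1)[OF bF2 b\<alpha> b\<gamma>] swap(1)[OF bF2 bA b\<gamma>]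
      using \<alpha>h[of "\<lambda>s. a (s, ?\<phi> y)" for y] by simp
    also have "\<dots> = (LINT z|P2. ?F (fst z) (snd z) * (indicator A (fst z) * indicator C (snd z)))"
      unfolding swap(2)[OF bF2 bA b\<gamma>] swap(2)[OF bF2 bA bC]
      using \<gamma>h[of "\<lambda>s. a (?\<phi> x, s)" for x] by simp
    finally show "(LINT z|P2. ?f (fst z) (snd z) * (indicator A (fst z) * indicator C (snd z))) =
      (LINT z|P2. ?F (fst z) (snd z) * (indicator A (fst z) * indicator C (snd z)))" .
  qed
  then show ?thesis by (simp add: split_beta')
qed

end

section \<open>Common factors of graphons with equal densities\<close>

text \<open>The image of a set of full measure may fail to be measurable. Perfectness supplies a
  Borel set of full image measure inside it, so almost every value is attained at a point with
  property \<open>R\<close>.\<close>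

lemma (in prob_space) perfect_measure_AE_image:
  fixes f :: "'a \<Rightarrow> real"
  assumes perf: "perfect_measure M" and f[measurable]: "f \<in> borel_measurable M" and R: "AE x in M. R x"
  obtains B where "B \<in> sets borel" "B \<subseteq> f ` {x\<in>space M. R x}" "AE y in distr M borel f. y \<in> B"
proof -
  from R obtain N where N: "{x\<in>space M. \<not> R x} \<subseteq> N" "N \<in> null_sets M"
    by (auto simp: eventually_ae_filter)
  have "space M - N \<in> sets M" using N(2) by auto
  then obtain B where B: "B \<in> sets borel" "B \<subseteq> f ` (space M - N)" "(space M - N) - f -` B \<in> null_sets M"
    by (rule perfect_measureD[OF perf f])
  have "AE x in M. f x \<in> B"
    using AE_not_in[OF B(3)] AE_not_in[OF N(2)] AE_space by eventually_elim auto
  then have "AE y in distr M borel f. y \<in> B"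
    using B(1) by (subst AE_distr_iff) auto
  moreover have "B \<subseteq> f ` {x\<in>space M. R x}" using B(2) N(1) by auto
  ultimately show ?thesis using that B(1) by blast
qed

lemma weak_isomorphism_distr:
  assumes "\<phi> \<in> M \<rightarrow>\<^sub>M N" "AE (x, y) in M \<Otimes>\<^sub>M M. W x y = V (\<phi> x) (\<phi> y)"
  shows "weak_isomorphism M W (distr M N \<phi>) V \<phi>"
proof -
  have "measure_preserving M (distr M N \<phi>) \<phi>"
    using assms(1) by (auto simp: measure_preserving_def emeasure_distr)
  with assms(2) show ?thesis
    by (simp add: weak_isomorphism_def pull_back_def measure_preserving_completion)
qed

lemma AE_pair_measure_distr:
  assumes M: "prob_space M" and \<phi>: "\<phi> \<in> M \<rightarrow>\<^sub>M N"
    and ae: "AE (x, y) in distr M N \<phi> \<Otimes>\<^sub>M distr M N \<phi>. R x y"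
  shows "AE (x, y) in M \<Otimes>\<^sub>M M. R (\<phi> x) (\<phi> y)"
proof -
  interpret M: prob_space M by fact
  interpret D: prob_space "distr M N \<phi>" by (rule M.prob_space_distr[OF \<phi>])
  have eq: "distr M N \<phi> \<Otimes>\<^sub>M distr M N \<phi> = distr (M \<Otimes>\<^sub>M M) (N \<Otimes>\<^sub>M N) (\<lambda>(x, y). (\<phi> x, \<phi> y))"
    by (rule pair_measure_distr[OF \<phi> \<phi>]) unfold_locales
  from AE_distrD[OF _ ae[unfolded eq]] show ?thesis
    using \<phi> by (simp add: split_beta')
qed

lemma borel_kernel_mono: "borel_kernel P U b \<Longrightarrow> b \<le> c \<Longrightarrow> borel_kernel P U c"
  unfolding borel_kernel_def borel_kernel_axioms_def by (blast intro: order.trans)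

lemma (in borel_kernel) sets_Q: "sets Q = sets (borel :: (nat \<Rightarrow> real) measure)"
  by (rule trans[OF sets_PiM_cong sets_PiM_equal_borel]) simp_all

lemma (in borel_kernel) perfect_measure_Q: "perfect_measure Q"
proof -
  interpret Q: prob_space Q by (rule prob_space_Q)
  show ?thesis by (intro perfect_measure_borel sets_Q) unfold_locales
qed

text \<open>All anchored densities are decodable from this one number, so two anchor sequences match
  as soon as a single real value does.\<close>

definition (in borel_kernel) anchored_code :: "(nat \<Rightarrow> real) \<Rightarrow> real" where
  "anchored_code \<xi> = seq_code (\<lambda>c. anchored_density c \<xi>)"

lemma (in borel_kernel) measurable_anchored_code [measurable]: "anchored_code \<in> borel_measurable Q"
  unfolding anchored_code_def[abs_def]
  by (rule measurable_seq_code, rule bdd_measurable_measurable, rule bdd_measurable_anchored_density)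

lemma distr_anchored_code_eq:
  assumes B: "borel_kernel P U b" and B': "borel_kernel P' U' b'"
    and dens: "\<And>k E. simple_graph_on k E \<Longrightarrow> hom_density k E P U = hom_density k E P' U'"
  shows "distr (\<Pi>\<^sub>M i\<in>UNIV. P) borel (borel_kernel.anchored_code P U) =
    distr (\<Pi>\<^sub>M i\<in>UNIV. P') borel (borel_kernel.anchored_code P' U')"
proof -
  interpret K: borel_kernel P U b by fact
  interpret K': borel_kernel P' U' b' by fact
  interpret Q: prob_space K.Q by (rule K.prob_space_Q)
  interpret Q': prob_space K'.Q by (rule K'.prob_space_Q)
  let ?X = "\<lambda>\<xi> c. K.anchored_density c \<xi>" and ?X' = "\<lambda>\<xi> c. K'.anchored_density c \<xi>"
  let ?S = "PiM UNIV (\<lambda>_. borel) :: (bool \<times> nat list \<times> nat list \<Rightarrow> real) measure"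
  have "distr (density K.Q (\<lambda>_. ennreal 1)) ?S ?X = distr (density K'.Q (\<lambda>_. ennreal 1)) ?S ?X'"
  proof (rule distr_eq_of_moments)
    show "finite_measure K.Q" "finite_measure K'.Q" by unfold_locales
    fix c show "K.anchored_density c \<in> borel_measurable K.Q" "K'.anchored_density c \<in> borel_measurable K'.Q"
      by (rule bdd_measurable_measurable, rule K.bdd_measurable_anchored_density)
         (rule bdd_measurable_measurable, rule K'.bdd_measurable_anchored_density)
    show "\<exists>d. \<forall>\<xi>\<in>space K.Q. \<bar>K.anchored_density c \<xi>\<bar> \<le> d" "\<exists>d. \<forall>\<xi>\<in>space K'.Q. \<bar>K'.anchored_density c \<xi>\<bar> \<le> d"
      using K.bdd_measurable_anchored_density[of c] K'.bdd_measurable_anchored_density[of c]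
      unfolding bdd_measurable_def by blast+
  next
    fix C
    show "(LINT \<xi>|K.Q. 1 * (\<Prod>c\<leftarrow>C. K.anchored_density c \<xi>)) = (LINT \<xi>|K'.Q. 1 * (\<Prod>c\<leftarrow>C. K'.anchored_density c \<xi>))"
      using anchored_density_moments[OF B B' dens, of C] by simp
  qed simp_all
  then have eq: "distr K.Q ?S ?X = distr K'.Q ?S ?X'" by (simp add: density_1)
  have m: "?X \<in> K.Q \<rightarrow>\<^sub>M ?S" "?X' \<in> K'.Q \<rightarrow>\<^sub>M ?S"
    by (rule measurable_PiM_single'; simp add: K.bdd_measurable_anchored_density K'.bdd_measurable_anchored_density bdd_measurable_measurable)+
  have s: "seq_code \<in> ?S \<rightarrow>\<^sub>M borel" using measurable_seq_code[of "\<lambda>x. x" ?S] by simp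
  have "distr K.Q borel K.anchored_code = distr (distr K.Q ?S ?X) borel seq_code"
    by (subst distr_distr[OF s m(1)]) (simp add: K.anchored_code_def[abs_def] comp_def)
  also have "\<dots> = distr (distr K'.Q ?S ?X') borel seq_code" by (simp only: eq)
  also have "\<dots> = distr K'.Q borel K'.anchored_code"
    by (subst distr_distr[OF s m(2)]) (simp add: K'.anchored_code_def[abs_def] comp_def)
  finally show ?thesis .
qed

section \<open>Laws of the anchor coordinates for fixed anchors\<close>

context borel_kernel
begin

text \<open>The Boolean selects the endpoint, so the coordinates of both endpoints form one
  countable family and moments determine their joint law.\<close>

definition anchor_coord :: "(nat \<Rightarrow> real) \<Rightarrow> bool \<times> nat \<Rightarrow> real \<times> real \<Rightarrow> real" where
  "anchor_coord \<xi> = (\<lambda>(t, i) z. T2 (if t then fst z else snd z) (\<xi> i))"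

lemma bdd_measurable_anchor_coord: "bdd_measurable (borel2) (anchor_coord \<xi> p)"
proof -
  obtain t i where p: "p = (t, i)" by (cases p)
  show ?thesis
    unfolding p anchor_coord_def by (cases t; simp; rule bdd_measurable_T2) measurable
qed

lemma prod_anchor_coord:
  "(\<Prod>p\<leftarrow>l. anchor_coord \<xi> p z) =
    (\<Prod>i\<leftarrow>map snd (filter fst l). T2 (fst z) (\<xi> i)) * (\<Prod>i\<leftarrow>map snd (filter (\<lambda>p. \<not> fst p) l). T2 (snd z) (\<xi> i))"
  by (induction l) (auto simp: anchor_coord_def mult_ac)

lemma integral_prod_anchor_coord:
  "(LINT z|P2. (\<Prod>p\<leftarrow>l. anchor_coord \<xi> p z)) =
    anchored_density (False, map snd (filter fst l), map snd (filter (\<lambda>p. \<not> fst p) l)) \<xi>"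
  by (simp add: anchored_density_def prod_anchor_coord)

lemma integral_U_prod_anchor_coord:
  "(LINT z|P2. (U (fst z) (snd z) + c) / (2 * c) * (\<Prod>p\<leftarrow>l. anchor_coord \<xi> p z)) =
    (anchored_density (True, map snd (filter fst l), map snd (filter (\<lambda>p. \<not> fst p) l)) \<xi> +
     c * anchored_density (False, map snd (filter fst l), map snd (filter (\<lambda>p. \<not> fst p) l)) \<xi>) / (2 * c)"
proof -
  interpret PP: pair_prob_space P P by (rule pair_prob_space)
  let ?p = "\<lambda>z. \<Prod>p\<leftarrow>l. anchor_coord \<xi> p z"
  have bU: "bdd_measurable (borel2) (\<lambda>z. U (fst z) (snd z))" by (rule bdd_measurable_U) measurable
  have bp: "bdd_measurable (borel2) ?p"
    by (intro bdd_measurable_prod_list bdd_measurable_anchor_coord)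
  have i: "integrable P2 (\<lambda>z. U (fst z) (snd z) * ?p z)" "integrable P2 ?p"
    using bdd_measurable_mult[OF bU bp] bp
    by (simp_all only: PP.integrable_bdd_measurable bdd_measurable_PP_iff)
  have "(LINT z|P2. (U (fst z) (snd z) + c) / (2 * c) * ?p z) =
    (LINT z|P2. (U (fst z) (snd z) * ?p z + c * ?p z) / (2 * c))"
    by (simp add: algebra_simps)
  also have "\<dots> = ((LINT z|P2. U (fst z) (snd z) * ?p z) + c * (LINT z|P2. ?p z)) / (2 * c)"
    using i by simp
  also have "(LINT z|P2. U (fst z) (snd z) * ?p z) =
     anchored_density (True, map snd (filter fst l), map snd (filter (\<lambda>p. \<not> fst p) l)) \<xi>"
    by (simp add: anchored_density_def prod_anchor_coord)
  finally show ?thesis by (simp only: integral_prod_anchor_coord)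
qed

abbreviation anchor_map2 :: "(nat \<Rightarrow> real) \<Rightarrow> real \<times> real \<Rightarrow> real \<times> real" where
  "anchor_map2 \<xi> z \<equiv> (anchor_map \<xi> (fst z), anchor_map \<xi> (snd z))"

end

definition code_pair :: "(bool \<times> nat \<Rightarrow> real) \<Rightarrow> real \<times> real" where
  "code_pair x = (seq_code (\<lambda>i. x (True, i)), seq_code (\<lambda>i. x (False, i)))"

lemma measurable_code_pair [measurable]: "code_pair \<in> PiM UNIV (\<lambda>_. borel) \<rightarrow>\<^sub>M borel2"
  unfolding code_pair_def[abs_def] by measurable

lemma (in borel_kernel) anchor_map2_code_pair:
  "anchor_map2 \<xi> z = code_pair (\<lambda>p. anchor_coord \<xi> p z)"
  by (simp add: code_pair_def anchor_map_def anchor_coord_def)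

text \<open>For fixed anchors a monomial in the coordinates integrates to an anchored density: with
  flag \<open>False\<close> without the kernel, with flag \<open>True\<close> weighted by it. The
  numbers in \<open>eq\<close> therefore determine all moments of both image measures. One
  \<open>c\<close> for both kernels makes the weights the same affine function of the
  kernel.\<close>

lemma distr_anchor_map2_eq:
  assumes B: "borel_kernel P U c" and B': "borel_kernel P' U' c" and c: "0 < c"
    and eq: "\<And>k. borel_kernel.anchored_density P U k \<xi> = borel_kernel.anchored_density P' U' k \<xi>'"
  shows "distr (density (P \<Otimes>\<^sub>M P) (\<lambda>z. (U (fst z) (snd z) + c) / (2 * c))) (borel2) (borel_kernel.anchor_map2 P U \<xi>) =
     distr (density (P' \<Otimes>\<^sub>M P') (\<lambda>z. (U' (fst z) (snd z) + c) / (2 * c))) (borel2) (borel_kernel.anchor_map2 P' U' \<xi>')" (is ?U)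
    and "distr (P \<Otimes>\<^sub>M P) (borel2) (borel_kernel.anchor_map2 P U \<xi>) =
     distr (P' \<Otimes>\<^sub>M P') (borel2) (borel_kernel.anchor_map2 P' U' \<xi>')" (is ?N)
proof -
  interpret K: borel_kernel P U c by fact
  interpret K': borel_kernel P' U' c by fact
  interpret PP: pair_prob_space P P by (rule K.pair_prob_space)
  interpret PP': pair_prob_space P' P' by (rule K'.pair_prob_space)
  let ?S = "PiM UNIV (\<lambda>_. borel) :: (bool \<times> nat \<Rightarrow> real) measure"
  let ?X = "\<lambda>z p. K.anchor_coord \<xi> p z" and ?X' = "\<lambda>z p. K'.anchor_coord \<xi>' p z"
  let ?w = "\<lambda>z. (U (fst z) (snd z) + c) / (2 * c)" and ?w' = "\<lambda>z. (U' (fst z) (snd z) + c) / (2 * c)"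
  have b: "bdd_measurable K.P2 (K.anchor_coord \<xi> p)" "bdd_measurable K'.P2 (K'.anchor_coord \<xi>' p)" for p
    by (simp_all add: K.bdd_measurable_anchor_coord K'.bdd_measurable_anchor_coord)
  have m: "K.anchor_coord \<xi> p \<in> borel_measurable K.P2" "K'.anchor_coord \<xi>' p \<in> borel_measurable K'.P2" for p
    by (rule bdd_measurable_measurable[OF b(1)], rule bdd_measurable_measurable[OF b(2)])
  have bd: "\<exists>d. \<forall>z\<in>space K.P2. \<bar>K.anchor_coord \<xi> p z\<bar> \<le> d" "\<exists>d. \<forall>z\<in>space K'.P2. \<bar>K'.anchor_coord \<xi>' p z\<bar> \<le> d" for p
    using b[of p] unfolding bdd_measurable_def by blast+
  have w0: "0 \<le> ?w z" "0 \<le> ?w' z" for z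
    using K.U_le[of "fst z" "snd z"] K'.U_le[of "fst z" "snd z"] c by (simp_all add: abs_le_iff)
  have bw: "bdd_measurable (borel2) ?w" "bdd_measurable (borel2) ?w'"
    unfolding divide_inverse
    by (intro bdd_measurable_mult bdd_measurable_add bdd_measurable_const K.bdd_measurable_U K'.bdd_measurable_U; measurable)+
  have fin: "finite_measure K.P2" "finite_measure K'.P2" by unfold_locales
  have mX: "?X \<in> K.P2 \<rightarrow>\<^sub>M ?S" "?X' \<in> K'.P2 \<rightarrow>\<^sub>M ?S"
    by (rule measurable_PiM_single'; simp add: m)+
  have X: "distr (density K.P2 v) (borel2) (K.anchor_map2 \<xi>) = distr (distr (density K.P2 v) ?S ?X) (borel2) code_pair" for v
    using mX by (subst distr_distr) (simp_all add: comp_def K.anchor_map2_code_pair)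
  have X': "distr (density K'.P2 v) (borel2) (K'.anchor_map2 \<xi>') = distr (distr (density K'.P2 v) ?S ?X') (borel2) code_pair" for v
    using mX by (subst distr_distr) (simp_all add: comp_def K'.anchor_map2_code_pair)
  have "distr (density K.P2 ?w) ?S ?X = distr (density K'.P2 ?w') ?S ?X'"
  proof (rule distr_eq_of_moments[OF fin m bd])
    show "integrable K.P2 ?w" using bw(1) by (intro PP.integrable_bdd_measurable) simp
    show "integrable K'.P2 ?w'" using bw(2) by (intro PP'.integrable_bdd_measurable) simp
    show "(LINT z|K.P2. ?w z * (\<Prod>p\<leftarrow>l. K.anchor_coord \<xi> p z)) = (LINT z|K'.P2. ?w' z * (\<Prod>p\<leftarrow>l. K'.anchor_coord \<xi>' p z))" for l
      unfolding K.integral_U_prod_anchor_coord K'.integral_U_prod_anchor_coord eq ..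
  qed (rule w0)+
  then show ?U unfolding X X' by (simp only:)
  have "distr (density K.P2 (\<lambda>_. ennreal 1)) ?S ?X = distr (density K'.P2 (\<lambda>_. ennreal 1)) ?S ?X'"
  proof (rule distr_eq_of_moments[OF fin m bd])
    show "(LINT z|K.P2. 1 * (\<Prod>p\<leftarrow>l. K.anchor_coord \<xi> p z)) = (LINT z|K'.P2. 1 * (\<Prod>p\<leftarrow>l. K'.anchor_coord \<xi>' p z))" for l
      by (simp only: mult_1 K.integral_prod_anchor_coord K'.integral_prod_anchor_coord eq)
  qed simp_all
  then have "distr (density K.P2 (\<lambda>_. ennreal 1)) (borel2) (K.anchor_map2 \<xi>) =
      distr (density K'.P2 (\<lambda>_. ennreal 1)) (borel2) (K'.anchor_map2 \<xi>')"
    unfolding X X' by (simp only:)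
  then show ?N by (simp add: density_1)
qed

text \<open>Equal densities give equal laws of codes. For each kernel the codes of good anchors
  contain a set of full measure for that common law, and two such sets meet, which yields good
  anchors with matching codes. There the laws of the two anchor maps agree, so one function
  \<open>a\<close> represents both kernels.\<close>

lemma borel_kernels_common_factor:
  assumes B0: "borel_kernel P U b" and B0': "borel_kernel P' U' b'"
    and dens: "\<And>k E. simple_graph_on k E \<Longrightarrow> hom_density k E P U = hom_density k E P' U'"
  obtains \<phi> \<phi>' V c where "\<phi> \<in> borel_measurable borel" "\<phi>' \<in> borel_measurable borel"
    "distr P borel \<phi> = distr P' borel \<phi>'" "borel_kernel (distr P borel \<phi>) V c"
    "AE (x, y) in P \<Otimes>\<^sub>M P. U x y = V (\<phi> x) (\<phi> y)"
    "AE (x, y) in P' \<Otimes>\<^sub>M P'. U' x y = V (\<phi>' x) (\<phi>' y)"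
proof -
  \<comment> \<open>The 1 keeps \<open>c\<close> positive, as it becomes a divisor.\<close>
  define c where "c = max 1 (max b b')"
  have c: "0 < c" "b \<le> c" "b' \<le> c" by (auto simp: c_def)
  have B: "borel_kernel P U c" and B': "borel_kernel P' U' c"
    using B0 B0' c by (auto intro: borel_kernel_mono)
  interpret K: borel_kernel P U c by fact
  interpret K': borel_kernel P' U' c by fact
  interpret PP: pair_prob_space P P by (rule K.pair_prob_space)
  interpret PP': pair_prob_space P' P' by (rule K'.pair_prob_space)
  interpret Q: prob_space K.Q by (rule K.prob_space_Q)
  interpret Q': prob_space K'.Q by (rule K'.prob_space_Q)
  let ?L = "distr K.Q borel K.anchored_code"
  interpret L: prob_space ?L by (rule Q.prob_space_distr) measurable
  have L': "?L = distr K'.Q borel K'.anchored_code" by (rule distr_anchored_code_eq[OF B B' dens])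
  obtain S where S: "S \<subseteq> K.anchored_code ` {\<xi>\<in>space K.Q. K.good \<xi>}" "AE y in ?L. y \<in> S"
    by (rule Q.perfect_measure_AE_image[OF K.perfect_measure_Q K.measurable_anchored_code K.AE_good]) blast
  obtain S' where S': "S' \<subseteq> K'.anchored_code ` {\<xi>\<in>space K'.Q. K'.good \<xi>}" "AE y in ?L. y \<in> S'"
    unfolding L' by (rule Q'.perfect_measure_AE_image[OF K'.perfect_measure_Q K'.measurable_anchored_code K'.AE_good]) blast
  have "S \<inter> S' \<noteq> {}"
  proof
    assume "S \<inter> S' = {}"
    from S(2) S'(2) have "AE y in ?L. y \<in> S \<inter> S'" by eventually_elim simp
    with \<open>S \<inter> S' = {}\<close> have "AE y in ?L. False" by simp
    then show False using L.AE_False by blast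
  qed
  then obtain \<xi> \<xi>' where \<xi>: "K.good \<xi>" and \<xi>': "K'.good \<xi>'" and code: "K.anchored_code \<xi> = K'.anchored_code \<xi>'"
    using S(1) S'(1) by fastforce
  have eq: "K.anchored_density k \<xi> = K'.anchored_density k \<xi>'" for k
    using arg_cong[OF code, of "seq_decode k"] by (simp add: K.anchored_code_def K'.anchored_code_def)
  note laws = distr_anchor_map2_eq[OF B B' c(1) eq]
  let ?w = "\<lambda>z. (U (fst z) (snd z) + c) / (2 * c)"
  have \<Phi>: "K.anchor_map2 \<xi> \<in> K.P2 \<rightarrow>\<^sub>M borel2" "K'.anchor_map2 \<xi>' \<in> K'.P2 \<rightarrow>\<^sub>M borel2" by measurable
  have "(\<lambda>z. U (fst z) (snd z)) \<in> borel_measurable K.P2"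
    using K.U_measurable by (simp add: split_beta')
  then have w: "?w \<in> borel_measurable K.P2" by measurable
  have w1: "?w z \<le> 1" for z using K.U_le[of "fst z" "snd z"] c(1) by (simp add: abs_le_iff)
  \<comment> \<open>\<open>a\<close> is obtained from the first kernel alone; \<open>laws\<close>
    then identifies it as the conditional expectation for the second.\<close>
  obtain a :: "real \<times> real \<Rightarrow> real" where a: "a \<in> borel_measurable (borel2)" "\<And>z. 0 \<le> a z" "\<And>z. a z \<le> 1"
    "distr (density K.P2 ?w) (borel2) (K.anchor_map2 \<xi>) = density (distr K.P2 (borel2) (K.anchor_map2 \<xi>)) a"
    by (rule factor_density_exists[OF PP.finite_measure_axioms \<Phi>(1) w w1]) blast
  have ae: "AE (x, y) in P \<Otimes>\<^sub>M P. (U x y + c) / (2 * c) = a (K.anchor_map \<xi> x, K.anchor_map \<xi> y)"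
    by (rule K.good_factor[OF \<xi> c(1) a])
  have ae': "AE (x, y) in P' \<Otimes>\<^sub>M P'. (U' x y + c) / (2 * c) = a (K'.anchor_map \<xi>' x, K'.anchor_map \<xi>' y)"
    by (rule K'.good_factor[OF \<xi>' c(1) a(1-3)]) (use a(4) laws in simp)
  \<comment> \<open>The inverse of \<open>u \<mapsto> (u + c) / (2 * c)\<close>, averaged over both
    orders of the arguments since \<open>a\<close> is known to be symmetric only almost
    everywhere.\<close>
  define V where "V s t = c * (a (s, t) + a (t, s)) - c" for s t
  have V: "u = V s t" if "(u + c) / (2 * c) = a (s, t)" "(u + c) / (2 * c) = a (t, s)" for u s t
    unfolding V_def that[symmetric] using c(1) by (simp add: field_simps)
  let ?\<phi> = "K.anchor_map \<xi>" and ?\<phi>' = "K'.anchor_map \<xi>'"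
  have [measurable]: "?\<phi> \<in> borel_measurable borel" "?\<phi>' \<in> borel_measurable borel"
    by (rule K.measurable_anchor_map, rule K'.measurable_anchor_map)
  have m: "?\<phi> \<in> borel_measurable P" "?\<phi>' \<in> borel_measurable P'"
    unfolding measurable_cong_sets[OF K.sets_P refl] measurable_cong_sets[OF K'.sets_P refl]
    by (rule K.measurable_anchor_map, rule K'.measurable_anchor_map)
  show ?thesis
  proof
    show "?\<phi> \<in> borel_measurable borel" "?\<phi>' \<in> borel_measurable borel" by measurable
    show "distr P borel ?\<phi> = distr P' borel ?\<phi>'"
    proof -
      have "distr P borel ?\<phi> = distr (distr K.P2 P fst) borel ?\<phi>"
        by (simp only: K.distr_pair_fst)
      also have "\<dots> = distr (distr K.P2 (borel2) (K.anchor_map2 \<xi>)) borel fst"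
        by (simp only: distr_distr[OF m(1) measurable_fst] distr_distr[OF measurable_fst \<Phi>(1)] comp_def fst_conv)
      also have "\<dots> = distr (distr K'.P2 (borel2) (K'.anchor_map2 \<xi>')) borel fst"
        by (simp only: laws(2))
      also have "\<dots> = distr (distr K'.P2 P' fst) borel ?\<phi>'"
        by (simp only: distr_distr[OF m(2) measurable_fst] distr_distr[OF measurable_fst \<Phi>(2)] comp_def fst_conv)
      also have "\<dots> = distr P' borel ?\<phi>'"
        by (simp only: K'.distr_pair_fst)
      finally show ?thesis .
    qed
    show "borel_kernel (distr P borel ?\<phi>) V c"
    proof -
      interpret D: prob_space "distr P borel ?\<phi>" by (rule K.prob_space_distr[OF m(1)])
      note a(1)[measurable]
      show ?thesis
      proof
        show "(\<lambda>(x, y). V x y) \<in> borel_measurable (borel2)" unfolding V_def by measurable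
        fix x y
        show "V x y = V y x" by (simp add: V_def add.commute)
        have "0 \<le> c * (a (x, y) + a (y, x))" using c a(2) by simp
        moreover have "c * (a (x, y) + a (y, x)) \<le> c * 2" using c a(3)[of "(x, y)"] a(3)[of "(y, x)"] by (intro mult_left_mono) auto
        ultimately show "\<bar>V x y\<bar> \<le> c" by (simp add: V_def abs_le_iff)
      qed simp
    qed
    show "AE (x, y) in P \<Otimes>\<^sub>M P. U x y = V (?\<phi> x) (?\<phi> y)"
      using ae AE_pair_swap[OF K.sigma_finite_measure_axioms ae]
      by eventually_elim (auto intro!: V split: prod.splits simp: K.U_sym)
    show "AE (x, y) in P' \<Otimes>\<^sub>M P'. U' x y = V (?\<phi>' x) (?\<phi>' y)"
      using ae' AE_pair_swap[OF K'.sigma_finite_measure_axioms ae']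
      by eventually_elim (auto intro!: V split: prod.splits simp: K'.U_sym)
  qed
qed

text \<open>The Borel models of the two graphons have a common factor; composing the model maps with
  the factor maps carries it back to the original spaces.\<close>

lemma graphons_common_factor:
  assumes G: "graphon M W" and G': "graphon M' W'"
    and dens: "\<And>k E. simple_graph_on k E \<Longrightarrow> hom_density k E M W = hom_density k E M' W'"
  obtains \<phi> \<phi>' V c where "\<phi> \<in> borel_measurable M" "\<phi>' \<in> borel_measurable M'"
    "distr M borel \<phi> = distr M' borel \<phi>'" "borel_kernel (distr M borel \<phi>) V c"
    "AE (x, y) in M \<Otimes>\<^sub>M M. W x y = V (\<phi> x) (\<phi> y)"
    "AE (x, y) in M' \<Otimes>\<^sub>M M'. W' x y = V (\<phi>' x) (\<phi>' y)"
proof -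
  interpret M: graphon M W by fact
  interpret M': graphon M' W' by fact
  obtain \<psi> U b where \<psi>[measurable]: "\<psi> \<in> borel_measurable M" and U: "borel_kernel (distr M borel \<psi>) U b"
    and WU: "AE (x, y) in M \<Otimes>\<^sub>M M. W x y = U (\<psi> x) (\<psi> y)"
    by (rule graphon_borel_kernel[OF G])
  obtain \<psi>' U' b' where \<psi>'[measurable]: "\<psi>' \<in> borel_measurable M'" and U': "borel_kernel (distr M' borel \<psi>') U' b'"
    and WU': "AE (x, y) in M' \<Otimes>\<^sub>M M'. W' x y = U' (\<psi>' x) (\<psi>' y)"
    by (rule graphon_borel_kernel[OF G'])
  have "weak_isomorphism M W (distr M borel \<psi>) U \<psi>" "weak_isomorphism M' W' (distr M' borel \<psi>') U' \<psi>'"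
    by (rule weak_isomorphism_distr[OF \<psi> WU], rule weak_isomorphism_distr[OF \<psi>' WU'])
  then have "hom_density k E (distr M borel \<psi>) U = hom_density k E (distr M' borel \<psi>') U'" if "simple_graph_on k E" for k E
    using that dens hom_density_weak_isomorphism[OF G borel_kernel.graphon[OF U]]
      hom_density_weak_isomorphism[OF G' borel_kernel.graphon[OF U']] by metis
  then obtain \<phi> \<phi>' V c where \<phi>[measurable]: "\<phi> \<in> borel_measurable borel" "\<phi>' \<in> borel_measurable borel"
    and d: "distr (distr M borel \<psi>) borel \<phi> = distr (distr M' borel \<psi>') borel \<phi>'"
    and V: "borel_kernel (distr (distr M borel \<psi>) borel \<phi>) V c"
    and UV: "AE (x, y) in distr M borel \<psi> \<Otimes>\<^sub>M distr M borel \<psi>. U x y = V (\<phi> x) (\<phi> y)"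
    and UV': "AE (x, y) in distr M' borel \<psi>' \<Otimes>\<^sub>M distr M' borel \<psi>'. U' x y = V (\<phi>' x) (\<phi>' y)"
    by (rule borel_kernels_common_factor[OF U U'])
  show ?thesis
  proof
    show "(\<lambda>x. \<phi> (\<psi> x)) \<in> borel_measurable M" "(\<lambda>x. \<phi>' (\<psi>' x)) \<in> borel_measurable M'" by measurable
    show "distr M borel (\<lambda>x. \<phi> (\<psi> x)) = distr M' borel (\<lambda>x. \<phi>' (\<psi>' x))"
      using d by (simp add: distr_distr comp_def)
    show "borel_kernel (distr M borel (\<lambda>x. \<phi> (\<psi> x))) V c"
      using V by (simp add: distr_distr comp_def)
    show "AE (x, y) in M \<Otimes>\<^sub>M M. W x y = V (\<phi> (\<psi> x)) (\<phi> (\<psi> y))"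
      using WU AE_pair_measure_distr[OF M.prob_space_axioms \<psi> UV] by eventually_elim auto
    show "AE (x, y) in M' \<Otimes>\<^sub>M M'. W' x y = V (\<phi>' (\<psi>' x)) (\<phi>' (\<psi>' y))"
      using WU' AE_pair_measure_distr[OF M'.prob_space_axioms \<psi>' UV'] by eventually_elim auto
  qed
qed

lemma weakly_isomorphic_of_hom_density:
  assumes G: "graphon M W" and G': "graphon M' W'"
    and dens: "\<And>k E. simple_graph_on k E \<Longrightarrow> hom_density k E M W = hom_density k E M' W'"
  shows "weakly_isomorphic TYPE(real) M W M' W'"
proof -
  obtain \<phi> \<phi>' V c where \<phi>: "\<phi> \<in> borel_measurable M" "\<phi>' \<in> borel_measurable M'"
    and d: "distr M borel \<phi> = distr M' borel \<phi>'" and V: "borel_kernel (distr M borel \<phi>) V c"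
    and ae: "AE (x, y) in M \<Otimes>\<^sub>M M. W x y = V (\<phi> x) (\<phi> y)"
    and ae': "AE (x, y) in M' \<Otimes>\<^sub>M M'. W' x y = V (\<phi>' x) (\<phi>' y)"
    by (rule graphons_common_factor[OF G G' dens])
  have "weak_isomorphism M W (distr M borel \<phi>) V \<phi>"
    by (rule weak_isomorphism_distr[OF \<phi>(1) ae])
  moreover have "weak_isomorphism M' W' (distr M borel \<phi>) V \<phi>'"
    unfolding d by (rule weak_isomorphism_distr[OF \<phi>(2) ae'])
  ultimately show ?thesis
    using borel_kernel.graphon[OF V] unfolding weakly_isomorphic_def by blast
qed

section \<open>Twin-free Lebesguian graphons\<close>

text \<open>By Fubini the section of \<open>W\<close> at almost every \<open>x\<close> is determined
  by \<open>\<phi> x\<close> up to a null set, so two such points with equal \<open>\<phi>\<close>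
  are twins.\<close>

lemma twin_free_inj_on:
  assumes G: "graphon M W" and tf: "almost_twin_free M W" and ae: "AE (x, y) in M \<Otimes>\<^sub>M M. W x y = V (\<phi> x) (\<phi> y)"
  obtains N where "N \<in> null_sets M" "inj_on \<phi> (space M - N)"
proof -
  interpret M: graphon M W by fact
  interpret MM: pair_sigma_finite M M ..
  from tf obtain N1 where N1: "N1 \<in> null_sets M"
    "\<And>x y. x \<in> space M - N1 \<Longrightarrow> y \<in> space M - N1 \<Longrightarrow> x \<noteq> y \<Longrightarrow> \<not> twins M W x y"
    unfolding almost_twin_free_def by blast
  have "AE x in M. AE y in M. W x y = V (\<phi> x) (\<phi> y)"
    using MM.AE_pair[OF ae] by simp
  then obtain N2 where N2: "{x\<in>space M. \<not> (AE y in M. W x y = V (\<phi> x) (\<phi> y))} \<subseteq> N2" "N2 \<in> null_sets M"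
    by (auto simp: eventually_ae_filter)
  show ?thesis
  proof
    show "N1 \<union> N2 \<in> null_sets M" using N1 N2 by auto
    show "inj_on \<phi> (space M - (N1 \<union> N2))"
    proof (rule inj_onI, rule ccontr)
      fix x y assume xy: "x \<in> space M - (N1 \<union> N2)" "y \<in> space M - (N1 \<union> N2)" "\<phi> x = \<phi> y" "x \<noteq> y"
      then have "AE z in M. W x z = V (\<phi> x) (\<phi> z)" "AE z in M. W y z = V (\<phi> y) (\<phi> z)"
        using N2(1) by auto
      then have "AE z in M. W x z = W y z" by eventually_elim (simp add: xy(3))
      then show False using N1(2)[of x y] xy by (auto simp: twins_def)
    qed
  qed
qed

lemma emeasure_vimage_distr_eq:
  assumes "\<phi> \<in> borel_measurable M" "\<phi>' \<in> borel_measurable M'" "distr M borel \<phi> = distr M' borel \<phi>'" "B \<in> sets borel"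
  shows "emeasure M (\<phi> -` B \<inter> space M) = emeasure M' (\<phi>' -` B \<inter> space M')"
  using assms by (metis emeasure_distr)

text \<open>By perfectness the injective image of a measurable set lies, up to a null set, between two
  Borel sets.\<close>

lemma vimage_injective_image:
  fixes \<phi> :: "'a \<Rightarrow> real" and \<phi>' :: "'b \<Rightarrow> real"
  assumes M: "prob_space M" "complete_measure M" and M': "prob_space M'" and perf: "perfect_measure M'"
    and \<phi>[measurable]: "\<phi> \<in> borel_measurable M" and \<phi>'[measurable]: "\<phi>' \<in> borel_measurable M'"
    and d: "distr M borel \<phi> = distr M' borel \<phi>'"
    and \<Omega>[measurable]: "\<Omega> \<in> sets M" and \<Omega>1: "AE x in M. x \<in> \<Omega>"
    and \<Omega>'[measurable]: "\<Omega>' \<in> sets M'" and \<Omega>'1: "AE y in M'. y \<in> \<Omega>'" and inj: "inj_on \<phi>' \<Omega>'"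
    and A[measurable]: "A \<in> sets M'"
  shows "{x\<in>\<Omega>. \<phi> x \<in> \<phi>' ` (A \<inter> \<Omega>')} \<in> sets M" (is "?S \<in> _")
    and "emeasure M {x\<in>\<Omega>. \<phi> x \<in> \<phi>' ` (A \<inter> \<Omega>')} = emeasure M' A"
proof -
  interpret M: prob_space M by fact
  interpret M': prob_space M' by fact
  interpret cM: complete_measure M by fact
  have AI: "A \<inter> \<Omega>' \<in> sets M'" "\<Omega>' - A \<in> sets M'" by measurable
  obtain B where B[measurable]: "B \<in> sets borel" and B_sub: "B \<subseteq> \<phi>' ` (A \<inter> \<Omega>')" and B0: "(A \<inter> \<Omega>') - \<phi>' -` B \<in> null_sets M'"
    by (rule perfect_measureD[OF perf \<phi>' AI(1)])
  obtain C where C[measurable]: "C \<in> sets borel" and C_sub: "C \<subseteq> \<phi>' ` (\<Omega>' - A)" and C0: "(\<Omega>' - A) - \<phi>' -` C \<in> null_sets M'"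
    by (rule perfect_measureD[OF perf \<phi>' AI(2)])
  \<comment> \<open>\<open>C\<close> lies in the image of the part of \<open>\<Omega>'\<close>
    outside \<open>A\<close>; by injectivity it misses the image of
    \<open>A \<inter> \<Omega>'\<close>, so removing it gives the outer set \<open>?R\<close>, while
    \<open>B\<close> gives the inner set \<open>?L\<close>.\<close>
  let ?L = "(\<phi> -` B \<inter> space M) \<inter> \<Omega>" and ?R = "\<Omega> - (\<phi> -` C \<inter> space M)"
  have L: "?L \<in> sets M" and R: "?R \<in> sets M" by measurable
  have sub: "?L \<subseteq> ?S" "?S \<subseteq> ?R"
    using B_sub C_sub inj by (auto dest!: subsetD[of C] inj_onD[OF inj])
  have "emeasure M' A \<le> emeasure M' (\<phi>' -` B \<inter> space M')"
  proof (rule emeasure_mono_AE)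
    show "AE y in M'. y \<in> A \<longrightarrow> y \<in> \<phi>' -` B \<inter> space M'"
      using \<Omega>'1 AE_not_in[OF B0] AE_space by eventually_elim auto
  qed measurable
  also have "\<dots> = emeasure M (\<phi> -` B \<inter> space M)"
    by (rule emeasure_vimage_distr_eq[OF \<phi> \<phi>' d B, symmetric])
  also have "\<dots> = emeasure M ?L"
    using \<Omega>1 by (intro emeasure_eq_AE) auto
  finally have AL: "emeasure M' A \<le> emeasure M ?L" .
  have "emeasure M ?R = emeasure M (\<phi> -` (UNIV - C) \<inter> space M)"
    using \<Omega>1 by (intro emeasure_eq_AE) auto
  also have "\<dots> = emeasure M' (\<phi>' -` (UNIV - C) \<inter> space M')"
    by (rule emeasure_vimage_distr_eq[OF \<phi> \<phi>' d]) auto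
  also have "\<dots> \<le> emeasure M' A"
  proof (rule emeasure_mono_AE)
    show "AE y in M'. y \<in> \<phi>' -` (UNIV - C) \<inter> space M' \<longrightarrow> y \<in> A"
      using \<Omega>'1 AE_not_in[OF C0] by eventually_elim auto
  qed measurable
  finally have RA: "emeasure M ?R \<le> emeasure M' A" .
  have LR: "emeasure M ?L \<le> emeasure M ?R" using sub R by (intro emeasure_mono) auto
  \<comment> \<open>\<open>?L\<close> and \<open>?R\<close> have the same finite measure, so
    completeness of \<open>M\<close> makes every set between them measurable.\<close>
  show S: "?S \<in> sets M"
    by (rule cM.complete_sets_sandwich[OF L R sub antisym[OF LR order.trans[OF RA AL]]])
       (simp add: M.emeasure_eq_measure)
  have "emeasure M ?L \<le> emeasure M ?S" "emeasure M ?S \<le> emeasure M ?R"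
    using sub S R by (auto intro!: emeasure_mono)
  with AL RA show "emeasure M ?S = emeasure M' A" by auto
qed

section \<open>Isomorphisms mod 0 from injective factors\<close>

lemma measure_preserving_restrict_space:
  assumes \<Omega>: "\<Omega> \<in> sets M" and \<Omega>': "\<Omega>' \<in> sets M'" and f: "\<And>x. x \<in> \<Omega> \<Longrightarrow> f x \<in> \<Omega>'"
    and A: "\<And>A. A \<in> sets M' \<Longrightarrow> f -` A \<inter> \<Omega> \<in> sets M" "\<And>A. A \<in> sets M' \<Longrightarrow> emeasure M (f -` A \<inter> \<Omega>) = emeasure M' A"
  shows "measure_preserving (restrict_space M \<Omega>) (restrict_space M' \<Omega>') f"
proof -
  have sp: "space (restrict_space M \<Omega>) = \<Omega>" "space (restrict_space M' \<Omega>') = \<Omega>'"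
    using sets.sets_into_space[OF \<Omega>] sets.sets_into_space[OF \<Omega>'] by (auto simp: space_restrict_space)
  show ?thesis
    unfolding measure_preserving_def sp
  proof (intro conjI ballI measurableI)
    fix B assume "B \<in> sets (restrict_space M' \<Omega>')"
    then have B: "B \<in> sets M'" "B \<subseteq> \<Omega>'" using \<Omega>' by (auto simp: sets_restrict_space_iff)
    show "f -` B \<inter> space (restrict_space M \<Omega>) \<in> sets (restrict_space M \<Omega>)"
      unfolding sp using A(1)[OF B(1)] \<Omega> by (simp add: sets_restrict_space_iff)
    show "emeasure (restrict_space M \<Omega>) (f -` B \<inter> \<Omega>) = emeasure (restrict_space M' \<Omega>') B"
      using A(2)[OF B(1)] B(2) \<Omega> \<Omega>' by (simp add: emeasure_restrict_space)
  qed (use f sp in auto)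
qed

text \<open>The isomorphism is the inverse of \<open>\<phi>'\<close> after \<open>\<phi>\<close>.
  The two images may differ or fail to be measurable, but perfectness gives Borel sets of full
  measure inside both, and over their intersection \<open>Y\<close> both maps are bijections onto
  \<open>Y\<close>.\<close>

lemma isomorphism_mod_0_of_injective_factors:
  fixes \<phi> :: "'a \<Rightarrow> real" and \<phi>' :: "'b \<Rightarrow> real"
  assumes M: "prob_space M" "complete_measure M" and M': "prob_space M'" "complete_measure M'"
    and perf: "perfect_measure M" and perf': "perfect_measure M'"
    and \<phi>[measurable]: "\<phi> \<in> borel_measurable M" and \<phi>'[measurable]: "\<phi>' \<in> borel_measurable M'"
    and d: "distr M borel \<phi> = distr M' borel \<phi>'"
    and N: "N \<in> null_sets M" "inj_on \<phi> (space M - N)" and N': "N' \<in> null_sets M'" "inj_on \<phi>' (space M' - N')"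
  obtains \<tau> where "isomorphism_mod_0 M M' \<tau>" "AE x in M. \<phi>' (\<tau> x) = \<phi> x"
proof -
  interpret M: prob_space M by fact
  interpret M': prob_space M' by fact
  let ?\<nu> = "distr M borel \<phi>"
  have "AE x in M. x \<notin> N" "AE y in M'. y \<notin> N'" using N N' by (auto intro: AE_not_in)
  obtain B where B[measurable]: "B \<in> sets borel" and B_sub: "B \<subseteq> \<phi> ` {x\<in>space M. x \<notin> N}" and B1: "AE s in ?\<nu>. s \<in> B"
    by (rule M.perfect_measure_AE_image[OF perf \<phi> \<open>AE x in M. x \<notin> N\<close>])
  obtain B' where B'[measurable]: "B' \<in> sets borel" and B'_sub: "B' \<subseteq> \<phi>' ` {y\<in>space M'. y \<notin> N'}" and B'1: "AE s in ?\<nu>. s \<in> B'"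
    unfolding d by (rule M'.perfect_measure_AE_image[OF perf' \<phi>' \<open>AE y in M'. y \<notin> N'\<close>])
  define Y where "Y = B \<inter> B'"
  have Y[measurable]: "Y \<in> sets borel" and Y1: "AE s in ?\<nu>. s \<in> Y"
    using B1 B'1 by (auto simp: Y_def)
  define \<Omega> where "\<Omega> = \<phi> -` Y \<inter> space M - N"
  define \<Omega>' where "\<Omega>' = \<phi>' -` Y \<inter> space M' - N'"
  have [measurable]: "N \<in> sets M" "N' \<in> sets M'" using N N' by auto
  have \<Omega>[measurable]: "\<Omega> \<in> sets M" and \<Omega>'[measurable]: "\<Omega>' \<in> sets M'" unfolding \<Omega>_def \<Omega>'_def by measurable
  have \<Omega>_sub: "\<Omega> \<subseteq> space M" and \<Omega>'_sub: "\<Omega>' \<subseteq> space M'" by (auto simp: \<Omega>_def \<Omega>'_def)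
  have \<Omega>1: "AE x in M. x \<in> \<Omega>"
    using AE_distrD[OF \<phi> Y1] \<open>AE x in M. x \<notin> N\<close> AE_space by eventually_elim (auto simp: \<Omega>_def)
  have \<Omega>'1: "AE y in M'. y \<in> \<Omega>'"
    using AE_distrD[OF \<phi>' Y1[unfolded d]] \<open>AE y in M'. y \<notin> N'\<close> AE_space by eventually_elim (auto simp: \<Omega>'_def)
  have inj: "inj_on \<phi> \<Omega>" using N(2) by (rule inj_on_subset) (auto simp: \<Omega>_def)
  have inj': "inj_on \<phi>' \<Omega>'" using N'(2) by (rule inj_on_subset) (auto simp: \<Omega>'_def)
  have im: "\<phi> ` \<Omega> = Y" using B_sub by (force simp: \<Omega>_def Y_def)
  have im': "\<phi>' ` \<Omega>' = Y" using B'_sub by (force simp: \<Omega>'_def Y_def)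
  obtain z where z: "z \<in> space M'" using M'.not_empty by blast
  \<comment> \<open>\<open>isomorphism_mod_0\<close> demands a measure preserving map on all of
    \<open>M\<close>, so the null set outside \<open>\<Omega>\<close> is sent to an arbitrary point
    \<open>z\<close>.\<close>
  define \<tau> where "\<tau> x = (if x \<in> \<Omega> then inv_into \<Omega>' \<phi>' (\<phi> x) else z)" for x
  have \<tau>: "\<tau> x \<in> \<Omega>'" "\<phi>' (\<tau> x) = \<phi> x" if "x \<in> \<Omega>" for x
    using that im im' inv_into_into[of "\<phi> x" \<phi>' \<Omega>'] f_inv_into_f[of "\<phi> x" \<phi>' \<Omega>'] by (auto simp: \<tau>_def)
  have bij: "bij_betw \<tau> \<Omega> \<Omega>'"
  proof (rule bij_betw_imageI)
    show "inj_on \<tau> \<Omega>" using inj \<tau>(2) by (metis inj_on_def)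
    show "\<tau> ` \<Omega> = \<Omega>'"
    proof (intro equalityI subsetI)
      fix y assume y: "y \<in> \<Omega>'"
      then obtain x where x: "x \<in> \<Omega>" "\<phi> x = \<phi>' y" using im im' by (metis imageE imageI)
      then have "\<tau> x = y" using inj_onD[OF inj', of "\<tau> x" y] \<tau>[OF x(1)] x y by simp
      with x show "y \<in> \<tau> ` \<Omega>" by auto
    qed (use \<tau> in auto)
  qed
  \<comment> \<open>Preimages under \<open>\<tau>\<close> are rewritten in the form for which
    \<open>vimage_injective_image\<close> gives measurability and measure.\<close>
  have pre: "\<tau> -` A \<inter> \<Omega> = {x\<in>\<Omega>. \<phi> x \<in> \<phi>' ` (A \<inter> \<Omega>')}" for A
  proof (intro equalityI subsetI)
    fix x assume "x \<in> {x\<in>\<Omega>. \<phi> x \<in> \<phi>' ` (A \<inter> \<Omega>')}"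
    then obtain a where a: "x \<in> \<Omega>" "a \<in> A" "a \<in> \<Omega>'" "\<phi> x = \<phi>' a" by auto
    with inj_onD[OF inj', of "\<tau> x" a] \<tau>[of x] show "x \<in> \<tau> -` A \<inter> \<Omega>" by simp
  next
    fix x assume x: "x \<in> \<tau> -` A \<inter> \<Omega>"
    then have "\<tau> x \<in> A \<inter> \<Omega>'" "\<phi> x = \<phi>' (\<tau> x)" using \<tau>[of x] by auto
    with x show "x \<in> {x\<in>\<Omega>. \<phi> x \<in> \<phi>' ` (A \<inter> \<Omega>')}" by blast
  qed
  note 1 = vimage_injective_image[OF M M'(1) perf' \<phi> \<phi>' d \<Omega> \<Omega>1 \<Omega>' \<Omega>'1 inj']
  note 2 = vimage_injective_image[OF M' M(1) perf \<phi>' \<phi> d[symmetric] \<Omega>' \<Omega>'1 \<Omega> \<Omega>1 inj]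
  have ipre: "inv_into \<Omega> \<tau> -` A \<inter> \<Omega>' = {y\<in>\<Omega>'. \<phi>' y \<in> \<phi> ` (A \<inter> \<Omega>)}" for A
  proof (intro equalityI subsetI)
    fix y assume "y \<in> inv_into \<Omega> \<tau> -` A \<inter> \<Omega>'"
    then have y: "inv_into \<Omega> \<tau> y \<in> A" "y \<in> \<Omega>'" by auto
    have "inv_into \<Omega> \<tau> y \<in> \<Omega>" "\<tau> (inv_into \<Omega> \<tau> y) = y"
      using bij y(2) by (auto simp: bij_betw_def intro: inv_into_into f_inv_into_f)
    with y \<tau>(2)[of "inv_into \<Omega> \<tau> y"] show "y \<in> {y\<in>\<Omega>'. \<phi>' y \<in> \<phi> ` (A \<inter> \<Omega>)}" by auto
  next
    fix y assume "y \<in> {y\<in>\<Omega>'. \<phi>' y \<in> \<phi> ` (A \<inter> \<Omega>)}"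
    then obtain x where x: "x \<in> A" "x \<in> \<Omega>" "\<phi>' y = \<phi> x" "y \<in> \<Omega>'" by auto
    then have "\<tau> x = y" using inj_onD[OF inj', of "\<tau> x" y] \<tau>[OF x(2)] x by simp
    moreover have "inv_into \<Omega> \<tau> (\<tau> x) = x" using bij x(2) by (simp add: bij_betw_def)
    ultimately show "y \<in> inv_into \<Omega> \<tau> -` A \<inter> \<Omega>'" using x by auto
  qed
  have mp: "measure_preserving M M' \<tau>"
    unfolding measure_preserving_def
  proof (intro conjI ballI measurableI)
    show "\<tau> x \<in> space M'" if "x \<in> space M" for x
      using \<tau>(1)[of x] \<Omega>'_sub z by (cases "x \<in> \<Omega>") (auto simp: \<tau>_def)
    fix A assume A: "A \<in> sets M'"
    \<comment> \<open>Outside \<open>\<Omega>\<close> the map is constant, so the preimage there is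
      the whole null set or empty.\<close>
    have split: "\<tau> -` A \<inter> space M = (\<tau> -` A \<inter> \<Omega>) \<union> (if z \<in> A then space M - \<Omega> else {})"
      using \<Omega>_sub by (auto simp: \<tau>_def split: if_splits)
    show m: "\<tau> -` A \<inter> space M \<in> sets M"
      unfolding split pre using 1(1)[OF A] by auto
    have "emeasure M (\<tau> -` A \<inter> space M) = emeasure M (\<tau> -` A \<inter> \<Omega>)"
      using \<Omega>1 1(1)[OF A] m by (intro emeasure_eq_AE) (auto simp: pre[symmetric] \<Omega>_sub[THEN subsetD])
    then show "emeasure M (\<tau> -` A \<inter> space M) = emeasure M' A"
      using 1(2)[OF A] by (simp add: pre)
  qed
  have "space (restrict_space M \<Omega>) = \<Omega>" "space (restrict_space M' \<Omega>') = \<Omega>'"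
    using \<Omega>_sub \<Omega>'_sub by (auto simp: space_restrict_space)
  moreover have "measure_preserving (restrict_space M \<Omega>) (restrict_space M' \<Omega>') \<tau>"
    using 1 \<tau>(1) by (intro measure_preserving_restrict_space \<Omega> \<Omega>') (simp_all only: pre)
  moreover have "measure_preserving (restrict_space M' \<Omega>') (restrict_space M \<Omega>) (inv_into \<Omega> \<tau>)"
    using 2 bij by (intro measure_preserving_restrict_space \<Omega> \<Omega>')
      (simp_all only: ipre, auto simp: bij_betw_def intro: inv_into_into)
  ultimately have iso: "measure_isomorphism (restrict_space M \<Omega>) (restrict_space M' \<Omega>') \<tau>"
    using bij by (simp add: measure_isomorphism_def)
  have null: "space M - \<Omega> \<in> null_sets M" "space M' - \<Omega>' \<in> null_sets M'"
    using \<Omega>1 \<Omega>'1 by (auto simp: AE_iff_null set_diff_eq)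
  have "space M - (space M - \<Omega>) = \<Omega>" "space M' - (space M' - \<Omega>') = \<Omega>'" using \<Omega>_sub \<Omega>'_sub by auto
  then have "isomorphism_mod_0 M M' \<tau>"
    unfolding isomorphism_mod_0_def using mp null iso by (metis (no_types))
  moreover have "AE x in M. \<phi>' (\<tau> x) = \<phi> x"
    using \<Omega>1 by eventually_elim (rule \<tau>(2))
  ultimately show ?thesis by (rule that)
qed

text \<open>Twin-freeness makes both factor maps injective off null sets and so yields
  \<open>\<tau>\<close>. The kernels match because \<open>\<phi>'\<close> after
  \<open>\<tau>\<close> is \<open>\<phi>\<close> almost everywhere and \<open>W\<close>,
  \<open>W'\<close> are both pull-backs of the same \<open>V\<close>.\<close>

lemma isomorphic_mod_0_of_hom_density:
  assumes L: "lebesguian_graphon M W" and tf: "almost_twin_free M W"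
    and L': "lebesguian_graphon M' W'" and tf': "almost_twin_free M' W'"
    and dens: "\<And>k E. simple_graph_on k E \<Longrightarrow> hom_density k E M W = hom_density k E M' W'"
  shows "isomorphic_mod_0 M W M' W'"
proof -
  have G: "graphon M W" "lebesgue_space M" and G': "graphon M' W'" "lebesgue_space M'"
    using L L' by (auto simp: lebesguian_graphon_def)
  have M: "prob_space M" "complete_measure M" and M': "prob_space M'" "complete_measure M'"
    using G(2) G'(2) by (auto simp: lebesgue_space_def)
  interpret M: prob_space M by fact
  obtain \<phi> \<phi>' V c where \<phi>: "\<phi> \<in> borel_measurable M" "\<phi>' \<in> borel_measurable M'"
    and d: "distr M borel \<phi> = distr M' borel \<phi>'" and V: "borel_kernel (distr M borel \<phi>) V c"
    and ae: "AE (x, y) in M \<Otimes>\<^sub>M M. W x y = V (\<phi> x) (\<phi> y)"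
    and ae': "AE (x, y) in M' \<Otimes>\<^sub>M M'. W' x y = V (\<phi>' x) (\<phi>' y)"
    by (rule graphons_common_factor[OF G(1) G'(1) dens])
  obtain N where N: "N \<in> null_sets M" "inj_on \<phi> (space M - N)"
    by (rule twin_free_inj_on[where V=V and \<phi>=\<phi>, OF G(1) tf ae])
  obtain N' where N': "N' \<in> null_sets M'" "inj_on \<phi>' (space M' - N')"
    by (rule twin_free_inj_on[where V=V and \<phi>=\<phi>', OF G'(1) tf' ae'])
  obtain \<tau> where iso: "isomorphism_mod_0 M M' \<tau>" and \<tau>: "AE x in M. \<phi>' (\<tau> x) = \<phi> x"
    by (rule isomorphism_mod_0_of_injective_factors[OF M M' perfect_measure_lebesgue_space[OF G(2)]
      perfect_measure_lebesgue_space[OF G'(2)] \<phi> d N N'])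
  have \<tau>m: "\<tau> \<in> M \<rightarrow>\<^sub>M M'" and \<tau>d: "distr M M' \<tau> = M'"
    using iso by (auto simp: isomorphism_mod_0_def measure_preserving_iff_distr)
  have "AE (x, y) in M \<Otimes>\<^sub>M M. W' (\<tau> x) (\<tau> y) = V (\<phi>' (\<tau> x)) (\<phi>' (\<tau> y))"
    by (rule AE_pair_measure_distr[OF M(1) \<tau>m, unfolded \<tau>d, OF ae'])
  moreover have "AE z in M \<Otimes>\<^sub>M M. \<phi>' (\<tau> (fst z)) = \<phi> (fst z)"
  proof (rule AE_distrD[OF measurable_fst])
    show "AE x in distr (M \<Otimes>\<^sub>M M) M fst. \<phi>' (\<tau> x) = \<phi> x"
      unfolding M.distr_pair_fst by (rule \<tau>)
  qed
  moreover have "AE z in M \<Otimes>\<^sub>M M. \<phi>' (\<tau> (snd z)) = \<phi> (snd z)"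
    using AE_pair_swap[OF M.sigma_finite_measure_axioms, of "\<lambda>x y. \<phi>' (\<tau> x) = \<phi> x"] calculation(2)
    by (simp add: split_beta')
  ultimately have "AE (x, y) in M \<Otimes>\<^sub>M M. pull_back W' \<tau> x y = W x y"
    using ae by eventually_elim (auto simp: pull_back_def)
  with iso show ?thesis unfolding isomorphic_mod_0_def by blast
qed

text \<open>Equal densities produce a common factor on \<open>real\<close>, and a common factor on
  any type forces equal densities. Together the two directions show that carriers of an arbitrary
  type \<open>'c\<close> relate no more graphons than \<open>TYPE(real)\<close> does.\<close>

theorem theorem2p1:
  fixes M :: "'a measure" and W :: "'a \<Rightarrow> 'a \<Rightarrow> real"
    and M' :: "'b measure" and W' :: "'b \<Rightarrow> 'b \<Rightarrow> real"
  shows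
    "(lebesguian_graphon M W \<and> almost_twin_free M W \<and>
      lebesguian_graphon M' W' \<and> almost_twin_free M' W' \<longrightarrow>
        ((\<forall>k E. simple_graph_on k E \<longrightarrow> hom_density k E M W = hom_density k E M' W')
          \<longleftrightarrow> isomorphic_mod_0 M W M' W')) \<and>
     (graphon M W \<and> graphon M' W' \<longrightarrow>
        ((\<forall>k E. simple_graph_on k E \<longrightarrow> hom_density k E M W = hom_density k E M' W')
          \<longleftrightarrow> weakly_isomorphic TYPE(real) M W M' W') \<and>
        (weakly_isomorphic TYPE('c) M W M' W' \<longrightarrow>
          (\<forall>k E. simple_graph_on k E \<longrightarrow> hom_density k E M W = hom_density k E M' W')))"
proof (intro conjI impI iffI allI; (elim conjE)?)
  fix k E
  assume "lebesguian_graphon M W" "lebesguian_graphon M' W'"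
    and "isomorphic_mod_0 M W M' W'" "simple_graph_on k E"
  then show "hom_density k E M W = hom_density k E M' W'"
    by (auto simp: lebesguian_graphon_def intro: isomorphic_mod_0_hom_density)
qed (auto intro: isomorphic_mod_0_of_hom_density weakly_isomorphic_of_hom_density weakly_isomorphic_hom_density)

end
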